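(* The points of the Fermat quartic $F_4$ defined over quadratic extensions of $\mathbb{Q}(\zeta_8)$ (including those defined over $\mathbb{Q}(\zeta_8)$ itself) are exactly the following $188$ points: (1) the $12$ cusps $[0:\zeta_4^i:1]$, $[\zeta_4^i:0:1]$, $[\zeta_8\zeta_4^i:1:0]$ ($0\le i\le 3$), defined over $\mathbb{Q}(\zeta_8)$; (2) the $48$ points $[2^{1/4}\zeta_4^i:\zeta_8^{1+2j}:1]$, $[\zeta_8^{1+2j}:2^{1/4}\zeta_4^i:1]$, $[2^{-1/4}\zeta_4^i:2^{-1/4}\zeta_4^j:1]$ ($0\le i,j\le 3$), defined over $\mathbb{Q}(2^{1/4},\zeta_8)$; (3) the $32$ points $[\zeta_3\zeta_8^{1+2i}:\zeta_3^2\zeta_8^{1+2j}:1]$, $[\zeta_3^2\zeta_8^{1+2i}:\zeta_3\zeta_8^{1+2j}:1]$ ($0\le i,j\le3$), defined over $\mathbb{Q}(\zeta_3,\zeta_8)$; (4) with $\alpha=(1+\sqrt{-7})/2$, $\overline{\alpha}=(1-\sqrt{-7})/2$, the $96$ points $[\alpha\zeta_4^i:\overline{\alpha}\zeta_4^j:1]$, $[\overline{\alpha}\zeta_4^i:\alpha\zeta_4^j:1]$, $[\overline{\alpha}\zeta_8^{7+2j}:\zeta_4^3:\alpha\zeta_4^i]$, $[\alpha\zeta_8^{7+2j}:\zeta_4^3:\overline{\alpha}\zeta_4^i]$, $[1:\alpha\zeta_8^{1+2i}:\overline{\alpha}\zeta_8^{2+2j}]$, $[1:\overline{\alpha}\zeta_8^{1+2i}:\alpha\zeta_8^{2+2j}]$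 ($0\le i,j\le 3$), defined over $\mathbb{Q}(\sqrt{-7},\zeta_8)$. In particular the number of such points is $12+48+32+96=188$.
   Context: Fix an embedding $\overline{\mathbb{Q}}\subset\mathbb{C}$; $\zeta_n=\exp(2\pi i/n)$, $2^{1/4}$ is the positive real fourth root of $2$, and $\sqrt{-7}=\sqrt{7}\,\zeta_4$. $F_4\subset\mathbb{P}^2$ is the Fermat quartic $X^4+Y^4=Z^4$ over $\mathbb{Q}$. A point is "defined over a quadratic extension of $\mathbb{Q}(\zeta_8)$" if its field of definition has degree at most $2$ over $\mathbb{Q}(\zeta_8)$. *)

theory Defs
  imports
    Complex_Main
    "HOL-Algebra.Generated_Fields"
    "HOL-Algebra.Embedded_Algebras"
    "HOL-Algebra.Algebraic_Closure_Type"
begin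

section \<open>Constants\<close>

definition zeta :: "nat \<Rightarrow> complex" where
  "zeta n = exp (2 * of_real pi * \<i> / of_nat n)"

definition root4_2 :: complex where
  "root4_2 = complex_of_real (root 4 2)"

definition sqrt_m7 :: complex where
  "sqrt_m7 = complex_of_real (sqrt 7) * zeta 4"

definition alpha :: complex where
  "alpha = (1 + sqrt_m7) / 2"

definition alpha_bar :: complex where
  "alpha_bar = (1 - sqrt_m7) / 2"

section \<open>Number fields inside the complex numbers\<close>

abbreviation C_ring :: "complex ring" where
  "C_ring \<equiv> ring_of_type_algebra"

text \<open>The field of rationals with the elements of \<open>S\<close> adjoined: the prime field need not be
  mentioned, since every subfield of the complex numbers contains the rationals.\<close>

definition Q_adj :: "complex set \<Rightarrow> complex set" where
  "Q_adj S = generate_field C_ring S"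

definition degree_le :: "complex set \<Rightarrow> complex set \<Rightarrow> nat \<Rightarrow> bool" where
  "degree_le K L n \<longleftrightarrow> (\<exists>d\<le>n. ring.dimension C_ring d K L)"

section \<open>The projective plane and the Fermat quartic\<close>

definition proj_rel :: "((complex \<times> complex \<times> complex) \<times> (complex \<times> complex \<times> complex)) set" where
  "proj_rel = {((x, y, z), (x', y', z')) | x y z x' y' z'.
     (x, y, z) \<noteq> (0, 0, 0) \<and> (\<exists>c. c \<noteq> 0 \<and> x' = c * x \<and> y' = c * y \<and> z' = c * z)}"

lemma proj_relI:
  assumes "(x, y, z) \<noteq> (0, 0, 0)" "c \<noteq> 0"
  shows "((x, y, z), (c * x, c * y, c * z)) \<in> proj_rel"
  using assms unfolding proj_rel_def by blast

lemma proj_relE: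
  assumes "(p, q) \<in> proj_rel"
  obtains x y z c where "p = (x, y, z)" "q = (c * x, c * y, c * z)"
    "(x, y, z) \<noteq> (0, 0, 0)" "c \<noteq> 0"
  using assms unfolding proj_rel_def by blast

lemma equiv_proj_rel: "equiv (UNIV - {(0, 0, 0)}) proj_rel"
proof (rule equivI)
  show "proj_rel \<subseteq> (UNIV - {(0, 0, 0)}) \<times> (UNIV - {(0, 0, 0)})"
    by (auto elim!: proj_relE)
  show "refl_on (UNIV - {(0, 0, 0)}) proj_rel"
  proof (rule refl_onI)
    fix p :: "complex \<times> complex \<times> complex"
    assume "p \<in> UNIV - {(0, 0, 0)}"
    then show "(p, p) \<in> proj_rel"
      using proj_relI[of "fst p" "fst (snd p)" "snd (snd p)" 1] by simp
  qed
  show "sym proj_rel"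
  proof (rule symI)
    fix p q assume "(p, q) \<in> proj_rel"
    then obtain x y z c where "p = (x, y, z)" "q = (c * x, c * y, c * z)"
      "(x, y, z) \<noteq> (0, 0, 0)" "c \<noteq> 0"
      by (rule proj_relE)
    then show "(q, p) \<in> proj_rel"
      using proj_relI[of "c * x" "c * y" "c * z" "inverse c"] by (simp flip: mult.assoc)
  qed
  show "trans proj_rel"
  proof (rule transI)
    fix p q r assume pq: "(p, q) \<in> proj_rel" and qr: "(q, r) \<in> proj_rel"
    from pq obtain x y z c where 1: "p = (x, y, z)" "q = (c * x, c * y, c * z)"
      "(x, y, z) \<noteq> (0, 0, 0)" "c \<noteq> 0"
      by (rule proj_relE)
    from qr obtain d where 2: "r = (d * (c * x), d * (c * y), d * (c * z))" "d \<noteq> 0"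
      using 1(2) by (elim proj_relE) blast
    show "(p, r) \<in> proj_rel"
      using proj_relI[of x y z "d * c"] 1 2 by (simp add: mult.assoc)
  qed
qed

definition P2 :: "(complex \<times> complex \<times> complex) set set" where
  "P2 = (UNIV - {(0, 0, 0)}) // proj_rel"

text \<open>The point with homogeneous coordinates \<open>x\<close>, \<open>y\<close>, \<open>z\<close>.\<close>

definition pt :: "complex \<Rightarrow> complex \<Rightarrow> complex \<Rightarrow> (complex \<times> complex \<times> complex) set" where
  "pt x y z = proj_rel `` {(x, y, z)}"

text \<open>Complex points are considered; those of finite degree over a number field are
  automatically points over the algebraic closure of the rationals.\<close>

definition F4 :: "(complex \<times> complex \<times> complex) set set" where
  "F4 = {P \<in> P2. \<forall>(x, y, z) \<in> P. x ^ 4 + y ^ 4 = z ^ 4}"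

text \<open>The field of definition is generated by the ratios of the homogeneous coordinates.\<close>

definition field_of_definition :: "(complex \<times> complex \<times> complex) set \<Rightarrow> complex set" where
  "field_of_definition P =
     Q_adj {a / b | a b x y z. (x, y, z) \<in> P \<and> a \<in> {x, y, z} \<and> b \<in> {x, y, z} \<and> b \<noteq> 0}"

definition defined_over :: "(complex \<times> complex \<times> complex) set \<Rightarrow> complex set \<Rightarrow> bool" where
  "defined_over P K \<longleftrightarrow> field_of_definition P \<subseteq> K"

text \<open>The degree over \<open>K\<close> of the field of definition means that of its compositum with \<open>K\<close>.
  Degree one, that is, \<open>P\<close> being defined over \<open>K\<close> itself, is included.\<close>

definition defined_over_quadratic_ext ::
    "(complex \<times> complex \<times> complex) set \<Rightarrow> complex set \<Rightarrow> bool" where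
  "defined_over_quadratic_ext P K \<longleftrightarrow> degree_le K (Q_adj (K \<union> field_of_definition P)) 2"

section \<open>The four families of points\<close>

definition family1 :: "(complex \<times> complex \<times> complex) set set" where
  "family1 =
     {pt 0 (zeta 4 ^ i) 1 | i. i \<in> {0..3}} \<union>
     {pt (zeta 4 ^ i) 0 1 | i. i \<in> {0..3}} \<union>
     {pt (zeta 8 * zeta 4 ^ i) 1 0 | i. i \<in> {0..3}}"

definition family2 :: "(complex \<times> complex \<times> complex) set set" where
  "family2 =
     {pt (root4_2 * zeta 4 ^ i) (zeta 8 ^ (1 + 2 * j)) 1 | i j. i \<in> {0..3} \<and> j \<in> {0..3}} \<union>
     {pt (zeta 8 ^ (1 + 2 * j)) (root4_2 * zeta 4 ^ i) 1 | i j. i \<in> {0..3} \<and> j \<in> {0..3}} \<union>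
     {pt (inverse root4_2 * zeta 4 ^ i) (inverse root4_2 * zeta 4 ^ j) 1
        | i j. i \<in> {0..3} \<and> j \<in> {0..3}}"

definition family3 :: "(complex \<times> complex \<times> complex) set set" where
  "family3 =
     {pt (zeta 3 * zeta 8 ^ (1 + 2 * i)) (zeta 3 ^ 2 * zeta 8 ^ (1 + 2 * j)) 1
        | i j. i \<in> {0..3} \<and> j \<in> {0..3}} \<union>
     {pt (zeta 3 ^ 2 * zeta 8 ^ (1 + 2 * i)) (zeta 3 * zeta 8 ^ (1 + 2 * j)) 1
        | i j. i \<in> {0..3} \<and> j \<in> {0..3}}"

definition family4 :: "(complex \<times> complex \<times> complex) set set" where
  "family4 =
     {pt (alpha * zeta 4 ^ i) (alpha_bar * zeta 4 ^ j) 1 | i j. i \<in> {0..3} \<and> j \<in> {0..3}} \<union>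
     {pt (alpha_bar * zeta 4 ^ i) (alpha * zeta 4 ^ j) 1 | i j. i \<in> {0..3} \<and> j \<in> {0..3}} \<union>
     {pt (alpha_bar * zeta 8 ^ (7 + 2 * j)) (zeta 4 ^ 3) (alpha * zeta 4 ^ i)
        | i j. i \<in> {0..3} \<and> j \<in> {0..3}} \<union>
     {pt (alpha * zeta 8 ^ (7 + 2 * j)) (zeta 4 ^ 3) (alpha_bar * zeta 4 ^ i)
        | i j. i \<in> {0..3} \<and> j \<in> {0..3}} \<union>
     {pt 1 (alpha * zeta 8 ^ (1 + 2 * i)) (alpha_bar * zeta 8 ^ (2 + 2 * j))
        | i j. i \<in> {0..3} \<and> j \<in> {0..3}} \<union>
     {pt 1 (alpha_bar * zeta 8 ^ (1 + 2 * i)) (alpha * zeta 8 ^ (2 + 2 * j))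
        | i j. i \<in> {0..3} \<and> j \<in> {0..3}}"

end

theory Submission
  imports Defs "HOL-Computational_Algebra.Nth_Powers"
begin

text \<open>
  The curve \<open>y\<^sup>2 = x\<^sup>3 - x\<close> has only \<open>4\<close>-torsion points over \<open>K8 = \<rat>(\<zeta>\<^sub>8)\<close>. Fermat's descent settles the
  curve and its twist by \<open>-2\<close> over \<open>\<rat>\<close>; one climbs to \<open>\<rat>(\<surd>-2)\<close> and then to \<open>K8\<close> by intersecting the
  curve with the line through a point and its conjugate.

  The quartic has three quotients isomorphic to this curve, given by a coordinate \<open>t\<close> on the conic
  \<open>X\<^sup>2 + Y\<^sup>2 = Z\<^sup>2\<close> and its images under two rotations of the octahedron of branch points. Take a point
  over a quadratic extension of \<open>K8\<close>. If \<open>t\<close> lies in \<open>K8\<close>, then one of the three quotients has a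
  point over \<open>K8\<close>, which gives the cusps and the second family. Otherwise the line through the images
  of the point and its conjugate on each quotient passes through a torsion point. If for one quotient
  this has order \<open>2\<close>, conjugation acts on \<open>t\<close> as a half turn of the octahedron. Half turns about
  vertices are impossible and those about edges give the remaining points. If it has order \<open>4\<close> for all
  three, then the norms of \<open>t - v\<close>, for \<open>v\<close> a branch point, have contradictory square classes.
\<close>

section \<open>Congruent numbers\<close>

text \<open>The obstacle is that over a quadratic extension of K8 the curve may have positive rank,
  so its points there cannot be listed. What stays under control is the sum of a point and its
  conjugate: it is defined over K8 and therefore torsion. This is why every argument goes through
  the third intersection of a line with the cubic. One quotient alone does not suffice. When
  \<open>t\<close> lies in K8, the ordinates on the three quotients are square roots of elements of
  K8 whose product is a rational function of \<open>t\<close>; if none were in K8, all would be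
  multiples of the generator \<open>s\<close>, and so would their product. When \<open>t\<close> is
  outside K8, the cubic evaluated at its points of order 2 gives norms of \<open>t - v\<close>
  modulo squares. Each quotient is branched over two of the three pairs of opposite vertices, so
  every pair occurs in two quotients. Multiplying relations from different quotients then eliminates
  the unknown norms and leaves a condition on torsion abscissae only.\<close>

lemma coprime_mult_square_nat:
  fixes a b c :: nat
  assumes "coprime a b" "a * b = c\<^sup>2" "a > 0" "b > 0"
  obtains u v where "a = u\<^sup>2" "b = v\<^sup>2" "u > 0" "v > 0" "c = u * v" "coprime u v"
proof -
  have *: "is_nth_power 2 (a * b)" using assms(2) by auto
  obtain u where u: "a = u\<^sup>2"
    using is_nth_power_mult_coprime_natD(1)[OF assms(1) *] assms(3,4) by (auto elim: is_nth_powerE)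
  obtain v where v: "b = v\<^sup>2"
    using is_nth_power_mult_coprime_natD(2)[OF assms(1) *] assms(3,4) by (auto elim: is_nth_powerE)
  have "(u * v)\<^sup>2 = c\<^sup>2" using assms(2) u v by (simp add: power_mult_distrib)
  then have "c = u * v" by (metis power2_eq_iff_nonneg zero_le)
  moreover have "coprime u v" using assms(1) u v by simp
  ultimately show ?thesis using that u v assms(3,4) by auto
qed

lemma coprime_half_sum_diff:
  fixes c d :: nat
  assumes "odd c" "odd d" "d < c" "coprime c d"
  obtains m n where "c = m + n" "d = m - n" "0 < n" "n < m" "coprime m n"
proof -
  define m where "m = (c + d) div 2"
  define n where "n = (c - d) div 2"
  have "even (c + d)" "even (c - d)" using assms by auto
  then have mn: "2 * m = c + d" "2 * n = c - d" unfolding m_def n_def by auto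
  then have c: "c = m + n" and d: "d = m - n" using assms by auto
  have n: "0 < n" "n < m" using mn assms by (auto intro: Nat.gr0I) (metis add_gr_0 assms(2) odd_pos c d zero_less_diff)
  have "coprime m n"
  proof (rule coprimeI)
    fix l assume "l dvd m" "l dvd n"
    then have "l dvd c" "l dvd d" unfolding c d by (auto intro: dvd_diff_nat)
    then show "is_unit l" using assms(4) coprime_common_divisor by blast
  qed
  then show ?thesis using that c d n by blast
qed

text \<open>The legs of a primitive triple are \<open>2 * p * q\<close> and
  \<open>p^2 - q^2\<close>. Only their product is recorded: it is symmetric in \<open>m\<close> and
  \<open>n\<close>, and it has the shape to which the descent returns.\<close>

lemma pythagorean_coprime:
  fixes m n a :: nat
  assumes "m > 0" "n > 0" "coprime m n" "m\<^sup>2 + n\<^sup>2 = a\<^sup>2"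
  obtains p q where "0 < q" "q < p" "coprime p q" "m * n = 2 * (p * q * (p + q) * (p - q))"
proof -
  note result = that
  have main: thesis if e: "even e" "e > 0" "k > 0" "coprime e k" "e\<^sup>2 + k\<^sup>2 = a\<^sup>2" "m * n = e * k" for e k
  proof -
    have ok: "odd k" using e(1,4) coprime_common_divisor[of e k 2] by auto
    have oa: "odd a" using e(5) ok e(1) by (metis even_add even_power pos2)
    have "k\<^sup>2 < a\<^sup>2" using e(2,5) by (metis less_add_same_cancel2 zero_less_power)
    then have ka: "k < a" using power_less_imp_less_base by blast
    have "coprime a k"
    proof (rule coprimeI)
      fix l assume l: "l dvd a" "l dvd k"
      have "l\<^sup>2 dvd e\<^sup>2" using l e(5) by (metis dvd_add_left_iff dvd_power_same)
      then have "l dvd e" by simp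
      then show "is_unit l" using l(2) e(4) coprime_common_divisor by blast
    qed
    then obtain r s where rs: "a = r + s" "k = r - s" "0 < s" "s < r" "coprime r s"
      using coprime_half_sum_diff[OF oa ok ka] by blast
    obtain f where f: "e = 2 * f" using e(1) by blast
    obtain t where t: "r = s + t" using rs(4) less_imp_add_positive by blast
    \<comment> \<open>\<open>e^2\<close> is the difference of the squares of \<open>r + s\<close>
      and \<open>r - s\<close>, that is \<open>4 * r * s\<close>.\<close>
    have "r * s = f\<^sup>2" using e(5) unfolding rs(1,2) f t by (simp add: power2_eq_square algebra_simps)
    then obtain u v where uv: "r = u\<^sup>2" "s = v\<^sup>2" "u > 0" "v > 0" "f = u * v" "coprime u v"
      using coprime_mult_square_nat[OF rs(5)] rs(3,4) by (metis gr_zeroI not_less_zero)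
    have "v < u" using rs(4) uv by (simp add: power_less_imp_less_base)
    moreover have "m * n = 2 * (u * v * (u + v) * (u - v))"
    proof -
      obtain h where h: "u = v + h" using \<open>v < u\<close> less_imp_add_positive by blast
      have "(u + v) * (u - v) = k" unfolding rs(2) uv(1,2) h by (simp add: power2_eq_square algebra_simps)
      then show ?thesis unfolding e(6) f uv(5) by (simp add: mult.assoc)
    qed
    ultimately show thesis using result uv by blast
  qed
  \<comment> \<open>A sum of two odd squares is 2 modulo 4, hence not a square.\<close>
  have "even m \<or> even n"
  proof (rule ccontr)
    assume "\<not> (even m \<or> even n)"
    then obtain x y where xy: "m = 2 * x + 1" "n = 2 * y + 1" using oddE by metis
    have a2: "a\<^sup>2 = 4 * (x\<^sup>2 + x + y\<^sup>2 + y) + 2"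
      using assms(4) unfolding xy by (simp add: power2_eq_square algebra_simps)
    then have "even a" by (metis even_add even_mult_iff even_numeral even_power)
    then obtain b where "a = 2 * b" by blast
    with a2 show False by (simp add: power2_eq_square) presburger
  qed
  then show thesis
    using main[of m n] main[of n m] assms by (auto simp: ac_simps)
qed

text \<open>This excludes an even \<open>p\<close> in the descent, where \<open>p + q\<close> and
  \<open>p - q\<close> are odd squares with sum \<open>2 * p\<close>.\<close>

lemma square_add_odd_neq:
  fixes c d a :: nat
  assumes "odd c" "odd d" shows "c\<^sup>2 + d\<^sup>2 \<noteq> 4 * a"
proof -
  obtain x y where xy: "c = 2 * x + 1" "d = 2 * y + 1" using assms oddE by metis
  have "c\<^sup>2 + d\<^sup>2 = 4 * (x\<^sup>2 + x + y\<^sup>2 + y) + 2"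
    unfolding xy by (simp add: power2_eq_square algebra_simps)
  then show ?thesis by presburger
qed

text \<open>The coprime factors are squares up to a factor \<open>2\<close>; two Pythagorean triples then lead back to
  the same equation with the same \<open>\<kappa>\<close>, so \<open>x\<^sup>3 - x\<close> is neither a square nor twice a square.\<close>

lemma fermat_descent:
  fixes p q w \<kappa> :: nat
  assumes "\<kappa> = 1 \<or> \<kappa> = 2" "0 < q" "q < p" "coprime p q"
  shows "p * q * (p + q) * (p - q) \<noteq> \<kappa> * w\<^sup>2"
  using assms
proof (induction w arbitrary: p q \<kappa> rule: less_induct)
  case (less w)
  show ?case
  proof
    assume eq: "p * q * (p + q) * (p - q) = \<kappa> * w\<^sup>2"
    have pos: "p * q * (p + q) * (p - q) > 0" using less.prems by simp
    then have w: "w > 0" using eq by (auto intro: Nat.gr0I)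
    show False
    proof (cases "odd p \<and> odd q")
      \<comment> \<open>Passing to the half sum and half difference divides the product by 4, which
        halves \<open>w\<close> and keeps \<open>\<kappa>\<close>.\<close>
      case True
      then obtain m n where mn: "p = m + n" "q = m - n" "0 < n" "n < m" "coprime m n"
        using coprime_half_sum_diff less.prems by blast
      obtain t where t: "m = n + t" using mn(4) less_imp_add_positive by blast
      have 4: "4 * (m * n * (m + n) * (m - n)) = \<kappa> * w\<^sup>2"
        using eq unfolding mn(1,2) t by (simp add: algebra_simps)
      then have "w\<^sup>2 = 2 * (2 * (m * n * (m + n) * (m - n))) \<or> w\<^sup>2 = 2 * (m * n * (m + n) * (m - n))"
        using 4 less.prems(1) by (elim disjE; simp only:; linarith)
      then have "even (w\<^sup>2)" by (metis dvd_triv_left)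
      then obtain v where v: "w = 2 * v" by auto
      then have "m * n * (m + n) * (m - n) = \<kappa> * v\<^sup>2" using 4 by (simp add: power2_eq_square)
      moreover have "v < w" using v w by simp
      ultimately show False using less.IH less.prems(1) mn(3-5) by blast
    next
      case False
      have op: "odd (p + q)" using False less.prems(4) coprime_common_divisor[of p q 2] by auto
      have cs: "coprime (p + q) (p - q)"
      proof (rule coprimeI)
        fix l assume l: "l dvd p + q" "l dvd p - q"
        have "l dvd (p + q) + (p - q)" "l dvd (p + q) - (p - q)" using l by (auto intro: dvd_add dvd_diff_nat)
        then have "l dvd 2 * p" "l dvd 2 * q" using less.prems(3) by (simp_all add: mult_2)
        moreover have "coprime l 2" using l(1) op by (metis coprime_commute coprime_left_2_iff_odd dvd_trans)
        ultimately have "l dvd p" "l dvd q" by (simp_all add: coprime_dvd_mult_right_iff)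
        then show "is_unit l" using less.prems(4) coprime_common_divisor by blast
      qed
      have cop: "coprime a b" if "\<And>l. \<lbrakk>l dvd a; l dvd b\<rbrakk> \<Longrightarrow> l dvd p \<and> l dvd q" for a b
        using that less.prems(4) coprime_common_divisor by (intro coprimeI) blast
      have c1: "coprime p (p + q)" "coprime q (p + q)"
        by (rule cop; simp add: dvd_add_right_iff dvd_add_left_iff)+
      have "q = p - (p - q)" "p = q + (p - q)" using less.prems(3) by simp_all
      then have c2: "coprime p (p - q)" "coprime q (p - q)"
        by (intro cop; metis dvd_diff_nat dvd_add)+
      have od: "odd (p - q)" using op less.prems(3) by simp
      \<comment> \<open>Here \<open>x\<close> and \<open>y\<close> are \<open>p\<close> and
        \<open>q\<close> with the factor \<open>\<kappa>\<close> removed from one of them. The four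
        factors are then pairwise coprime, so each is a square, and \<open>m\<close>,
        \<open>n\<close> are the half sum and half difference of the roots of \<open>p + q\<close>
        and \<open>p - q\<close>.\<close>
      have factor: "\<exists>a b m n. x = a\<^sup>2 \<and> y = b\<^sup>2 \<and> p + q = (m + n)\<^sup>2 \<and> p - q = (m - n)\<^sup>2 \<and> 0 < n \<and> n < m \<and>
          coprime m n \<and> odd (m + n) \<and> odd (m - n) \<and> 0 < b \<and> b \<le> w"
        if h: "x * y * (p + q) * (p - q) = w\<^sup>2" "coprime x y" "x > 0" "y > 0" "x dvd p" "y dvd q" for x y
      proof -
        have 1: "coprime (x * y) ((p + q) * (p - q))"
          using c1 c2 h(5,6) by (auto intro: coprime_divisors[OF _ dvd_refl])
        have 2: "(x * y) * ((p + q) * (p - q)) = w\<^sup>2" using h(1) by (simp add: mult.assoc)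
        have pq: "p + q > 0" "p - q > 0" using less.prems(2,3) by simp_all
        obtain k l where kl: "x * y = k\<^sup>2" "(p + q) * (p - q) = l\<^sup>2" "k > 0" "l > 0" "w = k * l"
          using coprime_mult_square_nat[OF 1 2] h(3,4) pq by (metis nat_0_less_mult_iff)
        obtain a b where ab: "x = a\<^sup>2" "y = b\<^sup>2" "a > 0" "b > 0" "k = a * b"
          using coprime_mult_square_nat[OF h(2) kl(1) h(3,4)] by blast
        obtain c d where cd: "p + q = c\<^sup>2" "p - q = d\<^sup>2" "c > 0" "d > 0" "coprime c d"
          using coprime_mult_square_nat[OF cs kl(2) pq] by metis
        have "d\<^sup>2 < c\<^sup>2" using cd(1,2) less.prems(2,3) by linarith
        then have "d < c" using power_less_imp_less_base by blast
        then obtain m n where mn: "c = m + n" "d = m - n" "0 < n" "n < m" "coprime m n"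
          using coprime_half_sum_diff[of c d] op od cd by auto
        have "b \<le> w" using ab kl by simp
        moreover have "odd c" "odd d" using op od cd(1,2) by auto
        ultimately show ?thesis
          using cd(1,2) mn ab unfolding mn(1,2) by blast
      qed
      \<comment> \<open>Together with \<open>sum_diff\<close> these identities say
        \<open>p = m^2 + n^2\<close> and \<open>q = 2 * m * n\<close>.\<close>
      have odd_ne: "(m + n)\<^sup>2 + (m - n)\<^sup>2 = 2 * (m\<^sup>2 + n\<^sup>2)" "(m + n)\<^sup>2 - (m - n)\<^sup>2 = 4 * (m * n)"
        if nm: "n < m" for m n :: nat
      proof -
        obtain h where h: "m = n + h" using nm less_imp_add_positive by blast
        show "(m + n)\<^sup>2 + (m - n)\<^sup>2 = 2 * (m\<^sup>2 + n\<^sup>2)" "(m + n)\<^sup>2 - (m - n)\<^sup>2 = 4 * (m * n)"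
          unfolding h by (simp_all add: power2_eq_square algebra_simps)
      qed
      have sum_diff: "(p + q) + (p - q) = 2 * p" "(p + q) - (p - q) = 2 * q"
        using less.prems(3) by simp_all
      consider "\<kappa> = 1" | "\<kappa> = 2" "even p" | "\<kappa> = 2" "even q"
      proof -
        have "even (p * q * (p + q) * (p - q))" if "\<kappa> = 2" using eq that by simp
        then show thesis using that less.prems(1) op od by auto
      qed
      then show False
      proof cases
        case 1
        have "p * q * (p + q) * (p - q) = w\<^sup>2" using eq 1 by simp
        then obtain a b m n where h: "p = a\<^sup>2" "q = b\<^sup>2" "p + q = (m + n)\<^sup>2" "p - q = (m - n)\<^sup>2"
          "0 < n" "n < m" "coprime m n" "0 < b" "b \<le> w"
          using factor[of p q] less.prems by force
        \<comment> \<open>As \<open>p\<close> is a square, \<open>m\<close> and \<open>n\<close> are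
          the legs of a triple, and \<open>b^2 = 2 * m * n\<close> is 4 times the new
          product.\<close>
        have "m\<^sup>2 + n\<^sup>2 = a\<^sup>2" using sum_diff(1) odd_ne(1)[OF h(6)] h(1,3,4) by simp
        then obtain u v where uv: "0 < v" "v < u" "coprime u v" "m * n = 2 * (u * v * (u + v) * (u - v))"
          using pythagorean_coprime[of m n a] h(5-7) less_trans by metis
        have b2: "2 * (m * n) = b\<^sup>2" using sum_diff(2) odd_ne(2)[OF h(6)] h(2-4) by simp
        then have "even b" by (metis dvd_triv_left even_power)
        then obtain b' where b': "b = 2 * b'" by blast
        have "u * v * (u + v) * (u - v) = 1 * b'\<^sup>2"
          using b2 uv(4) unfolding b' by (simp add: power2_eq_square mult.assoc)
        moreover have "b' < w" using b' h(8,9) by simp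
        ultimately show False using less.IH uv(1-3) by blast
      next
        case 2
        then obtain p' where p': "p = 2 * p'" by blast
        have "p' * q * (p + q) * (p - q) = w\<^sup>2" using eq 2(1) unfolding p' by (simp add: mult.assoc)
        moreover have "coprime p' q" "p' dvd p" "p' > 0" using less.prems p' by (auto intro!: Nat.gr0I)
        ultimately obtain a m n where h: "p' = a\<^sup>2" "p + q = (m + n)\<^sup>2" "p - q = (m - n)\<^sup>2" "odd (m + n)" "odd (m - n)"
          using factor[of p' q] less.prems(2) by force
        show False using square_add_odd_neq[OF h(4,5), of p'] sum_diff(1) h(2,3) p' by simp
      next
        case 3
        then obtain q' where q': "q = 2 * q'" by blast
        have "p * q * (p + q) * (p - q) = 2 * (p * q' * (p + q) * (p - q))"
          using arg_cong[OF q', of "\<lambda>y. p * y * (p + q) * (p - q)"] by (simp only: ac_simps)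
        then have "p * q' * (p + q) * (p - q) = w\<^sup>2" using eq 3(1) by simp
        moreover have "coprime p q'" "q' dvd q" "q' > 0" using less.prems q' by (auto intro!: Nat.gr0I)
        ultimately obtain a b m n where h: "p = a\<^sup>2" "q' = b\<^sup>2" "p + q = (m + n)\<^sup>2" "p - q = (m - n)\<^sup>2"
          "0 < n" "n < m" "coprime m n" "0 < b" "b \<le> w"
          using factor[of p q'] less.prems(2,3) by force
        \<comment> \<open>The same triple, now with \<open>q = 2 * b^2\<close>: here
          \<open>b^2 = m * n\<close> is twice the new product, so the factor 2 reappears.\<close>
        have "m\<^sup>2 + n\<^sup>2 = a\<^sup>2" using sum_diff(1) odd_ne(1)[OF h(6)] h(1,3,4) by simp
        then obtain u v where uv: "0 < v" "v < u" "coprime u v" "m * n = 2 * (u * v * (u + v) * (u - v))"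
          using pythagorean_coprime[of m n a] h(5-7) less_trans by metis
        have b2: "m * n = b\<^sup>2" using sum_diff(2) odd_ne(2)[OF h(6)] h(2-4) q' by simp
        then have "even b" using uv(4) by (metis dvd_triv_left even_power)
        then obtain b' where b': "b = 2 * b'" by blast
        have "m * n = 4 * b'\<^sup>2" using b2 unfolding b' by (simp add: power_mult_distrib)
        then have "u * v * (u + v) * (u - v) = 2 * b'\<^sup>2" using uv(4) by linarith
        moreover have "b' < w" using b' h(8,9) by simp
        ultimately show False using less.IH uv(1-3) by blast
      qed
    qed
  qed
qed

lemma fermat_descent_int:
  fixes p q z \<kappa> :: int
  assumes "\<kappa> = 1 \<or> \<kappa> = 2" "q > 0" "coprime p q" "p * q * (p + q) * (p - q) = \<kappa> * z\<^sup>2"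
  shows "z = 0"
proof (rule ccontr)
  assume z: "z \<noteq> 0"
  have descent: False if h: "0 < b" "b < a" "coprime a b" "a * b * (a + b) * (a - b) = \<kappa> * z\<^sup>2" for a b :: int
  proof -
    obtain m n where mn: "a = int m" "b = int n"
      using h(1,2) by (metis less_trans zero_less_imp_eq_int)
    obtain k where k: "\<kappa> = int k" "k = 1 \<or> k = 2" using assms(1) by force
    have "int (m * n * (m + n) * (m - n)) = int (k * (nat \<bar>z\<bar>)\<^sup>2)"
      using h(2,4) unfolding mn k(1) by (simp add: of_nat_diff)
    then have "m * n * (m + n) * (m - n) = k * (nat \<bar>z\<bar>)\<^sup>2" by (simp only: of_nat_eq_iff)
    then show False using fermat_descent[OF k(2), of n m "nat \<bar>z\<bar>"] h(1-3) unfolding mn by simp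
  qed
  have pos: "p * q * (p + q) * (p - q) > 0" using assms(1,4) z by auto
  then have ne: "p \<noteq> 0" "p \<noteq> q" "p \<noteq> - q" by auto
  consider "q < p" | "0 < p" "p < q" | "- q < p" "p < 0" | "p < - q" using ne by linarith
  then show False
  proof cases
    case 1 then show ?thesis using descent[of q p] assms(2-4) by simp
  next
    case 2
    then have "p * q * (p + q) * (p - q) < 0" using assms(2) by (simp add: mult_pos_neg)
    then show ?thesis using pos by simp
  next
    case 3
    \<comment> \<open>Replacing \<open>p / q\<close> by \<open>- q / p\<close> is translation by the
      point (0, 0). It moves the compact real component, where \<open>p / q\<close> is between -1
      and 0, to the unbounded one.\<close>
    have "q * (-p) * (q + -p) * (q - -p) = \<kappa> * z\<^sup>2" using assms(4) by (simp add: algebra_simps)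
    moreover have "coprime q (-p)" using assms(3) by (simp add: coprime_commute)
    ultimately show ?thesis using descent[of "-p" q] 3 by simp
  next
    case 4
    have "(p * q) * ((p + q) * (p - q)) < 0"
      using 4 assms(2) by (intro mult_neg_pos mult_neg_neg) (auto simp: mult_neg_pos)
    then show ?thesis using pos by (simp add: mult.assoc)
  qed
qed

lemma congruent_curve_rat:
  fixes x y :: rat and \<kappa> :: int
  assumes "\<kappa> = 1 \<or> \<kappa> = 2" "of_int \<kappa> * y\<^sup>2 = x ^ 3 - x"
  shows "y = 0"
proof -
  obtain p q where x: "x = of_int p / of_int q" "q > 0" "coprime p q"
    by (metis Fract_of_int_quotient Rat_cases)
  \<comment> \<open>Multiplying the equation by \<open>q^4\<close> keeps the left side
    \<open>\<kappa>\<close> times a square and turns the right side into the quartic form of the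
    descent.\<close>
  define z where "z = y * (of_int q)\<^sup>2"
  obtain u v where z: "z = of_int u / of_int v" "v > 0" "coprime u v"
    by (metis Fract_of_int_quotient Rat_cases)
  have q0: "(of_int q :: rat) \<noteq> 0" using x(2) by simp
  have v0: "(of_int v :: rat) \<noteq> 0" using z(2) by simp
  have "of_int \<kappa> * z\<^sup>2 = (x ^ 3 - x) * (of_int q) ^ 4"
    unfolding z_def assms(2)[symmetric] by (simp add: power_mult_distrib)
  also have "\<dots> = of_int (p * q * (p + q) * (p - q))"
    unfolding x(1) using q0 by (simp add: field_simps power2_eq_square power3_eq_cube power4_eq_xxxx)
  finally have N: "of_int \<kappa> * z\<^sup>2 = of_int (p * q * (p + q) * (p - q))" .
  then have "(of_int (\<kappa> * u\<^sup>2) :: rat) = of_int (p * q * (p + q) * (p - q) * v\<^sup>2)"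
    unfolding z(1) using v0 by (simp add: field_simps)
  then have uv: "\<kappa> * u\<^sup>2 = p * q * (p + q) * (p - q) * v\<^sup>2" by (simp only: of_int_eq_iff)
  \<comment> \<open>Since \<open>\<kappa>\<close> is squarefree, \<open>z\<close> can have no
    denominator.\<close>
  then have "v\<^sup>2 dvd \<kappa> * u\<^sup>2" by simp
  moreover have "coprime (v\<^sup>2) (u\<^sup>2)" using z(3) by (simp add: coprime_commute)
  ultimately have "v\<^sup>2 dvd \<kappa>" by (simp add: coprime_dvd_mult_left_iff)
  then have v2: "v\<^sup>2 \<le> 2" using assms(1) zdvd_imp_le[of "v\<^sup>2" \<kappa>] by auto
  have "v = 1"
  proof (rule ccontr)
    assume "v \<noteq> 1"
    then have "2\<^sup>2 \<le> v\<^sup>2" using z(2) by (intro power_mono) auto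
    then show False using v2 by simp
  qed
  then have "u = 0" using fermat_descent_int[OF assms(1) x(2,3), of u] uv by simp
  then show ?thesis using z(1) q0 unfolding z_def by simp
qed

section \<open>Quadratic extensions\<close>

locale complex_subfield =
  fixes K :: "complex set"
  assumes one_closed [simp, intro]: "1 \<in> K"
    and diff_closed [simp, intro]: "\<lbrakk>x \<in> K; y \<in> K\<rbrakk> \<Longrightarrow> x - y \<in> K"
    and mult_closed [simp, intro]: "\<lbrakk>x \<in> K; y \<in> K\<rbrakk> \<Longrightarrow> x * y \<in> K"
    and inverse_closed [simp, intro]: "x \<in> K \<Longrightarrow> inverse x \<in> K"
begin

lemma zero_closed [simp, intro]: "0 \<in> K"
  using diff_closed[of 1 1] by simp

lemma uminus_closed [simp, intro]: "x \<in> K \<Longrightarrow> - x \<in> K"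
  using diff_closed[of 0 x] by simp

lemma add_closed [simp, intro]: "\<lbrakk>x \<in> K; y \<in> K\<rbrakk> \<Longrightarrow> x + y \<in> K"
  using diff_closed[of x "- y"] by simp

lemma divide_closed [simp, intro]: "\<lbrakk>x \<in> K; y \<in> K\<rbrakk> \<Longrightarrow> x / y \<in> K"
  by (simp add: divide_inverse)

lemma power_closed [simp, intro]: "x \<in> K \<Longrightarrow> x ^ n \<in> K"
  by (induction n) auto

lemma of_nat_closed [simp, intro]: "of_nat n \<in> K"
  by (induction n) auto

lemma numeral_closed [simp, intro]: "numeral n \<in> K"
  using of_nat_closed[of "numeral n"] by simp

lemma of_rat_closed: "of_rat r \<in> K"
proof -
  have "of_int k \<in> K" for k by (cases k) (auto simp del: of_nat_Suc)
  then show ?thesis by (cases r) (auto simp: of_rat_rat)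
qed

end

lemma complex_subfield_Rats: "complex_subfield \<rat>"
  by unfold_locales auto

locale quadratic_extension = complex_subfield +
  fixes s :: complex
  assumes s_notin: "s \<notin> K" and s_square: "s\<^sup>2 \<in> K"
begin

definition L :: "complex set" where
  "L = {a + b * s | a b. a \<in> K \<and> b \<in> K}"

lemma L_I [intro]: "\<lbrakk>a \<in> K; b \<in> K\<rbrakk> \<Longrightarrow> a + b * s \<in> L"
  unfolding L_def by blast

lemma L_E:
  assumes "z \<in> L" obtains a b where "a \<in> K" "b \<in> K" "z = a + b * s"
  using assms unfolding L_def by blast

lemma coords_unique:
  assumes "a \<in> K" "b \<in> K" "a' \<in> K" "b' \<in> K" "a + b * s = a' + b' * s"
  shows "a = a'" "b = b'"
proof -
  show b: "b = b'"
  proof (rule ccontr)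
    assume "b \<noteq> b'"
    then have "s = (a' - a) / (b - b')" using assms(5) by (simp add: field_simps)
    then show False using s_notin assms by simp
  qed
  then show "a = a'" using assms(5) by simp
qed

definition conj :: "complex \<Rightarrow> complex" where
  "conj z = (THE w. \<exists>a\<in>K. \<exists>b\<in>K. z = a + b * s \<and> w = a - b * s)"

lemma conj_eq:
  assumes "a \<in> K" "b \<in> K" shows "conj (a + b * s) = a - b * s"
  unfolding conj_def
proof (rule the_equality)
  fix w assume "\<exists>a'\<in>K. \<exists>b'\<in>K. a + b * s = a' + b' * s \<and> w = a' - b' * s"
  then obtain a' b' where *: "a' \<in> K" "b' \<in> K" "a + b * s = a' + b' * s" "w = a' - b' * s" by blast
  show "w = a - b * s" using coords_unique[OF assms *(1-3)] *(4) by simp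
qed (use assms in blast)

lemma K_subset_L: "K \<subseteq> L"
  using L_I[of _ 0] by auto

lemma K_in_L [simp, intro]: "a \<in> K \<Longrightarrow> a \<in> L"
  using K_subset_L by blast

lemma s_in_L [simp, intro]: "s \<in> L"
  using L_I[of 0 1] by simp

lemma conj_K [simp]: "a \<in> K \<Longrightarrow> conj a = a"
  using conj_eq[of a 0] by simp

lemma conj_s [simp]: "conj s = - s"
  using conj_eq[of 0 1] by simp

lemma s_mult_s: "s * s \<in> K"
  using s_square by (simp add: power2_eq_square)

lemma
  assumes "z \<in> L" "w \<in> L"
  shows conj_diff [simp]: "conj (z - w) = conj z - conj w" and diff_L: "z - w \<in> L"
    and conj_mult [simp]: "conj (z * w) = conj z * conj w" and mult_L: "z * w \<in> L"
proof -
  obtain a b c d where *: "a \<in> K" "b \<in> K" "z = a + b * s" "c \<in> K" "d \<in> K" "w = c + d * s"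
    using assms by (metis L_E)
  have 1: "z - w = (a - c) + (b - d) * s" using * by (simp add: algebra_simps)
  have 2: "z * w = (a * c + b * d * (s * s)) + (a * d + b * c) * s" using * by (simp add: algebra_simps)
  have c: "conj z = a - b * s" "conj w = c - d * s" using * by (simp_all add: conj_eq)
  have K: "a - c \<in> K" "b - d \<in> K" "a * c + b * d * (s * s) \<in> K" "a * d + b * c \<in> K"
    using *(1,2,4,5) s_mult_s by simp_all
  show "z - w \<in> L" unfolding 1 by (rule L_I[OF K(1,2)])
  show "conj (z - w) = conj z - conj w"
    unfolding 1 conj_eq[OF K(1,2)] c by (simp add: algebra_simps)
  show "z * w \<in> L" unfolding 2 by (rule L_I[OF K(3,4)])
  show "conj (z * w) = conj z * conj w"
    unfolding 2 conj_eq[OF K(3,4)] c by (simp add: algebra_simps)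
qed

lemma conj_L [simp, intro]:
  assumes "z \<in> L" shows "conj z \<in> L"
proof -
  obtain a b where *: "a \<in> K" "b \<in> K" "z = a + b * s" using assms by (elim L_E)
  then have "conj z = a + (- b) * s" by (simp add: conj_eq)
  then show ?thesis using *(1,2) by (simp only: L_I uminus_closed)
qed

lemma conj_conj [simp]:
  assumes "z \<in> L" shows "conj (conj z) = z"
proof -
  obtain a b where *: "a \<in> K" "b \<in> K" "z = a + b * s" using assms by (elim L_E)
  then have "conj z = a + (- b) * s" by (simp add: conj_eq)
  then have "conj (conj z) = a - (- b) * s" using conj_eq[of a "- b"] *(1,2) by simp
  then show ?thesis using * by simp
qed

lemma trace_norm_K: "z \<in> L \<Longrightarrow> z + conj z \<in> K" "z \<in> L \<Longrightarrow> z * conj z \<in> K"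
proof -
  assume "z \<in> L"
  then obtain a b where *: "a \<in> K" "b \<in> K" "z = a + b * s" by (elim L_E)
  have "z + conj z = 2 * a" "z * conj z = a * a - b * b * (s * s)"
    using * by (simp_all add: conj_eq algebra_simps)
  moreover have "2 * a \<in> K" "a * a - b * b * (s * s) \<in> K" using *(1,2) s_mult_s by simp_all
  ultimately show "z + conj z \<in> K" "z * conj z \<in> K" by simp_all
qed

lemma conj_eq_0_iff [simp]: "z \<in> L \<Longrightarrow> conj z = 0 \<longleftrightarrow> z = 0"
proof
  assume "z \<in> L" "conj z = 0"
  then have "conj (conj z) = 0" by simp
  then show "z = 0" by (rule trans[OF conj_conj[OF \<open>z \<in> L\<close>, symmetric]])
qed simp

lemma conj_fixed_iff: "z \<in> L \<Longrightarrow> conj z = z \<longleftrightarrow> z \<in> K"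
proof
  assume "z \<in> L" "conj z = z"
  then have "z = (z + conj z) / 2" by simp
  moreover have "(z + conj z) / 2 \<in> K" using trace_norm_K(1)[OF \<open>z \<in> L\<close>] by blast
  ultimately show "z \<in> K" by simp
qed simp

sublocale L: complex_subfield L
proof
  fix z assume z: "z \<in> L"
  show "inverse z \<in> L"
  proof (cases "z = 0")
    case False
    then have "conj z \<noteq> 0" using z by simp
    then have "inverse z = conj z * inverse (z * conj z)"
      by (simp only: inverse_mult_distrib mult.left_commute[of "conj z"] right_inverse mult_1_right not_False_eq_True)
    moreover have "inverse (z * conj z) \<in> L" using trace_norm_K(2)[OF z] by blast
    ultimately show ?thesis using mult_L[OF conj_L[OF z]] by (simp only:)
  qed simp
qed (rule diff_L mult_L K_in_L[OF one_closed]; assumption)+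

lemma conj_uminus [simp]: "z \<in> L \<Longrightarrow> conj (- z) = - conj z"
  using conj_diff[of 0 z] by simp

lemma conj_add [simp]: "\<lbrakk>z \<in> L; w \<in> L\<rbrakk> \<Longrightarrow> conj (z + w) = conj z + conj w"
  using conj_diff[of z "- w"] by simp

lemma conj_inverse [simp]: "z \<in> L \<Longrightarrow> conj (inverse z) = inverse (conj z)"
proof (cases "z = 0")
  case False
  assume z: "z \<in> L"
  have "conj z * conj (inverse z) = 1"
    using z False by (simp flip: conj_mult)
  then show ?thesis by (metis inverse_unique)
qed simp

lemma conj_divide [simp]: "\<lbrakk>z \<in> L; w \<in> L\<rbrakk> \<Longrightarrow> conj (z / w) = conj z / conj w"
  by (simp add: divide_inverse)

lemma conj_power [simp]: "z \<in> L \<Longrightarrow> conj (z ^ n) = conj z ^ n"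
  by (induction n) auto

text \<open>Conjugation multiplies such a \<open>z\<close> by 1 or by -1.\<close>

lemma square_in_K:
  assumes "z \<in> L" "z\<^sup>2 \<in> K" shows "z \<in> K \<or> z / s \<in> K"
proof -
  have "(conj z)\<^sup>2 = z\<^sup>2" using assms conj_power[OF assms(1), of 2] by simp
  then consider "conj z = z" | "conj z = - z" by (metis power2_eq_iff)
  then show ?thesis
  proof cases
    case 2
    then have "conj (z / s) = z / s" using assms by simp
    then show ?thesis using conj_fixed_iff[of "z / s"] assms by simp
  qed (use conj_fixed_iff assms in auto)
qed

lemma s_nonzero: "s \<noteq> 0"
  using s_notin by auto

text \<open>The line through a point and its conjugate is defined over \<open>K\<close>, hence so is its third
  intersection \<open>r\<close> with the cubic.\<close>

lemma third_intersection:
  assumes x: "x \<in> L" "x \<notin> K" and y: "y \<in> L" "y\<^sup>2 = x ^ 3 - x"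
  obtains m c r where "m \<in> K" "c \<in> K" "r \<in> K" "y = m * x + c" "(m * r + c)\<^sup>2 = r ^ 3 - r"
    "\<And>T. T ^ 3 - T - (m * T + c)\<^sup>2 = (T - x) * (T - conj x) * (T - r)"
proof -
  have ne: "x - conj x \<noteq> 0" using x conj_fixed_iff[OF x(1)] by simp
  define m where "m = (y - conj y) / (x - conj x)"
  define c where "c = y - m * x"
  \<comment> \<open>By Vieta the three abscissae sum to the square of the slope.\<close>
  define r where "r = m\<^sup>2 - x - conj x"
  have mL: "m \<in> L" unfolding m_def using x y by simp
  have "conj m = (conj y - y) / (conj x - x)" unfolding m_def using x y by simp
  also have "\<dots> = m" unfolding m_def using minus_divide_divide[of "y - conj y" "x - conj x"] by simp
  finally have cm: "conj m = m" .
  then have m: "m \<in> K" using conj_fixed_iff[OF mL] by simp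
  have mx: "m * (x - conj x) = y - conj y" unfolding m_def using ne by simp
  have cy: "conj y = m * conj x + c" using mx unfolding c_def by (simp add: algebra_simps)
  have "conj c = conj y - m * conj x" unfolding c_def using x y mL cm by simp
  also have "\<dots> = c" using cy by simp
  finally have c: "c \<in> K" using conj_fixed_iff[of c] x y mL unfolding c_def by simp
  have "r = m\<^sup>2 - (x + conj x)" unfolding r_def by simp
  then have r: "r \<in> K" using m trace_norm_K(1)[OF x(1)] by simp
  have yx: "y = m * x + c" unfolding c_def by simp
  have e1: "x ^ 3 - x = (m * x + c)\<^sup>2" using y(2) yx by simp
  have "conj x ^ 3 - conj x = conj (x ^ 3 - x)" using x by simp
  also have "\<dots> = conj y ^ 2" unfolding y(2)[symmetric] by (rule conj_power[OF y(1)])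
  finally have e2: "conj x ^ 3 - conj x = (m * conj x + c)\<^sup>2" unfolding cy .
  define x' where "x' = conj x"
  \<comment> \<open>Subtracting the two equations and cancelling \<open>x - x'\<close> expresses the
    coefficient \<open>2 * m * c\<close> through the abscissae and the slope.\<close>
  have "(x - x') * (x\<^sup>2 + x * x' + x'\<^sup>2 - 1) = (x ^ 3 - x) - (x' ^ 3 - x')"
    by (simp add: algebra_simps power2_eq_square power3_eq_cube)
  also have "\<dots> = (x - x') * (m\<^sup>2 * (x + x') + 2 * m * c)"
    unfolding e1 e2[folded x'_def] by (simp add: algebra_simps power2_eq_square)
  finally have "x\<^sup>2 + x * x' + x'\<^sup>2 - 1 = m\<^sup>2 * (x + x') + 2 * m * c"
    using ne unfolding x'_def by simp
  then have e3: "2 * m * c = x\<^sup>2 + x * x' + x'\<^sup>2 - 1 - m\<^sup>2 * (x + x')" by (simp add: algebra_simps)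
  have "c\<^sup>2 = (m * x + c)\<^sup>2 - m\<^sup>2 * x\<^sup>2 - (2 * m * c) * x"
    by (simp add: algebra_simps power2_eq_square)
  also have "\<dots> = x * x' * r" unfolding e1[symmetric] e3 r_def x'_def[symmetric]
    by (simp add: algebra_simps power2_eq_square power3_eq_cube)
  finally have e4: "c\<^sup>2 = x * x' * r" .
  have key: "T ^ 3 - T - (m * T + c)\<^sup>2 = (T - x) * (T - x') * (T - r)" for T
  proof -
    have "T ^ 3 - T - (m * T + c)\<^sup>2 = T ^ 3 - T - m\<^sup>2 * T\<^sup>2 - (2 * m * c) * T - c\<^sup>2"
      by (simp add: algebra_simps power2_eq_square)
    then show ?thesis unfolding e3 e4 unfolding r_def x'_def[symmetric]
      by (simp add: algebra_simps power2_eq_square power3_eq_cube)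
  qed
  have "(m * r + c)\<^sup>2 = r ^ 3 - r" using key[of r] by simp
  then show thesis using that[OF m c r yx _ key[unfolded x'_def]] by blast
qed

text \<open>\<open>2 * x + B\<close> is a square root of the discriminant that lies in
  \<open>L\<close> but not in \<open>K\<close>, hence a \<open>K\<close>-multiple of
  \<open>s\<close>.\<close>

lemma quadratic_root_coords:
  assumes "x \<in> L" "x \<notin> K" "B \<in> K" "C \<in> K" "x\<^sup>2 + B * x + C = 0"
  obtains n where "n \<in> K" "n \<noteq> 0" "B\<^sup>2 - 4 * C = s\<^sup>2 * n\<^sup>2"
proof -
  have "(2 * x + B)\<^sup>2 = 4 * (x\<^sup>2 + B * x + C) + (B\<^sup>2 - 4 * C)"
    by (simp add: power2_eq_square algebra_simps)
  then have eq: "(2 * x + B)\<^sup>2 = B\<^sup>2 - 4 * C" using assms(5) by simp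
  have L: "2 * x + B \<in> L" using assms by simp
  have "2 * x + B \<notin> K"
  proof
    assume "2 * x + B \<in> K"
    then have "(2 * x + B - B) / 2 \<in> K" using assms(3) by blast
    then show False using assms(2) by simp
  qed
  then have "(2 * x + B) / s \<in> K" using square_in_K[OF L] assms unfolding eq by auto
  moreover have "(2 * x + B) / s \<noteq> 0" using \<open>2 * x + B \<notin> K\<close> s_nonzero by auto
  moreover have "B\<^sup>2 - 4 * C = s\<^sup>2 * ((2 * x + B) / s)\<^sup>2"
    using s_nonzero by (simp add: power_divide eq)
  ultimately show thesis using that by blast
qed

text \<open>In each case the discriminant of the quadratic satisfied by \<open>x\<close> is a point of an isogenous
  curve, which the dual isogeny maps back to a point of the \<open>s\<^sup>2\<close>-twist.\<close>

lemma congruent_curve_L: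
  assumes K0: "\<And>x y. \<lbrakk>x \<in> K; y \<in> K; y\<^sup>2 = x ^ 3 - x\<rbrakk> \<Longrightarrow> y = 0"
    and K1: "\<And>x y. \<lbrakk>x \<in> K; y \<in> K; s\<^sup>2 * y\<^sup>2 = x ^ 3 - x\<rbrakk> \<Longrightarrow> y = 0"
    and xy: "x \<in> L" "y \<in> L" "y\<^sup>2 = x ^ 3 - x"
  shows "y = 0 \<or> x\<^sup>2 = -1 \<or> (x - 1)\<^sup>2 = 2 \<or> (x + 1)\<^sup>2 = 2"
proof (cases "x \<in> K")
  case True
  then have "y\<^sup>2 \<in> K" using xy(3) by simp
  then consider "y \<in> K" | "y / s \<in> K" using square_in_K[OF xy(2)] by blast
  then show ?thesis
  proof cases
    case 1 then show ?thesis using K0[OF True _ xy(3)] by blast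
  next
    case 2
    have "s\<^sup>2 * (y / s)\<^sup>2 = x ^ 3 - x" using xy(3) s_nonzero by (simp add: power_divide)
    then show ?thesis using K1[OF True 2] s_nonzero by simp
  qed
next
  case False
  obtain m c r where mcr: "m \<in> K" "c \<in> K" "r \<in> K" "y = m * x + c" "(m * r + c)\<^sup>2 = r ^ 3 - r"
    using third_intersection[OF xy(1) False xy(2,3)] by metis
  \<comment> \<open>By \<open>K0\<close> the third point has ordinate 0, so the line passes through
    one of the points of order 2.\<close>
  have c: "c = - (m * r)" using K0[OF mcr(3) _ mcr(5)] mcr(1-3) by (simp add: eq_neg_iff_add_eq_0 add.commute)
  have "r * (r\<^sup>2 - 1) = 0" using mcr(5) unfolding c by (simp add: power3_eq_cube power2_eq_square algebra_simps)
  then have "r = 0 \<or> r = 1 \<or> r = -1" by (simp add: power2_eq_1_iff)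
  then consider "r = 0" | "r = 1" | "r = -1" by blast
  then show ?thesis
  proof cases
    case 1
    have "x * (x\<^sup>2 + (- m\<^sup>2) * x + (- 1)) = 0"
      using xy(3) unfolding mcr(4) c 1 by (simp add: power2_eq_square power3_eq_cube algebra_simps)
    then have q: "x\<^sup>2 + (- m\<^sup>2) * x + (- 1) = 0" using False by auto
    obtain n where n: "n \<in> K" "n \<noteq> 0" "(- m\<^sup>2)\<^sup>2 - 4 * (- 1) = s\<^sup>2 * n\<^sup>2"
      using quadratic_root_coords[OF xy(1) False _ _ q] mcr(1) by (metis one_closed power_closed uminus_closed)
    show ?thesis
    proof (cases "m = 0")
      case True then show ?thesis using mcr(4) c by simp
    next
      case m: False
      \<comment> \<open>The discriminant relation puts \<open>(m^2, m * s * n)\<close> on the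
        isogenous curve \<open>Y^2 = X^3 + 4 * X\<close>. The dual isogeny sends
        \<open>(X, Y)\<close> to \<open>(Y^2 / (4 * X^2), Y * (X^2 - 4) / (8 * X^2))\<close>; the
        ordinate of the image is \<open>s\<close> times the number called \<open>Y\<close>
        below.\<close>
      define U where "U = s\<^sup>2 * n\<^sup>2 / (4 * m\<^sup>2)"
      define Y where "Y = n * (m ^ 4 - 4) / (8 * m ^ 3)"
      have U: "U = (m ^ 4 + 4) / (4 * m\<^sup>2)" unfolding U_def n(3)[symmetric] by simp
      have "U\<^sup>2 - 1 = (m ^ 4 - 4)\<^sup>2 / (4 * m\<^sup>2)\<^sup>2"
        unfolding U using m by (simp add: field_simps) (simp add: power2_eq_square power4_eq_xxxx algebra_simps)
      then have "U ^ 3 - U = U * ((m ^ 4 - 4)\<^sup>2 / (4 * m\<^sup>2)\<^sup>2)"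
        by (simp add: power3_eq_cube power2_eq_square algebra_simps)
      also have "\<dots> = s\<^sup>2 * Y\<^sup>2"
        unfolding U_def Y_def using m by (simp add: power2_eq_square power3_eq_cube)
      finally have "Y = 0" using K1[of U Y] mcr(1) n(1) s_square unfolding U_def Y_def by simp
      then have "(m\<^sup>2)\<^sup>2 = 2\<^sup>2" unfolding Y_def using n(2) m by simp
      then have "m\<^sup>2 = 2 \<or> m\<^sup>2 = - 2" by (simp only: power2_eq_iff)
      then show ?thesis
      proof
        assume "m\<^sup>2 = 2"
        moreover have "(x - 1)\<^sup>2 = x\<^sup>2 + (- 2) * x + (- 1) + 2"
          by (simp add: power2_eq_square algebra_simps)
        ultimately show ?thesis using q by simp
      next
        assume "m\<^sup>2 = - 2"
        moreover have "(x + 1)\<^sup>2 = x\<^sup>2 + (- (- 2)) * x + (- 1) + 2"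
          by (simp add: power2_eq_square algebra_simps)
        ultimately show ?thesis using q by simp
      qed
    qed
  next
    case 2
    have "(x - 1) * ((x - 1)\<^sup>2 + (3 - m\<^sup>2) * (x - 1) + 2) = 0"
      using xy(3) unfolding mcr(4) c 2 by (simp add: power2_eq_square power3_eq_cube algebra_simps)
    then have q: "(x - 1)\<^sup>2 + (3 - m\<^sup>2) * (x - 1) + 2 = 0" using False by auto
    have x1: "x - 1 \<in> L" "x - 1 \<notin> K" using xy(1) False add_closed[of "x - 1" 1] by auto
    obtain n where n: "n \<in> K" "n \<noteq> 0" "(3 - m\<^sup>2)\<^sup>2 - 4 * 2 = s\<^sup>2 * n\<^sup>2"
      using quadratic_root_coords[OF x1 _ _ q] mcr(1) by (metis diff_closed numeral_closed power_closed)
    show ?thesis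
    proof (cases "m = 0")
      case True then show ?thesis using mcr(4) c by simp
    next
      case m: False
      \<comment> \<open>In the coordinate \<open>x - 1\<close> the cubic is
        \<open>X * (X + 1) * (X + 2)\<close>. The isogenous curve is
        \<open>Y^2 = X^3 - 6 * X^2 + X\<close>, again with the point of abscissa
        \<open>m^2\<close>.\<close>
      define Z where "Z = s\<^sup>2 * n\<^sup>2 / (4 * m\<^sup>2)"
      define Y where "Y = n * (m\<^sup>2 - 1) * (m\<^sup>2 + 1) / (8 * m ^ 3)"
      have Z: "Z = ((3 - m\<^sup>2)\<^sup>2 - 8) / (4 * m\<^sup>2)" unfolding Z_def n(3)[symmetric] by simp
      have Z1: "Z + 1 = (m\<^sup>2 - 1)\<^sup>2 / (4 * m\<^sup>2)" "Z + 2 = (m\<^sup>2 + 1)\<^sup>2 / (4 * m\<^sup>2)"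
        unfolding Z using m by (simp_all add: field_simps) (simp_all add: power2_eq_square algebra_simps)
      have "(Z + 1) ^ 3 - (Z + 1) = Z * (Z + 1) * (Z + 2)"
        by (simp add: power3_eq_cube algebra_simps)
      also have "\<dots> = s\<^sup>2 * Y\<^sup>2"
        unfolding Z1 unfolding Z_def Y_def using m by (simp add: power2_eq_square power3_eq_cube)
      finally have "Y = 0" using K1[of "Z + 1" Y] mcr(1) n(1) s_square unfolding Z_def Y_def by simp
      then have "m\<^sup>2 = 1 \<or> m\<^sup>2 = - 1" unfolding Y_def using n(2) m by (auto simp: eq_neg_iff_add_eq_0)
      then show ?thesis
      proof
        assume "m\<^sup>2 = 1"
        moreover have "x\<^sup>2 = ((x - 1)\<^sup>2 + (3 - 1) * (x - 1) + 2) - 1"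
          by (simp add: power2_eq_square algebra_simps)
        ultimately show ?thesis using q by simp
      next
        assume "m\<^sup>2 = - 1"
        moreover have "(x + 1)\<^sup>2 = ((x - 1)\<^sup>2 + (3 - - 1) * (x - 1) + 2) + 2"
          by (simp add: power2_eq_square algebra_simps)
        ultimately show ?thesis using q by simp
      qed
    qed
  next
    case 3
    have "(x + 1) * ((x + 1)\<^sup>2 + (- 3 - m\<^sup>2) * (x + 1) + 2) = 0"
      using xy(3) unfolding mcr(4) c 3 by (simp add: power2_eq_square power3_eq_cube algebra_simps)
    then have q: "(x + 1)\<^sup>2 + (- 3 - m\<^sup>2) * (x + 1) + 2 = 0" using False
      by (metis eq_neg_iff_add_eq_0 mult_eq_0_iff one_closed uminus_closed)
    have x1: "x + 1 \<in> L" "x + 1 \<notin> K" using xy(1) False diff_closed[of "x + 1" 1] by auto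
    obtain n where n: "n \<in> K" "n \<noteq> 0" "(- 3 - m\<^sup>2)\<^sup>2 - 4 * 2 = s\<^sup>2 * n\<^sup>2"
      using quadratic_root_coords[OF x1 _ _ q] mcr(1) by (metis diff_closed numeral_closed power_closed uminus_closed)
    show ?thesis
    proof (cases "m = 0")
      case True then show ?thesis using mcr(4) c by simp
    next
      case m: False
      \<comment> \<open>In the coordinate \<open>x + 1\<close> the cubic is
        \<open>X * (X - 1) * (X - 2)\<close>, and the isogenous curve is
        \<open>Y^2 = X^3 + 6 * X^2 + X\<close>.\<close>
      define Z where "Z = s\<^sup>2 * n\<^sup>2 / (4 * m\<^sup>2)"
      define Y where "Y = n * (m\<^sup>2 - 1) * (m\<^sup>2 + 1) / (8 * m ^ 3)"
      have Z: "Z = ((3 + m\<^sup>2)\<^sup>2 - 8) / (4 * m\<^sup>2)" unfolding Z_def n(3)[symmetric]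
        by (simp add: power2_eq_square algebra_simps)
      have Z1: "Z - 1 = (m\<^sup>2 + 1)\<^sup>2 / (4 * m\<^sup>2)" "Z - 2 = (m\<^sup>2 - 1)\<^sup>2 / (4 * m\<^sup>2)"
        unfolding Z using m by (simp_all add: field_simps) (simp_all add: power2_eq_square algebra_simps)
      have "(Z - 1) ^ 3 - (Z - 1) = Z * (Z - 1) * (Z - 2)"
        by (simp add: power3_eq_cube algebra_simps)
      also have "\<dots> = s\<^sup>2 * Y\<^sup>2"
        unfolding Z1 unfolding Z_def Y_def using m by (simp add: power2_eq_square power3_eq_cube)
      finally have "Y = 0" using K1[of "Z - 1" Y] mcr(1) n(1) s_square unfolding Z_def Y_def by simp
      then have "m\<^sup>2 = 1 \<or> m\<^sup>2 = - 1" unfolding Y_def using n(2) m by (auto simp: eq_neg_iff_add_eq_0)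
      then show ?thesis
      proof
        assume "m\<^sup>2 = 1"
        moreover have "(x - 1)\<^sup>2 = ((x + 1)\<^sup>2 + (- 3 - 1) * (x + 1) + 2) + 2"
          by (simp add: power2_eq_square algebra_simps)
        ultimately show ?thesis using q by simp
      next
        assume "m\<^sup>2 = - 1"
        moreover have "x\<^sup>2 = ((x + 1)\<^sup>2 + (- 3 - - 1) * (x + 1) + 2) - 1"
          by (simp add: power2_eq_square algebra_simps)
        ultimately show ?thesis using q by simp
      qed
    qed
  qed
qed

end

section \<open>The eighth cyclotomic field\<close>

lemma C_ring_inv:
  assumes "x \<noteq> (0 :: complex)" shows "inv\<^bsub>C_ring\<^esub> x = inverse x"
proof -
  interpret F: field C_ring by (rule field_from_type_algebra)
  show ?thesis using assms by (intro F.comm_inv_char) (auto simp: ring_of_type_algebra_def)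
qed

lemma C_ring_minus: "\<ominus>\<^bsub>C_ring\<^esub> x = - (x :: complex)"
proof -
  interpret F: field C_ring by (rule field_from_type_algebra)
  show ?thesis
    using F.add.inv_equality[of "- x" x] unfolding a_inv_def by (simp add: ring_of_type_algebra_def)
qed

lemma complex_subfield_Q_adj: "complex_subfield (Q_adj S)"
proof -
  note intros = generate_field.intros[where R = C_ring and H = S]
  have add: "x + y \<in> Q_adj S" if "x \<in> Q_adj S" "y \<in> Q_adj S" for x y
    using intros(5)[of x y] that unfolding Q_adj_def by (simp add: ring_of_type_algebra_def)
  have min: "- x \<in> Q_adj S" if "x \<in> Q_adj S" for x
    using intros(3)[of x] that unfolding Q_adj_def C_ring_minus by simp
  have one: "1 \<in> Q_adj S"
    using intros(1) unfolding Q_adj_def by (simp add: ring_of_type_algebra_def)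
  show ?thesis
  proof
    show "x - y \<in> Q_adj S" if "x \<in> Q_adj S" "y \<in> Q_adj S" for x y
      using add[OF that(1) min[OF that(2)]] by simp
    show "x * y \<in> Q_adj S" if "x \<in> Q_adj S" "y \<in> Q_adj S" for x y
      using intros(6)[of x y] that unfolding Q_adj_def by (simp add: ring_of_type_algebra_def)
    show "inverse x \<in> Q_adj S" if "x \<in> Q_adj S" for x
    proof (cases "x = 0")
      case False
      then show ?thesis using intros(4)[of x] that C_ring_inv[OF False] unfolding Q_adj_def
        by (simp add: ring_of_type_algebra_def)
    qed (use that in simp)
  qed (rule one)
qed

lemma Q_adj_incl: "S \<subseteq> Q_adj S"
  unfolding Q_adj_def by (auto intro: generate_field.incl)

lemma Q_adj_minimal:
  assumes "complex_subfield M" "S \<subseteq> M" shows "Q_adj S \<subseteq> M"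
proof
  interpret complex_subfield M by fact
  fix x assume "x \<in> Q_adj S"
  then have "x \<in> generate_field C_ring S" unfolding Q_adj_def .
  then show "x \<in> M"
  proof induction
    case (m_inv h)
    then show ?case using C_ring_inv[of h] by (simp add: ring_of_type_algebra_def)
  qed (use assms(2) in \<open>auto simp: C_ring_minus, auto simp: ring_of_type_algebra_def\<close>)
qed

section \<open>The tower from the rationals over Q(sqrt(-2)) to K8\<close>

definition rt2 :: complex where "rt2 = complex_of_real (sqrt 2)"

lemma rt2_square: "rt2\<^sup>2 = 2" "rt2 * rt2 = 2"
  unfolding rt2_def by (simp_all flip: of_real_power of_real_mult)

lemma rt2_nonzero [simp]: "rt2 \<noteq> 0"
  using rt2_square by auto

lemma no_rat_square_eq_2: "(q :: rat)\<^sup>2 \<noteq> 2"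
proof
  assume q: "q\<^sup>2 = 2"
  obtain a b where ab: "q = of_int a / of_int b" "b > 0" "coprime a b"
    by (metis Fract_of_int_quotient Rat_cases)
  have "(of_int (a\<^sup>2) :: rat) = of_int (2 * b\<^sup>2)" using q ab by (simp add: field_simps)
  then have eq: "a\<^sup>2 = 2 * b\<^sup>2" by (simp only: of_int_eq_iff)
  then have "even a" by (metis dvd_triv_left even_power)
  then obtain c where "a = 2 * c" by blast
  then have "b\<^sup>2 = 2 * c\<^sup>2" using eq by (simp add: power2_eq_square)
  then have "even b" by (metis dvd_triv_left even_power)
  then show False using ab(3) \<open>even a\<close> coprime_common_divisor[of a b 2] by simp
qed

lemma Rats_square_neq:
  assumes "z \<in> (\<rat> :: complex set)"
  shows "z\<^sup>2 \<noteq> 2" "z\<^sup>2 \<noteq> -1" "2 * z\<^sup>2 \<noteq> 1"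
proof -
  obtain q where q: "z = of_rat q" using assms by (elim Rats_cases)
  have *: "(of_rat a :: complex) = of_rat b \<longleftrightarrow> a = b" for a b by simp
  show "z\<^sup>2 \<noteq> 2" using no_rat_square_eq_2[of q] *[of "q\<^sup>2" 2] unfolding q
    by (simp add: of_rat_power)
  have "q\<^sup>2 \<noteq> -1" by (metis zero_le_power2 not_one_le_zero neg_0_le_iff_le)
  then show "z\<^sup>2 \<noteq> -1" using *[of "q\<^sup>2" "-1"] unfolding q by (simp add: of_rat_power of_rat_minus)
  have "2 * q\<^sup>2 \<noteq> 1"
  proof
    assume "2 * q\<^sup>2 = 1"
    then have "(2 * q)\<^sup>2 = 2" by (simp add: power2_eq_square)
    then show False using no_rat_square_eq_2 by blast
  qed
  then show "2 * z\<^sup>2 \<noteq> 1" using *[of "2 * q\<^sup>2" 1] unfolding q by (simp add: of_rat_power of_rat_mult)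
qed

definition rtm2 :: complex where "rtm2 = \<i> * rt2"

lemma rtm2_square: "rtm2\<^sup>2 = - 2"
  unfolding rtm2_def by (simp add: power_mult_distrib rt2_square)

text \<open>The square root of -2 comes first because it brings neither i nor sqrt 2. Over Q(i) and
  over Q(sqrt 2) the curve has points of order 4, with abscissae i and 1 + sqrt 2, and the
  hypothesis \<open>K0\<close> of \<open>congruent_curve_L\<close> would fail for the second
  step.\<close>

interpretation Q2: quadratic_extension \<rat> "rtm2"
proof (intro quadratic_extension.intro quadratic_extension_axioms.intro complex_subfield_Rats)
  show "rtm2 \<notin> \<rat>"
  proof
    assume "rtm2 \<in> \<rat>"
    then obtain q where "rtm2 = of_rat q" by (elim Rats_cases)
    moreover have "Im (of_rat q :: complex) = 0" by (cases q) (simp add: of_rat_rat)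
    ultimately have "Im rtm2 = 0" by simp
    then show False unfolding rtm2_def rt2_def by simp
  qed
  show "rtm2\<^sup>2 \<in> \<rat>" by (simp add: rtm2_square)
qed

lemma Q2_square_neq:
  assumes "z \<in> Q2.L" shows "z\<^sup>2 \<noteq> 2" "z\<^sup>2 \<noteq> -1"
proof -
  \<comment> \<open>For \<open>z = q * rtm2\<close> with \<open>q\<close> rational, the two values
    would make \<open>q^2\<close> equal to -1 and to 1/2 respectively.\<close>
  have *: "2 * (z / rtm2)\<^sup>2 = - z\<^sup>2"
    by (simp add: power_divide rtm2_square)
  show "z\<^sup>2 \<noteq> 2"
  proof
    assume 2: "z\<^sup>2 = 2"
    then have "z \<in> \<rat> \<or> z / rtm2 \<in> \<rat>" using Q2.square_in_K[OF assms] by simp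
    moreover have "2 * (z / rtm2)\<^sup>2 = 2 * (- 1)" using * 2 by simp
    then have "(z / rtm2)\<^sup>2 = -1" by (simp only: mult_cancel_left) simp
    ultimately show False using Rats_square_neq 2 by blast
  qed
  show "z\<^sup>2 \<noteq> -1"
  proof
    assume 2: "z\<^sup>2 = -1"
    then have "z \<in> \<rat> \<or> z / rtm2 \<in> \<rat>" using Q2.square_in_K[OF assms] by simp
    moreover have "2 * (z / rtm2)\<^sup>2 = 1" using * 2 by simp
    ultimately show False using Rats_square_neq 2 by blast
  qed
qed

interpretation K8: quadratic_extension Q2.L \<i>
proof (intro quadratic_extension.intro quadratic_extension_axioms.intro Q2.L.complex_subfield_axioms)
  show "\<i> \<notin> Q2.L" using Q2_square_neq(2)[of \<i>] by auto
  show "\<i>\<^sup>2 \<in> Q2.L" by simp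
qed

abbreviation K8 :: "complex set" where "K8 \<equiv> K8.L"

lemma rt2_eq: "rt2 = - \<i> * rtm2"
  unfolding rtm2_def by simp

lemma rt2_in_K8 [simp, intro]: "rt2 \<in> K8"
  unfolding rt2_eq by (intro K8.L.mult_closed K8.L.uminus_closed K8.s_in_L K8.K_in_L Q2.s_in_L)

lemma conj_rt2: "K8.conj rt2 = - rt2"
  unfolding rt2_eq by (simp add: Q2.s_in_L)

lemma zeta_4: "zeta 4 = \<i>"
proof -
  have "zeta 4 = cis (pi / 2)" unfolding zeta_def cis_conv_exp by (simp add: field_simps)
  then show ?thesis by simp
qed

lemma zeta_8: "zeta 8 = (1 + \<i>) / rt2"
proof -
  have "zeta 8 = cis (pi / 4)" unfolding zeta_def cis_conv_exp by (simp add: field_simps)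
  also have "\<dots> = of_real (sqrt 2 / 2) * (1 + \<i>)"
    by (simp add: complex_eq_iff cos_45 sin_45)
  also have "\<dots> = (rt2 / 2) * (1 + \<i>)" unfolding rt2_def by simp
  also have "\<dots> = (1 + \<i>) / rt2" using rt2_square by (simp add: field_simps)
  finally show ?thesis .
qed

lemma zeta_8_square: "(zeta 8)\<^sup>2 = \<i>"
  unfolding zeta_8 power_divide rt2_square by (simp add: power2_eq_square algebra_simps)

lemma Q_adj_zeta_8: "Q_adj {zeta 8} = K8"
proof
  have "zeta 8 \<in> K8" unfolding zeta_8 by simp
  then show "Q_adj {zeta 8} \<subseteq> K8"
    by (intro Q_adj_minimal K8.L.complex_subfield_axioms) simp
  interpret Q: complex_subfield "Q_adj {zeta 8}" by (rule complex_subfield_Q_adj)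
  have z: "zeta 8 \<in> Q_adj {zeta 8}" using Q_adj_incl by blast
  have i: "\<i> \<in> Q_adj {zeta 8}" using Q.power_closed[OF z, of 2] zeta_8_square by simp
  have "zeta 8 * rt2 = 1 + \<i>" unfolding zeta_8 by simp
  moreover have "zeta 8 \<noteq> 0" using zeta_8_square by auto
  ultimately have "rt2 = (1 + \<i>) / zeta 8" by (simp add: field_simps)
  moreover have "(1 + \<i>) / zeta 8 \<in> Q_adj {zeta 8}" using z i by simp
  ultimately have "rt2 \<in> Q_adj {zeta 8}" by simp
  then have r: "rtm2 \<in> Q_adj {zeta 8}" unfolding rtm2_def using i by simp
  have Rats: "\<rat> \<subseteq> Q_adj {zeta 8}" using Q.of_rat_closed by (auto elim: Rats_cases)
  show "K8 \<subseteq> Q_adj {zeta 8}"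
  proof
    fix z assume "z \<in> K8"
    then obtain a b where ab: "a \<in> Q2.L" "b \<in> Q2.L" "z = a + b * \<i>" by (rule K8.L_E)
    obtain c d where "c \<in> \<rat>" "d \<in> \<rat>" "a = c + d * rtm2" using ab(1) by (rule Q2.L_E)
    moreover obtain e f where "e \<in> \<rat>" "f \<in> \<rat>" "b = e + f * rtm2" using ab(2) by (rule Q2.L_E)
    ultimately have "a \<in> Q_adj {zeta 8}" "b \<in> Q_adj {zeta 8}"
      using Rats by (simp_all add: subset_iff r)
    then show "z \<in> Q_adj {zeta 8}" unfolding ab(3) by (intro Q.add_closed Q.mult_closed i)
  qed
qed

section \<open>The elliptic curve over the tower\<close>

lemma congruent_curve_Rats:
  assumes "x \<in> \<rat>" "y \<in> \<rat>" "\<kappa> = 1 \<or> \<kappa> = 2" "of_int \<kappa> * y\<^sup>2 = x ^ 3 - (x :: complex)"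
  shows "y = 0"
proof -
  obtain p q where pq: "x = of_rat p" "y = of_rat q" using assms(1,2) by (auto elim!: Rats_cases)
  have "(of_rat (of_int \<kappa> * q\<^sup>2) :: complex) = of_rat (p ^ 3 - p)"
    using assms(4) unfolding pq by (simp add: of_rat_mult of_rat_power of_rat_diff)
  then have "of_int \<kappa> * q\<^sup>2 = p ^ 3 - p" by (simp only: of_rat_eq_iff)
  then show ?thesis using congruent_curve_rat[OF assms(3)] pq(2) by simp
qed

text \<open>The two descents supply the hypotheses of the climb, the twist by -2 becoming that by 2
  under \<open>x\<close> to \<open>- x\<close>. A point of order 4 would yield a square root of -1
  or of 2.\<close>

lemma congruent_curve_Q2:
  assumes "x \<in> Q2.L" "y \<in> Q2.L" "y\<^sup>2 = x ^ 3 - x" shows "y = 0"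
proof -
  have 1: "y = 0" if "x \<in> \<rat>" "y \<in> \<rat>" "y\<^sup>2 = x ^ 3 - x" for x y :: complex
    using congruent_curve_Rats[of x y 1] that by simp
  have 2: "y = 0" if "x \<in> \<rat>" "y \<in> \<rat>" "rtm2\<^sup>2 * y\<^sup>2 = x ^ 3 - x" for x y :: complex
  proof -
    have "2 * y\<^sup>2 = (- x) ^ 3 - (- x)" using that(3) by (simp add: rtm2_square algebra_simps)
    then show ?thesis using congruent_curve_Rats[of "- x" y 2] that by simp
  qed
  have "y = 0 \<or> x\<^sup>2 = -1 \<or> (x - 1)\<^sup>2 = 2 \<or> (x + 1)\<^sup>2 = 2"
    by (rule Q2.congruent_curve_L[OF 1 2 assms])
  moreover have "x - 1 \<in> Q2.L" "x + 1 \<in> Q2.L" using assms(1) by simp_all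
  ultimately show ?thesis using Q2_square_neq assms(1) by blast
qed

text \<open>The twist by the square -1 of the new generator is the curve itself under
  \<open>x\<close> to \<open>- x\<close>, so \<open>congruent_curve_Q2\<close> serves for both
  hypotheses of the climb. The points of order 4 cannot be excluded any more, as they are defined
  over K8.\<close>

lemma congruent_curve_K8:
  assumes "x \<in> K8" "y \<in> K8" "y\<^sup>2 = x ^ 3 - x"
  shows "y = 0 \<or> x\<^sup>2 = -1 \<or> (x - 1)\<^sup>2 = 2 \<or> (x + 1)\<^sup>2 = 2"
proof (rule K8.congruent_curve_L[OF congruent_curve_Q2 _ assms])
  fix x y assume "x \<in> Q2.L" "y \<in> Q2.L" "\<i>\<^sup>2 * y\<^sup>2 = x ^ 3 - x"
  then have "y\<^sup>2 = (- x) ^ 3 - (- x)" by (simp add: algebra_simps)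
  then show "y = 0" using congruent_curve_Q2[of "- x" y] \<open>x \<in> Q2.L\<close> \<open>y \<in> Q2.L\<close> by simp
qed

text \<open>The norms of the first three numbers to Q(sqrt(-2)) are 2, -1 and 2, which are not
  squares there. The norm of \<open>rt2\<close> is -2, a square, so this number is treated by
  coordinates.\<close>

lemma K8_square_neq:
  assumes "w \<in> K8"
  shows "w\<^sup>2 \<noteq> 1 + \<i>" "w\<^sup>2 \<noteq> 1 + rt2" "w\<^sup>2 \<noteq> 2 + rt2" "w\<^sup>2 \<noteq> rt2"
proof -
  have N: "w * K8.conj w \<in> Q2.L" using K8.trace_norm_K(2)[OF assms] .
  have N2: "(w * K8.conj w)\<^sup>2 = w\<^sup>2 * K8.conj (w\<^sup>2)" using assms by (simp add: power_mult_distrib)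
  have i: "\<i> \<in> K8" by (rule K8.s_in_L)
  show "w\<^sup>2 \<noteq> 1 + \<i>"
    using Q2_square_neq(1)[OF N] unfolding N2 using i by (auto simp: algebra_simps)
  show "w\<^sup>2 \<noteq> 1 + rt2"
    using Q2_square_neq(2)[OF N] unfolding N2 by (auto simp: conj_rt2 rt2_square algebra_simps)
  show "w\<^sup>2 \<noteq> 2 + rt2"
    using Q2_square_neq(1)[OF N] unfolding N2 by (auto simp: conj_rt2 rt2_square algebra_simps)
  show "w\<^sup>2 \<noteq> rt2"
  proof
    assume w: "w\<^sup>2 = rt2"
    obtain u v where uv: "u \<in> Q2.L" "v \<in> Q2.L" "w = u + v * \<i>" using assms by (rule K8.L_E)
    have "(u\<^sup>2 - v\<^sup>2) + (2 * u * v) * \<i> = w\<^sup>2" unfolding uv(3) by (simp add: power2_eq_square algebra_simps)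
    also have "\<dots> = 0 + (- rtm2) * \<i>" unfolding w rt2_eq by simp
    finally have "u\<^sup>2 - v\<^sup>2 = 0" "2 * u * v = - rtm2"
      using K8.coords_unique[of "u\<^sup>2 - v\<^sup>2" "2 * u * v" 0 "- rtm2"] uv by (auto simp: Q2.s_in_L)
    then have "u = v \<or> u = - v" by (metis eq_iff_diff_eq_0 power2_eq_iff)
    then have "2 * u\<^sup>2 = - rtm2 \<or> 2 * u\<^sup>2 = rtm2"
      using \<open>2 * u * v = - rtm2\<close> by (auto simp: power2_eq_square mult.assoc)
    \<comment> \<open>Taking the norm to the rationals makes 2 the square of the rational number
      \<open>2 * (u * Q2.conj u)\<close>.\<close>
    then have "(2 * u\<^sup>2) * Q2.conj (2 * u\<^sup>2) = 2"
      using rtm2_square by (elim disjE) (simp_all only: Q2.conj_uminus[OF Q2.s_in_L] Q2.conj_s, simp_all add: power2_eq_square)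
    then have "(2 * (u * Q2.conj u))\<^sup>2 = 2" using uv(1) by (simp add: power2_eq_square algebra_simps)
    moreover have "2 * (u * Q2.conj u) \<in> \<rat>" using Q2.trace_norm_K(2)[OF uv(1)] by simp
    ultimately show False using Rats_square_neq(1) by blast
  qed
qed

section \<open>Square classes\<close>

definition same_sq_class :: "complex \<Rightarrow> complex \<Rightarrow> bool" where
  "same_sq_class a b \<longleftrightarrow> (\<exists>u\<in>K8. u \<noteq> 0 \<and> a = b * u\<^sup>2)"

lemma same_sq_classI: "\<lbrakk>u \<in> K8; u \<noteq> 0; a = b * u\<^sup>2\<rbrakk> \<Longrightarrow> same_sq_class a b"
  unfolding same_sq_class_def by blast

lemma same_sq_class_sym: "same_sq_class a b \<Longrightarrow> same_sq_class b a"
  unfolding same_sq_class_def by (elim bexE, rule_tac x = "inverse u" in bexI) (auto simp: field_simps)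

lemma same_sq_class_trans: "\<lbrakk>same_sq_class a b; same_sq_class b c\<rbrakk> \<Longrightarrow> same_sq_class a c"
  unfolding same_sq_class_def by (elim bexE, rule_tac x = "u * ua" in bexI) (auto simp: field_simps)

lemma same_sq_class_mult: "\<lbrakk>same_sq_class a b; same_sq_class c d\<rbrakk> \<Longrightarrow> same_sq_class (a * c) (b * d)"
  unfolding same_sq_class_def by (elim bexE, rule_tac x = "u * ua" in bexI) (auto simp: field_simps)

lemma same_sq_class_1_neq:
  "\<not> same_sq_class (1 + \<i>) 1" "\<not> same_sq_class (1 + rt2) 1" "\<not> same_sq_class (2 + rt2) 1" "\<not> same_sq_class rt2 1"
  using K8_square_neq unfolding same_sq_class_def by fastforce+

lemma zeta_8_in_K8 [simp, intro]: "zeta 8 \<in> K8"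
  unfolding zeta_8 by simp

lemma zeta_8_nonzero [simp]: "zeta 8 \<noteq> 0"
  unfolding zeta_def by simp

lemma zeta_8_power_4: "zeta 8 ^ 4 = - 1"
proof -
  have "zeta 8 ^ 4 = ((zeta 8)\<^sup>2)\<^sup>2" by (simp flip: power_mult)
  then show ?thesis by (simp add: zeta_8_square)
qed

lemma shifted_square_eq_2:
  assumes "(x - 1)\<^sup>2 = 2 \<or> (x + 1)\<^sup>2 = 2"
  shows "x \<in> {1 + rt2, 1 - rt2, - 1 + rt2, - 1 - rt2}"
proof -
  have "x - 1 = rt2 \<or> x - 1 = - rt2 \<or> x + 1 = rt2 \<or> x + 1 = - rt2"
    using assms unfolding rt2_square(1)[symmetric] power2_eq_iff by blast
  then have "x = 1 + rt2 \<or> x = 1 - rt2 \<or> x = - 1 + rt2 \<or> x = - 1 - rt2"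
    by (elim disjE) (simp_all add: diff_eq_eq eq_diff_eq[symmetric])
  then show ?thesis by blast
qed

text \<open>Modulo squares signs disappear, since -1 is the square of i. Moreover
  \<open>rt2 - 1\<close> is the inverse of \<open>1 + rt2\<close>, and its square also carries
  \<open>2 + rt2\<close> to \<open>2 - rt2\<close>, so one multiplier relates all
  conjugates.\<close>

lemma same_sq_class_torsion:
  assumes "(r - 1)\<^sup>2 = 2 \<or> (r + 1)\<^sup>2 = 2"
  shows "same_sq_class r (1 + rt2)" "same_sq_class (r + 1) rt2 \<or> same_sq_class (r + 1) (2 + rt2)" "same_sq_class (r - 1) rt2 \<or> same_sq_class (r - 1) (2 + rt2)"
proof -
  have nz: "rt2 - 1 \<noteq> 0" using rt2_square by auto
  have refl: "same_sq_class a a" for a by (rule same_sq_classI[of 1]) auto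
  have neg: "same_sq_class (- a) a" for a by (rule same_sq_classI[of \<i>]) auto
  have inv: "same_sq_class (rt2 - 1) (1 + rt2)" "same_sq_class (2 - rt2) (2 + rt2)"
    by (rule same_sq_classI[of "rt2 - 1"], use nz in \<open>auto simp: power2_eq_square algebra_simps rt2_square\<close>)+
  have neg': "same_sq_class (1 - rt2) (1 + rt2)" "same_sq_class (rt2 - 2) (2 + rt2)" "same_sq_class (- 1 - rt2) (1 + rt2)" "same_sq_class (- 2 - rt2) (2 + rt2)"
    using same_sq_class_trans[OF neg inv(1)] same_sq_class_trans[OF neg inv(2)] neg[of "1 + rt2"] neg[of "2 + rt2"] by simp_all
  consider "r = 1 + rt2" "r + 1 = 2 + rt2" "r - 1 = rt2" | "r = 1 - rt2" "r + 1 = 2 - rt2" "r - 1 = - rt2"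
    | "r = rt2 - 1" "r + 1 = rt2" "r - 1 = rt2 - 2" | "r = - 1 - rt2" "r + 1 = - rt2" "r - 1 = - 2 - rt2"
    using shifted_square_eq_2[OF assms] by force
  then have "same_sq_class r (1 + rt2) \<and> (same_sq_class (r + 1) rt2 \<or> same_sq_class (r + 1) (2 + rt2)) \<and> (same_sq_class (r - 1) rt2 \<or> same_sq_class (r - 1) (2 + rt2))"
  proof cases
    case 1 show ?thesis unfolding 1(2,3) unfolding 1(1) using refl by blast
  next
    case 2 show ?thesis unfolding 2(2,3) unfolding 2(1) using inv neg' neg[of rt2] by blast
  next
    case 3 show ?thesis unfolding 3(2,3) unfolding 3(1) using inv neg' refl[of rt2] by blast
  next
    case 4 show ?thesis unfolding 4(2,3) unfolding 4(1) using neg' neg[of rt2] by blast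
  qed
  then show "same_sq_class r (1 + rt2)" "same_sq_class (r + 1) rt2 \<or> same_sq_class (r + 1) (2 + rt2)" "same_sq_class (r - 1) rt2 \<or> same_sq_class (r - 1) (2 + rt2)"
    by blast+
qed

text \<open>Since i is the square of \<open>zeta 8\<close>, all powers of i are squares in K8;
  \<open>r\<close> is such a power, and \<open>r + 1\<close> and \<open>r - 1\<close> are such
  powers times 1 + i.\<close>

lemma same_sq_class_torsion_i:
  assumes "r\<^sup>2 = -1"
  shows "same_sq_class r 1" "same_sq_class (r + 1) (1 + \<i>)" "same_sq_class (r - 1) (1 + \<i>)"
proof -
  have *: "r = \<i> \<or> r = - \<i>" using assms by (metis power2_eq_iff power2_i)
  have z: "\<i> = zeta 8 * zeta 8" using zeta_8_square by (simp add: power2_eq_square)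
  have 1: "same_sq_class (a * \<i>) a" for a by (rule same_sq_classI[of "zeta 8"]) (auto simp: zeta_8_square)
  have 2: "same_sq_class (- a) a" for a by (rule same_sq_classI[of \<i>]) auto
  have 3: "same_sq_class (- (a * \<i>)) a" for a by (rule same_sq_class_trans[OF 2 1])
  have 4: "same_sq_class a a" for a by (rule same_sq_classI[of 1]) auto
  show "same_sq_class r 1" using * 1[of 1] 3[of 1] by auto
  show "same_sq_class (r + 1) (1 + \<i>)"
    using * 4[of "1 + \<i>"] 3[of "1 + \<i>"] by (auto simp: algebra_simps)
  show "same_sq_class (r - 1) (1 + \<i>)"
    using * 1[of "1 + \<i>"] 2[of "1 + \<i>"] by (auto simp: algebra_simps)
qed

text \<open>By the pigeonhole principle two of the three representatives coincide. They cancel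
  modulo squares, and the third one is left as a square.\<close>

lemma same_sq_class_odd_product:
  assumes "same_sq_class (a * b * c) 1"
    and "\<And>x. x \<in> {a, b, c} \<Longrightarrow> same_sq_class x g \<or> same_sq_class x h" "g \<in> K8" "h \<in> K8" "g \<noteq> 0" "h \<noteq> 0"
  shows "same_sq_class g 1 \<or> same_sq_class h 1"
proof -
  have ex: "\<exists>x'. x' \<in> {g, h} \<and> same_sq_class x x'" if "x \<in> {a, b, c}" for x
    using assms(2)[OF that] by blast
  obtain a' where a': "a' \<in> {g, h}" "same_sq_class a a'" using ex[of a] by auto
  obtain b' where b': "b' \<in> {g, h}" "same_sq_class b b'" using ex[of b] by auto
  obtain c' where c': "c' \<in> {g, h}" "same_sq_class c c'" using ex[of c] by auto
  have prod: "same_sq_class (a' * b' * c') 1"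
    by (rule same_sq_class_trans[OF same_sq_class_sym assms(1)]) (rule same_sq_class_mult[OF same_sq_class_mult[OF a'(2) b'(2)] c'(2)])
  have cancel: "same_sq_class y 1" if "x \<in> {g, h}" "same_sq_class p 1" "p = y * x\<^sup>2" for x y p
  proof (rule same_sq_class_trans[OF same_sq_class_sym that(2)])
    show "same_sq_class p y" by (rule same_sq_classI[of x]) (use that assms(3-6) in auto)
  qed
  consider "a' = b'" | "a' = c'" | "b' = c'" using a'(1) b'(1) c'(1) by blast
  then have "same_sq_class a' 1 \<or> same_sq_class b' 1 \<or> same_sq_class c' 1"
  proof cases
    case 1 then show ?thesis using cancel[OF a'(1) prod, of c'] by (simp add: power2_eq_square)
  next
    case 2 then show ?thesis using cancel[OF a'(1) prod, of b'] by (simp add: power2_eq_square)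
  next
    case 3 then show ?thesis using cancel[OF b'(1) prod, of a'] by (simp add: power2_eq_square)
  qed
  then show ?thesis using a'(1) b'(1) c'(1) by blast
qed

text \<open>As 1 + sqrt 2 is not a square, the first two products force the abscissae to be all of
  the kind with square -1 or all of the other kind. The third product has an odd number of factors,
  so the class of 1 + i, or the classes of sqrt 2 and 2 + sqrt 2, cannot cancel in it.\<close>

lemma torsion_classes_incompatible:
  assumes r: "\<And>r. r \<in> {r1, r2, r3} \<Longrightarrow> r\<^sup>2 = -1 \<or> (r - 1)\<^sup>2 = 2 \<or> (r + 1)\<^sup>2 = 2"
    and s: "same_sq_class (r1 * r2) 1" "same_sq_class (r1 * r3) 1" "same_sq_class ((r1 + 1) * (r2 + 1) * (r3 - 1)) 1"
  shows False
proof -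
  have nz: "1 + \<i> \<noteq> 0" "2 + rt2 \<noteq> 0" using rt2_square by (auto simp: complex_eq_iff add_eq_0_iff)
  have same: "r\<^sup>2 = -1 \<longleftrightarrow> r'\<^sup>2 = -1" if "r \<in> {r1, r2, r3}" "r' \<in> {r1, r2, r3}" "same_sq_class (r * r') 1" for r r'
  proof -
    have "\<not> (r\<^sup>2 = -1 \<and> (r' - 1)\<^sup>2 = 2 \<or> r\<^sup>2 = -1 \<and> (r' + 1)\<^sup>2 = 2)" if s: "same_sq_class (r * r') 1" for r r'
    proof
      assume *: "r\<^sup>2 = -1 \<and> (r' - 1)\<^sup>2 = 2 \<or> r\<^sup>2 = -1 \<and> (r' + 1)\<^sup>2 = 2"
      have "same_sq_class (r * r') (1 * (1 + rt2))"
        using * by (intro same_sq_class_mult same_sq_class_torsion_i same_sq_class_torsion) blast+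
      then show False using s same_sq_class_1_neq(2) same_sq_class_sym same_sq_class_trans by (metis mult_1)
    qed
    from this[OF that(3)] this[of r' r] that r[OF that(1)] r[OF that(2)] show ?thesis
      by (auto simp: mult.commute)
  qed
  show False
  proof (cases "r1\<^sup>2 = -1")
    case True
    then have "r2\<^sup>2 = -1" "r3\<^sup>2 = -1" using same[of r1 r2] same[of r1 r3] s by simp_all
    then have "same_sq_class (1 + \<i>) 1 \<or> same_sq_class (1 + \<i>) 1"
      using same_sq_class_torsion_i True nz by (intro same_sq_class_odd_product[OF s(3)]) auto
    then show False using same_sq_class_1_neq by blast
  next
    case False
    then have "r2\<^sup>2 \<noteq> -1" "r3\<^sup>2 \<noteq> -1" using same[of r1 r2] same[of r1 r3] s by simp_all
    then have "(r - 1)\<^sup>2 = 2 \<or> (r + 1)\<^sup>2 = 2" if "r \<in> {r1, r2, r3}" for r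
      using r[OF that] False that by auto
    then have "same_sq_class rt2 1 \<or> same_sq_class (2 + rt2) 1"
      using same_sq_class_torsion nz by (intro same_sq_class_odd_product[OF s(3)]) auto
    then show False using same_sq_class_1_neq by blast
  qed
qed

lemma quartic_K8:
  assumes "p \<in> K8" "w \<in> K8" "2 * w\<^sup>2 = p ^ 4 + 1"
  shows "p = 0 \<or> p ^ 4 = 1 \<or> p ^ 4 = -1"
proof (cases "p = 0 \<or> w = 0")
  case True
  then show ?thesis using assms(3) by (auto simp: eq_neg_iff_add_eq_0)
next
  case False
  \<comment> \<open>This is a map from the quartic to the elliptic curve with ordinate
    \<open>(1 - \<i>) * p * w\<close>; the constant fits because the square of
    \<open>1 - \<i>\<close> is \<open>- 2 * \<i>\<close>.\<close>
  define x where "x = \<i> * p\<^sup>2"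
  have p4: "p\<^sup>2 * p\<^sup>2 = 2 * w\<^sup>2 - 1" using assms(3) by (simp add: power2_eq_square power4_eq_xxxx mult.assoc)
  have "x ^ 3 - x = - \<i> * p\<^sup>2 * (p\<^sup>2 * p\<^sup>2 + 1)"
    unfolding x_def by (simp add: power3_eq_cube algebra_simps)
  also have "\<dots> = ((1 - \<i>) * p * w)\<^sup>2"
    unfolding p4 by (simp add: power2_eq_square algebra_simps)
  finally have "((1 - \<i>) * p * w)\<^sup>2 = x ^ 3 - x" by simp
  then have "(1 - \<i>) * p * w = 0 \<or> x\<^sup>2 = -1 \<or> (x - 1)\<^sup>2 = 2 \<or> (x + 1)\<^sup>2 = 2"
    using assms(1,2) unfolding x_def by (intro congruent_curve_K8) auto
  moreover have "1 - \<i> \<noteq> 0" by (simp add: complex_eq_iff)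
  \<comment> \<open>\<open>x\<close> is a square in K8, as i is one, while these abscissae have the
    nontrivial class of 1 + sqrt 2.\<close>
  moreover have "\<not> ((x - 1)\<^sup>2 = 2 \<or> (x + 1)\<^sup>2 = 2)"
  proof
    assume *: "(x - 1)\<^sup>2 = 2 \<or> (x + 1)\<^sup>2 = 2"
    have "same_sq_class x 1"
      by (rule same_sq_classI[of "zeta 8 * p"]) (use assms(1) False in \<open>auto simp: x_def power_mult_distrib zeta_8_square\<close>)
    then show False using same_sq_class_torsion(1)[OF *] same_sq_class_1_neq(2) same_sq_class_sym same_sq_class_trans by blast
  qed
  ultimately have "x\<^sup>2 = -1" using False by auto
  then show ?thesis unfolding x_def by (simp add: power_mult_distrib flip: power_mult)
qed

section \<open>Quadratic points of the quartic\<close>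

text \<open>With \<open>a = x\<^sup>4\<close> and \<open>b = y\<^sup>4\<close>, the factors describe the fourth powers occurring in the four
  families; their product is invariant under the permutations of \<open>a, b, -(a + b)\<close>.\<close>

definition exceptional :: "complex \<Rightarrow> complex \<Rightarrow> bool" where
  "exceptional a b \<longleftrightarrow> a = 0 \<or> b = 0 \<or> a + b = 0 \<or> a = b \<or> 2 * a + b = 0 \<or> a + 2 * b = 0 \<or>
     a\<^sup>2 + a * b + b\<^sup>2 = 0 \<or> 16 * a\<^sup>2 + 31 * a * b + 16 * b\<^sup>2 = 0 \<or> 16 * a\<^sup>2 + a * b + b\<^sup>2 = 0 \<or>
     a\<^sup>2 + a * b + 16 * b\<^sup>2 = 0"

lemma exceptional_swap: "exceptional a b \<Longrightarrow> exceptional b a"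
  unfolding exceptional_def by (elim disjE) (simp_all add: algebra_simps)

lemma exceptional_scale: "exceptional a b \<Longrightarrow> exceptional (a * k) (b * k)"
proof -
  assume *: "exceptional a b"
  have "2 * (a * k) + b * k = (2 * a + b) * k" "a * k + 2 * (b * k) = (a + 2 * b) * k"
    "a * k + b * k = (a + b) * k"
    "(a * k)\<^sup>2 + (a * k) * (b * k) + (b * k)\<^sup>2 = (a\<^sup>2 + a * b + b\<^sup>2) * k\<^sup>2"
    "16 * (a * k)\<^sup>2 + 31 * (a * k) * (b * k) + 16 * (b * k)\<^sup>2 = (16 * a\<^sup>2 + 31 * a * b + 16 * b\<^sup>2) * k\<^sup>2"
    "16 * (a * k)\<^sup>2 + (a * k) * (b * k) + (b * k)\<^sup>2 = (16 * a\<^sup>2 + a * b + b\<^sup>2) * k\<^sup>2"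
    "(a * k)\<^sup>2 + (a * k) * (b * k) + 16 * (b * k)\<^sup>2 = (a\<^sup>2 + a * b + 16 * b\<^sup>2) * k\<^sup>2"
    by (simp_all add: power2_eq_square algebra_simps)
  with * show ?thesis unfolding exceptional_def by auto
qed

text \<open>For \<open>a = x^4\<close> and \<open>b = y^4\<close> on the quartic,
  \<open>(a + b, - b)\<close> is the pair belonging to the permuted point
  \<open>(z, zeta 8 * y, x)\<close>.\<close>

lemma exceptional_rotate: "exceptional (a + b) (- b) \<Longrightarrow> exceptional a b"
  unfolding exceptional_def by (elim disjE) (simp_all add: algebra_simps power2_eq_square)

text \<open>The coordinate \<open>t\<close> on the conic \<open>X\<^sup>2 + Y\<^sup>2 = Z\<^sup>2\<close> below the quartic: the six branch points
  \<open>0, \<infinity>, \<plusminus>1, \<plusminus>\<i>\<close> are the vertices of an octahedron, and the symmetries of the quartic act on \<open>t\<close> by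
  its rotations.\<close>

definition octahedral :: "complex \<Rightarrow> complex \<Rightarrow> complex \<Rightarrow> complex" where
  "octahedral x y z = y\<^sup>2 / (z\<^sup>2 + x\<^sup>2)"

context
  fixes x y z t :: complex
  assumes nz: "x \<noteq> 0" "y \<noteq> 0" "z \<noteq> 0" and quartic: "x ^ 4 + y ^ 4 = z ^ 4"
  defines "t \<equiv> octahedral x y z"
begin

lemma denom_product: "(z\<^sup>2 + x\<^sup>2) * (z\<^sup>2 - x\<^sup>2) = y\<^sup>2 * y\<^sup>2" "(z\<^sup>2 + y\<^sup>2) * (z\<^sup>2 - y\<^sup>2) = x\<^sup>2 * x\<^sup>2"
  using quartic by (simp_all add: algebra_simps power2_eq_square power4_eq_xxxx)

lemma denom_nonzero: "z\<^sup>2 + x\<^sup>2 \<noteq> 0" "z\<^sup>2 + y\<^sup>2 \<noteq> 0"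
  using denom_product nz by auto

text \<open>The usual parametrization \<open>(1 - t^2 : 2 * t : 1 + t^2)\<close> of the conic by
  \<open>t\<close>, with the common factor kept.\<close>

lemma octahedral_coords:
  "t * (z\<^sup>2 + x\<^sup>2) = y\<^sup>2" "(1 - t\<^sup>2) * (z\<^sup>2 + x\<^sup>2) = 2 * x\<^sup>2" "(1 + t\<^sup>2) * (z\<^sup>2 + x\<^sup>2) = 2 * z\<^sup>2"
proof -
  let ?h = "z\<^sup>2 + x\<^sup>2"
  show 1: "t * ?h = y\<^sup>2" unfolding t_def octahedral_def using denom_nonzero by simp
  have "t\<^sup>2 * ?h * ?h = (t * ?h) * (t * ?h)" by (simp add: power2_eq_square)
  also have "\<dots> = (z\<^sup>2 - x\<^sup>2) * ?h" unfolding 1 denom_product(1)[symmetric] by simp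
  finally have 2: "t\<^sup>2 * ?h = z\<^sup>2 - x\<^sup>2" using denom_nonzero by simp
  show "(1 - t\<^sup>2) * ?h = 2 * x\<^sup>2" "(1 + t\<^sup>2) * ?h = 2 * z\<^sup>2"
    unfolding left_diff_distrib distrib_right[of 1] 2 by simp_all
qed

lemma octahedral_neq: "t \<noteq> 0" "t \<noteq> 1" "t \<noteq> -1" "t\<^sup>2 \<noteq> -1"
  using octahedral_coords nz by auto

text \<open>By the parametrization \<open>t * (1 - t^2)\<close> is 2 times a square involving
  \<open>x * y\<close>; the square root of -2 lies in K8, so the quotient is the curve itself and
  not a twist.\<close>

lemma octahedral_curve: "(rtm2 * x * y / (z\<^sup>2 + x\<^sup>2))\<^sup>2 = t ^ 3 - t"
proof -
  have "t ^ 3 - t = - (t * h) * ((1 - t\<^sup>2) * h) / h\<^sup>2" if "h \<noteq> 0" for h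
  proof -
    have "- (t * h) * ((1 - t\<^sup>2) * h) / h\<^sup>2 = - t * (1 - t\<^sup>2)" using that by (simp add: power2_eq_square)
    then show ?thesis by (simp add: power2_eq_square power3_eq_cube algebra_simps)
  qed
  from this[OF denom_nonzero(1)] show ?thesis unfolding octahedral_coords
    by (simp add: power_divide power_mult_distrib rtm2_square)
qed

text \<open>\<open>t^2 = -1\<close> would mean \<open>z = 0\<close>. The other values are midpoints
  of edges of the octahedron, where \<open>1 - t^2\<close> is \<open>2 * t\<close> up to sign, that
  is, \<open>x^2\<close> is \<open>y^2\<close> up to sign.\<close>

lemma octahedral_torsion:
  assumes "t\<^sup>2 = -1 \<or> (t - 1)\<^sup>2 = 2 \<or> (t + 1)\<^sup>2 = 2"
  shows "x ^ 4 = y ^ 4"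
proof -
  have "1 - t\<^sup>2 = - 2 * t \<or> 1 - t\<^sup>2 = 2 * t"
    using assms octahedral_neq(4) by (auto simp: power2_eq_square algebra_simps)
  then have "(1 - t\<^sup>2) * (z\<^sup>2 + x\<^sup>2) = - 2 * (t * (z\<^sup>2 + x\<^sup>2)) \<or> (1 - t\<^sup>2) * (z\<^sup>2 + x\<^sup>2) = 2 * (t * (z\<^sup>2 + x\<^sup>2))"
    by auto
  then have "x\<^sup>2 = - (y\<^sup>2) \<or> x\<^sup>2 = y\<^sup>2" unfolding octahedral_coords by auto
  then have "(x\<^sup>2)\<^sup>2 = (y\<^sup>2)\<^sup>2" by (elim disjE) (simp_all only: power2_minus)
  moreover have "x ^ 4 = (x\<^sup>2)\<^sup>2" "y ^ 4 = (y\<^sup>2)\<^sup>2" by (simp_all flip: power_mult)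
  ultimately show ?thesis by metis
qed

text \<open>Exchanging \<open>x\<close> and \<open>y\<close> acts on \<open>t\<close> as a half turn
  about an edge midpoint: it swaps 0 with 1, infinity with -1, and i with -i.\<close>

lemma octahedral_ratio: "x\<^sup>2 / (y\<^sup>2 + z\<^sup>2) = (1 - t) / (1 + t)"
proof -
  have "1 + t \<noteq> 0" using octahedral_neq(3) by (metis add_eq_0_iff)
  have "x\<^sup>2 * (1 + t) * (z\<^sup>2 + x\<^sup>2) = x\<^sup>2 * (z\<^sup>2 + x\<^sup>2 + t * (z\<^sup>2 + x\<^sup>2))"
    by (simp add: algebra_simps)
  also have "\<dots> = (z\<^sup>2 + x\<^sup>2 - t * (z\<^sup>2 + x\<^sup>2)) * (z\<^sup>2 + y\<^sup>2)"
    unfolding octahedral_coords using denom_product(2) by (simp add: algebra_simps)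
  also have "\<dots> = (1 - t) * (y\<^sup>2 + z\<^sup>2) * (z\<^sup>2 + x\<^sup>2)" by (simp add: algebra_simps)
  finally have "x\<^sup>2 * (1 + t) = (1 - t) * (y\<^sup>2 + z\<^sup>2)" using denom_nonzero(1) by simp
  then show ?thesis using \<open>1 + t \<noteq> 0\<close> denom_nonzero(2) by (simp add: field_simps add.commute)
qed

end

text \<open>The fourth power of \<open>zeta 8\<close> is -1, so a term can change sides of the
  equation. Composing the first quotient map with these permutations gives the other two quotients,
  branched over 0, infinity, i, -i and over 1, -1, i, -i.\<close>

lemma octahedral_permute:
  assumes "x \<noteq> 0" "y \<noteq> 0" "z \<noteq> 0" "x ^ 4 + y ^ 4 = z ^ 4"
  shows "z ^ 4 + (zeta 8 * y) ^ 4 = x ^ 4" "z ^ 4 + (zeta 8 * x) ^ 4 = y ^ 4"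
    "octahedral z (zeta 8 * y) x = \<i> * octahedral x y z"
    "octahedral z (zeta 8 * x) y = \<i> * (1 - octahedral x y z) / (1 + octahedral x y z)"
proof -
  show "z ^ 4 + (zeta 8 * y) ^ 4 = x ^ 4" "z ^ 4 + (zeta 8 * x) ^ 4 = y ^ 4"
    unfolding assms(4)[symmetric] by (simp_all add: power_mult_distrib zeta_8_power_4)
  show "octahedral z (zeta 8 * y) x = \<i> * octahedral x y z"
    unfolding octahedral_def by (simp add: power_mult_distrib zeta_8_square add.commute)
  have "octahedral z (zeta 8 * x) y = \<i> * (x\<^sup>2 / (y\<^sup>2 + z\<^sup>2))"
    unfolding octahedral_def by (simp add: power_mult_distrib zeta_8_square)
  then show "octahedral z (zeta 8 * x) y = \<i> * (1 - octahedral x y z) / (1 + octahedral x y z)"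
    unfolding octahedral_ratio[OF assms] by simp
qed

text \<open>Here \<open>r\<close> is the abscissa of a point of order 4 over K8, and
  \<open>r * (r^2 - 1)\<close> is the square of its ordinate.\<close>

lemma same_sq_class_torsion_square_diff:
  assumes "r\<^sup>2 = -1 \<or> (r - 1)\<^sup>2 = 2 \<or> (r + 1)\<^sup>2 = 2" shows "same_sq_class (r\<^sup>2 - 1) r"
  using assms
proof (elim disjE)
  assume r: "r\<^sup>2 = -1"
  then have "r = \<i> \<or> r = - \<i>" by (metis power2_eq_iff power2_i)
  then have "1 + r \<in> K8" by auto
  moreover have "1 + r \<noteq> 0" using \<open>r = \<i> \<or> r = - \<i>\<close> by (auto simp: complex_eq_iff)
  moreover have "r\<^sup>2 - 1 = r * (1 + r)\<^sup>2"
    using r by (simp add: power2_eq_square algebra_simps)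
  ultimately show ?thesis by (rule same_sq_classI)
next
  assume "(r - 1)\<^sup>2 = 2"
  then have "r\<^sup>2 - 1 = r * 2" by (simp add: power2_eq_square algebra_simps)
  then show ?thesis by (intro same_sq_classI[of rt2]) (auto simp: rt2_square)
next
  assume "(r + 1)\<^sup>2 = 2"
  then have "r\<^sup>2 + 2 * r = 1" by (simp add: power2_eq_square algebra_simps)
  then have "r\<^sup>2 - 1 = r * (- 2)" by (simp add: algebra_simps)
  then show ?thesis using rtm2_square by (intro same_sq_classI[of rtm2]) auto
qed

section \<open>Points over a quadratic extension of K8\<close>

locale K8_quadratic = quadratic_extension K8 s for s
begin

abbreviation nm :: "complex \<Rightarrow> complex" where "nm w \<equiv> w * conj w"

text \<open>If the third point has order 2, the conjugate point is the negative of the translate by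
  it, and the first three alternatives are the formulas for these translations. Otherwise the values
  of the line at 0, 1 and -1 lie in K8, and by the factorization of the cubic their squares are the
  products in the last alternative.\<close>

lemma third_intersection_classes:
  assumes t: "t \<in> L" "t \<notin> K8" and y: "y \<in> L" "y\<^sup>2 = t ^ 3 - t"
  shows "t * conj t = -1 \<or> (t - 1) * (conj t - 1) = 2 \<or> (t + 1) * (conj t + 1) = 2 \<or>
    (\<exists>r. (r\<^sup>2 = -1 \<or> (r - 1)\<^sup>2 = 2 \<or> (r + 1)\<^sup>2 = 2) \<and>
      same_sq_class (nm t * r) 1 \<and> same_sq_class (nm (t - 1) * (r - 1)) 1 \<and> same_sq_class (nm (t + 1) * (r + 1)) 1)"
proof -
  obtain m c r where mcr: "m \<in> K8" "c \<in> K8" "r \<in> K8" "y = m * t + c" "(m * r + c)\<^sup>2 = r ^ 3 - r"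
    and key: "\<And>T. T ^ 3 - T - (m * T + c)\<^sup>2 = (T - t) * (T - conj t) * (T - r)"
    using third_intersection[OF t y] by blast
  define t' where "t' = conj t"
  have k0: "c\<^sup>2 = t * t' * r" using key[of 0] unfolding t'_def by simp
  have k1: "(m + c)\<^sup>2 = (t - 1) * (t' - 1) * (r - 1)"
    using key[of 1] unfolding t'_def by (simp add: algebra_simps)
  have k2: "(c - m)\<^sup>2 = (t + 1) * (t' + 1) * (r + 1)"
    using key[of "- 1"] unfolding t'_def by (simp add: algebra_simps)
  have torsion: "m * r + c = 0 \<or> r\<^sup>2 = -1 \<or> (r - 1)\<^sup>2 = 2 \<or> (r + 1)\<^sup>2 = 2"
    using mcr by (intro congruent_curve_K8) auto
  show ?thesis
  proof (cases "m * r + c = 0")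
    case True
    then have c: "c = - (m * r)" by (simp add: eq_neg_iff_add_eq_0 add.commute)
    have "r ^ 3 - r = 0" using mcr(5) True by simp
    moreover have "r ^ 3 - r = r * (r\<^sup>2 - 1)" by (simp add: power2_eq_square power3_eq_cube algebra_simps)
    ultimately have "r * (r\<^sup>2 - 1) = 0" by simp
    then have "r = 0 \<or> r = 1 \<or> r = -1" by (simp add: power2_eq_1_iff)
    then consider "r = 0" | "r = 1" | "r = -1" by blast
    then show ?thesis
    proof cases
      case 1
      have "(t + 1) * (t' + 1) = - ((t - 1) * (t' - 1))" using k1 k2 unfolding c 1 by simp
      moreover have "2 * (t * t') = (t - 1) * (t' - 1) + (t + 1) * (t' + 1) - 2" by (simp add: algebra_simps)
      ultimately have "2 * (t * t') = 2 * (- 1)" by simp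
      then have "t * t' = - 1" by (simp only: mult_cancel_left) simp
      then show ?thesis unfolding t'_def by simp
    next
      case 2
      have "(t - 1) * (t' - 1) - 2 = 2 * (t * t' * 1) - (t + 1) * (t' + 1)" by (simp add: algebra_simps)
      also have "\<dots> = 0" using k0 k2 unfolding c 2 by simp
      finally show ?thesis unfolding t'_def by simp
    next
      case 3
      have "(t + 1) * (t' + 1) - 2 = 2 * (t * t') - (t - 1) * (t' - 1)" by (simp add: algebra_simps)
      also have "\<dots> = 0" using k0 k1 unfolding c 3 by simp
      finally show ?thesis unfolding t'_def by simp
    qed
  next
    case False
    then have tor: "r\<^sup>2 = -1 \<or> (r - 1)\<^sup>2 = 2 \<or> (r + 1)\<^sup>2 = 2" using torsion by blast
    have sqc1: "same_sq_class b 1" if "a \<in> K8" "a\<^sup>2 = b" "b \<noteq> 0" for a b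
      by (rule same_sq_classI[of a]) (use that in auto)
    have "t \<noteq> 0" "t - 1 \<noteq> 0" "t + 1 \<noteq> 0" using t(2) by (auto simp: eq_neg_iff_add_eq_0[symmetric])
    then have "nm t \<noteq> 0" "nm (t - 1) \<noteq> 0" "nm (t + 1) \<noteq> 0"
      using t(1) conj_eq_0_iff[of t] conj_eq_0_iff[of "t - 1"] conj_eq_0_iff[of "t + 1"] by simp_all
    then have N: "t * t' \<noteq> 0" "(t - 1) * (t' - 1) \<noteq> 0" "(t + 1) * (t' + 1) \<noteq> 0"
      unfolding t'_def using t(1) by simp_all
    have "r \<noteq> 0" "r - 1 \<noteq> 0" "r + 1 \<noteq> 0" using tor by (auto simp: eq_neg_iff_add_eq_0[symmetric])
    then have N': "t * t' * r \<noteq> 0" "(t - 1) * (t' - 1) * (r - 1) \<noteq> 0" "(t + 1) * (t' + 1) * (r + 1) \<noteq> 0"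
      using N by simp_all
    have "same_sq_class (t * t' * r) 1" by (rule sqc1[OF mcr(2) k0 N'(1)])
    moreover have "same_sq_class ((t - 1) * (t' - 1) * (r - 1)) 1"
      by (rule sqc1[OF _ k1 N'(2)]) (simp add: mcr)
    moreover have "same_sq_class ((t + 1) * (t' + 1) * (r + 1)) 1"
      by (rule sqc1[OF _ k2 N'(3)]) (simp add: mcr)
    moreover have "conj (t - 1) = t' - 1" "conj (t + 1) = t' + 1" unfolding t'_def using t(1) by simp_all
    ultimately have "same_sq_class (nm t * r) 1 \<and> same_sq_class (nm (t - 1) * (r - 1)) 1 \<and> same_sq_class (nm (t + 1) * (r + 1)) 1"
      unfolding t'_def by simp
    with tor show ?thesis by blast
  qed
qed

context
  fixes x y z t :: complex
  assumes nz: "x \<noteq> 0" "y \<noteq> 0" "z \<noteq> 0" and quartic: "x ^ 4 + y ^ 4 = z ^ 4"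
    and xyz_L: "x \<in> L" "y \<in> L" "z \<in> L"
  defines "t \<equiv> octahedral x y z"
begin

lemma octahedral_L: "t \<in> L"
  unfolding t_def octahedral_def using xyz_L by simp

text \<open>Here \<open>t\<close> and its conjugate are exchanged by a half turn about an axis through two vertices; the
  second elliptic quotient then forces \<open>t\<close> and its conjugate to differ by an element of \<open>K8\<close>.\<close>

lemma axis_impossible:
  assumes "t \<notin> K8" shows "t * conj t \<noteq> -1"
proof
  assume N: "t * conj t = -1"
  define w where "w = rtm2 * z * (zeta 8 * y) / (x\<^sup>2 + z\<^sup>2)"
  have wL: "w \<in> L" unfolding w_def using xyz_L by simp
  have "w\<^sup>2 = (\<i> * t) ^ 3 - \<i> * t"
    using octahedral_curve[of z "zeta 8 * y" x] octahedral_permute[OF nz quartic] nz unfolding w_def t_def by simp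
  also have "\<dots> = - \<i> * t * (t * t + 1)" by (simp add: power3_eq_cube algebra_simps)
  \<comment> \<open>The assumption on the norm rewrites the linear term \<open>t\<close> as
    \<open>- t * t * conj t\<close>.\<close>
  also have "\<dots> = - \<i> * (t * t) * (t - conj t)" using N by (simp add: algebra_simps)
  finally have w2: "w\<^sup>2 = - \<i> * (t * t) * (t - conj t)" .
  have "(nm w)\<^sup>2 = w\<^sup>2 * conj (w\<^sup>2)" using wL by (simp add: power_mult_distrib)
  also have "\<dots> = (- \<i>)\<^sup>2 * (t * conj t)\<^sup>2 * ((t - conj t) * (conj t - t))"
    unfolding w2 using octahedral_L by (simp add: power2_eq_square ac_simps)
  also have "\<dots> = (t - conj t)\<^sup>2" unfolding N by (simp add: power2_eq_square algebra_simps)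
  \<comment> \<open>A norm lies in K8 and is fixed by conjugation, whereas \<open>t - conj t\<close>
    is negated by it.\<close>
  finally have "nm w = t - conj t \<or> nm w = - (t - conj t)" by (simp only: power2_eq_iff)
  then have "t - conj t \<in> K8"
    using trace_norm_K(2)[OF wL] uminus_closed[OF trace_norm_K(2)[OF wL]] by (metis minus_minus)
  then have "conj (t - conj t) = t - conj t" by (rule conj_K)
  then have "conj t = t" using octahedral_L by (simp add: algebra_simps)
  then show False using conj_fixed_iff[OF octahedral_L] assms by simp
qed

text \<open>Here conjugation acts as a half turn about the midpoint of an edge, so that \<open>x/z\<close> and its
  conjugate \<open>x'\<close> satisfy \<open>(x/z)\<^sup>4 + x'\<^sup>4 = 1\<close>. In their sum \<open>p\<close> and product \<open>q\<close> this reads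
  \<open>2 (q - p\<^sup>2)\<^sup>2 = p\<^sup>4 + 1\<close>, a curve with finitely many points over \<open>K8\<close>.\<close>

lemma swap_exceptional:
  assumes "(t - 1) * (conj t - 1) = 2 \<or> (t + 1) * (conj t + 1) = 2"
  shows "exceptional (x ^ 4) (y ^ 4)"
proof -
  define X1 where "X1 = x / z"
  have XL: "X1 \<in> L" "X1 \<noteq> 0" unfolding X1_def using xyz_L nz by simp_all
  note oc = octahedral_coords[OF nz quartic, folded t_def] and neq = octahedral_neq[OF nz quartic, folded t_def]
  define h where "h = z\<^sup>2 + x\<^sup>2"
  have h: "h \<noteq> 0" unfolding h_def using denom_nonzero[OF nz quartic] by simp
  have t1: "1 + t\<^sup>2 \<noteq> 0" using neq(4) by (simp add: add_eq_0_iff)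
  have X2: "X1\<^sup>2 = (1 - t\<^sup>2) / (1 + t\<^sup>2)"
  proof -
    have "(1 - t\<^sup>2) / (1 + t\<^sup>2) = ((1 - t\<^sup>2) * h) / ((1 + t\<^sup>2) * h)" using h by simp
    then show ?thesis unfolding oc[folded h_def] X1_def by (simp add: power_divide)
  qed
  have Y2: "(y / z)\<^sup>2 = 2 * t / (1 + t\<^sup>2)"
  proof -
    have "2 * t / (1 + t\<^sup>2) = (2 * (t * h)) / ((1 + t\<^sup>2) * h)" using h by simp
    then show ?thesis unfolding oc[folded h_def] by (simp add: power_divide)
  qed
  have "(conj X1)\<^sup>2 = conj (X1\<^sup>2)" using XL by simp
  then have cX2: "(conj X1)\<^sup>2 = (1 - (conj t)\<^sup>2) / (1 + (conj t)\<^sup>2)" unfolding X2 using octahedral_L by simp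
  have tn: "t - 1 \<noteq> 0" "t + 1 \<noteq> 0" using neq by (simp_all add: eq_neg_iff_add_eq_0)
  have frac: "(1 - (b / a)\<^sup>2) / (1 + (b / a)\<^sup>2) = (a\<^sup>2 - b\<^sup>2) / (a\<^sup>2 + b\<^sup>2)" if "a \<noteq> 0" for a b :: complex
  proof -
    have "(1 - (b / a)\<^sup>2) / (1 + (b / a)\<^sup>2) = ((1 - (b / a)\<^sup>2) * a\<^sup>2) / ((1 + (b / a)\<^sup>2) * a\<^sup>2)"
      using that by simp
    also have "\<dots> = (a\<^sup>2 - b\<^sup>2) / (a\<^sup>2 + b\<^sup>2)"
      unfolding left_diff_distrib distrib_right power_divide using that by simp
    finally show ?thesis .
  qed
  \<comment> \<open>The half turn exchanges the squares of \<open>x / z\<close> and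
    \<open>y / z\<close> up to a sign, which disappears in fourth powers.\<close>
  have "(conj X1)\<^sup>2 = (y / z)\<^sup>2 \<or> (conj X1)\<^sup>2 = - ((y / z)\<^sup>2)"
    using assms
  proof
    assume "(t - 1) * (conj t - 1) = 2"
    then have "conj t = (t + 1) / (t - 1)" using tn by (simp add: field_simps)
    then have "(conj X1)\<^sup>2 = ((t - 1)\<^sup>2 - (t + 1)\<^sup>2) / ((t - 1)\<^sup>2 + (t + 1)\<^sup>2)"
      unfolding cX2 by (simp only: frac[OF tn(1)])
    also have "\<dots> = (2 * (- 2 * t)) / (2 * (1 + t\<^sup>2))" by (simp add: power2_eq_square algebra_simps)
    also have "\<dots> = - ((y / z)\<^sup>2)" unfolding Y2 mult_divide_mult_cancel_left_if by simp
    finally show ?thesis by blast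
  next
    assume "(t + 1) * (conj t + 1) = 2"
    then have "conj t = (1 - t) / (t + 1)" using tn by (simp add: field_simps)
    then have "(conj X1)\<^sup>2 = ((t + 1)\<^sup>2 - (1 - t)\<^sup>2) / ((t + 1)\<^sup>2 + (1 - t)\<^sup>2)"
      unfolding cX2 by (simp only: frac[OF tn(2)])
    also have "\<dots> = (2 * (2 * t)) / (2 * (1 + t\<^sup>2))" by (simp add: power2_eq_square algebra_simps)
    also have "\<dots> = (y / z)\<^sup>2" unfolding Y2 mult_divide_mult_cancel_left_if by simp
    finally show ?thesis by blast
  qed
  then have "((conj X1)\<^sup>2)\<^sup>2 = ((y / z)\<^sup>2)\<^sup>2" by (elim disjE) (simp_all only: power2_minus)
  then have cX4: "(conj X1) ^ 4 = (y / z) ^ 4" by (simp flip: power_mult)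
  have "X1 ^ 4 + (y / z) ^ 4 = 1"
    using quartic nz unfolding X1_def by (simp add: power_divide flip: add_divide_distrib)
  then have sum4: "X1 ^ 4 + (conj X1) ^ 4 = 1" unfolding cX4 .
  define p q where "p = X1 + conj X1" and "q = X1 * conj X1"
  have pq: "p \<in> K8" "q \<in> K8" unfolding p_def q_def using trace_norm_K XL by auto
  have "2 * (q - p\<^sup>2)\<^sup>2 = p ^ 4 + (X1 ^ 4 + (conj X1) ^ 4)"
    unfolding p_def q_def by (simp add: power2_eq_square power4_eq_xxxx algebra_simps)
  then have q4: "2 * (q - p\<^sup>2)\<^sup>2 = p ^ 4 + 1" unfolding sum4 .
  then have p4: "p = 0 \<or> p ^ 4 = 1 \<or> p ^ 4 = -1"
    using pq by (intro quartic_K8[of p "q - p\<^sup>2"]) auto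
  have quad: "X1\<^sup>2 = p * X1 - q" unfolding p_def q_def by (simp add: power2_eq_square algebra_simps)
  have q0: "q \<noteq> 0" unfolding q_def using XL by simp
  define a where "a = X1 ^ 4"
  have ga: "exceptional a (1 - a) \<Longrightarrow> exceptional (x ^ 4) (y ^ 4)"
  proof -
    assume "exceptional a (1 - a)"
    moreover have "x ^ 4 = a * z ^ 4" unfolding a_def X1_def using nz by (simp add: power_divide)
    moreover have "y ^ 4 = (1 - a) * z ^ 4" using quartic calculation(2) by (simp add: algebra_simps)
    ultimately show ?thesis by (metis exceptional_scale)
  qed
  show ?thesis
  proof (cases "p = 0")
    case True
    then have "conj X1 = - X1" unfolding p_def by (simp add: add_eq_0_iff)
    then have "2 * a = 1" using sum4 unfolding a_def by simp
    then have "a = 1 - a" by (simp add: algebra_simps)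
    then show ?thesis using ga unfolding exceptional_def by blast
  next
    case p0: False
    \<comment> \<open>Dividing by the trace makes \<open>u\<close> a root of
      \<open>T^2 - T + v\<close>, and \<open>v\<close> is restricted by the value of
      \<open>p^4\<close>.\<close>
    define u where "u = X1 / p"
    define v where "v = q / p\<^sup>2"
    have u: "u\<^sup>2 = u - v"
      using quad p0 unfolding u_def v_def by (simp add: power_divide field_simps power2_eq_square)
    have v0: "v \<noteq> 0" unfolding v_def using q0 p0 by simp
    have "2 * (v - 1)\<^sup>2 * p ^ 4 = 2 * (q - p\<^sup>2)\<^sup>2"
      unfolding v_def using p0 by (simp add: power2_eq_square power4_eq_xxxx algebra_simps)
    then have v: "2 * (v - 1)\<^sup>2 * p ^ 4 = p ^ 4 + 1" using q4 by simp
    have aX: "a = p ^ 4 * u ^ 4" unfolding a_def u_def using p0 by (simp add: power_divide)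
    have u4: "u ^ 4 = (u\<^sup>2)\<^sup>2" by (simp flip: power_mult)
    from p4 p0 consider "p ^ 4 = -1" | "p ^ 4 = 1" by blast
    then show ?thesis
    proof cases
      case 1
      then have "v = 1" using v by simp
      \<comment> \<open>\<open>u\<close> is a primitive sixth root of unity; this is the origin of
        the third family.\<close>
      then have u2: "u * u = u - 1" using u by (simp add: power2_eq_square)
      have "a = u" unfolding aX 1 u4 by (simp add: power2_eq_square u2 algebra_simps)
      then have "a\<^sup>2 + a * (1 - a) + (1 - a)\<^sup>2 = 0" using u2 by (simp add: power2_eq_square algebra_simps)
      then show ?thesis using ga unfolding exceptional_def by blast
    next
      case 2
      then have "(v - 1)\<^sup>2 = 1" using v by simp
      then have "v - 1 = 1 \<or> v - 1 = -1" by (simp add: power2_eq_1_iff)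
      then have "v = 2" using v0 by (auto simp: diff_eq_eq)
      \<comment> \<open>The roots of \<open>T^2 - T + 2\<close> are \<open>alpha\<close> and
        \<open>alpha_bar\<close>; this is the origin of the fourth family.\<close>
      then have u2: "u * u = u - 2" using u by (simp add: power2_eq_square)
      have a2: "a = 2 - 3 * u" unfolding aX 2 u4 by (simp add: power2_eq_square u2 algebra_simps)
      have "16 * a\<^sup>2 + 31 * a * (1 - a) + 16 * (1 - a)\<^sup>2 = 9 * (u * u - u + 2)"
        unfolding a2 by (simp add: power2_eq_square algebra_simps)
      then have "16 * a\<^sup>2 + 31 * a * (1 - a) + 16 * (1 - a)\<^sup>2 = 0" using u2 by simp
      then show ?thesis using ga unfolding exceptional_def by blast
    qed
  qed
qed

lemma classes_or_exceptional:
  assumes "t \<notin> K8"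
  shows "exceptional (x ^ 4) (y ^ 4) \<or>
    (\<exists>r. (r\<^sup>2 = -1 \<or> (r - 1)\<^sup>2 = 2 \<or> (r + 1)\<^sup>2 = 2) \<and>
      same_sq_class (nm t * r) 1 \<and> same_sq_class (nm (t - 1) * (r - 1)) 1 \<and> same_sq_class (nm (t + 1) * (r + 1)) 1)"
proof -
  have "rtm2 * x * y / (z\<^sup>2 + x\<^sup>2) \<in> L" using xyz_L by simp
  from third_intersection_classes[OF octahedral_L assms this octahedral_curve[OF nz quartic, folded t_def]]
  show ?thesis using axis_impossible[OF assms] swap_exceptional by blast
qed

end

lemma quadratic_point_exceptional:
  assumes nz: "x \<noteq> 0" "y \<noteq> 0" "z \<noteq> 0" and quartic: "x ^ 4 + y ^ 4 = z ^ 4"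
    and L: "x \<in> L" "y \<in> L" "z \<in> L"
  shows "exceptional (x ^ 4) (y ^ 4)"
proof (rule ccontr)
  assume nonexc: "\<not> exceptional (x ^ 4) (y ^ 4)"
  define t where "t = octahedral x y z"
  note neq = octahedral_neq[OF nz quartic, folded t_def]
  note perm = octahedral_permute[OF nz quartic, folded t_def]
  have zL: "zeta 8 * y \<in> L" "zeta 8 * x \<in> L" using L by simp_all
  have znz: "zeta 8 * y \<noteq> 0" "zeta 8 * x \<noteq> 0" using nz by simp_all
  have nonexc_perm: "\<not> exceptional (z ^ 4) ((zeta 8 * y) ^ 4)" "\<not> exceptional (z ^ 4) ((zeta 8 * x) ^ 4)"
    using nonexc exceptional_rotate[of "x ^ 4" "y ^ 4"] exceptional_rotate[of "y ^ 4" "x ^ 4"] exceptional_swap[of "y ^ 4" "x ^ 4"]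
    unfolding quartic[symmetric] power_mult_distrib zeta_8_power_4 by (auto simp: add.commute)
  have tn: "t - 1 \<noteq> 0" "1 + t \<noteq> 0" "t - \<i> \<noteq> 0" "t + \<i> \<noteq> 0"
    using neq eq_neg_iff_add_eq_0[of t \<i>] by (auto simp: add_eq_0_iff)
  show False
  proof (cases "t \<in> K8")
    case True
    \<comment> \<open>The ordinates on the three quotients. If one of them were in K8, its point
      would be torsion and the given point exceptional.\<close>
    define w1 where "w1 = rtm2 * x * y / (z\<^sup>2 + x\<^sup>2)"
    define w2 where "w2 = rtm2 * z * (zeta 8 * y) / (x\<^sup>2 + z\<^sup>2)"
    define w3 where "w3 = rtm2 * z * (zeta 8 * x) / (y\<^sup>2 + z\<^sup>2)"
    have sq: "w1\<^sup>2 = t ^ 3 - t" "w2\<^sup>2 = (\<i> * t) ^ 3 - \<i> * t"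
      "w3\<^sup>2 = (\<i> * (1 - t) / (1 + t)) ^ 3 - \<i> * (1 - t) / (1 + t)"
      using octahedral_curve[OF nz quartic] octahedral_curve[OF nz(3) znz(1) nz(1) perm(1)] octahedral_curve[OF nz(3) znz(2) nz(2) perm(2)]
      unfolding perm w1_def w2_def w3_def t_def by simp_all
    have wL: "w1 \<in> L" "w2 \<in> L" "w3 \<in> L" unfolding w1_def w2_def w3_def using L by simp_all
    have wnz: "w1 \<noteq> 0" "w2 \<noteq> 0" "w3 \<noteq> 0"
      unfolding w1_def w2_def w3_def using nz denom_nonzero[OF nz quartic] rtm2_square
      by (auto simp: add.commute)
    have w1_notin: "w1 \<notin> K8"
    proof
      assume "w1 \<in> K8"
      then have "x ^ 4 = y ^ 4"
        using congruent_curve_K8[OF True _ sq(1)] wnz octahedral_torsion[OF nz quartic, folded t_def] by blast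
      then show False using nonexc unfolding exceptional_def by blast
    qed
    have w2_notin: "w2 \<notin> K8"
    proof
      assume "w2 \<in> K8"
      then have "z ^ 4 = (zeta 8 * y) ^ 4"
        using congruent_curve_K8[OF _ _ sq(2)] True wnz
          octahedral_torsion[OF nz(3) znz(1) nz(1) perm(1), unfolded perm(3)] by blast
      then show False using nonexc_perm unfolding exceptional_def by blast
    qed
    have w3_notin: "w3 \<notin> K8"
    proof
      assume "w3 \<in> K8"
      moreover have "\<i> * (1 - t) / (1 + t) \<in> K8" using True by simp
      ultimately have "z ^ 4 = (zeta 8 * x) ^ 4"
        using congruent_curve_K8[OF _ _ sq(3)] wnz
          octahedral_torsion[OF nz(3) znz(2) nz(2) perm(2), unfolded perm(4)] by blast
      then show False using nonexc_perm unfolding exceptional_def by blast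
    qed
    have "w1\<^sup>2 \<in> K8" "w2\<^sup>2 \<in> K8" "w3\<^sup>2 \<in> K8" unfolding sq using True by simp_all
    then have ws: "w1 / s \<in> K8" "w2 / s \<in> K8" "w3 / s \<in> K8"
      using square_in_K wL w1_notin w2_notin w3_notin by blast+
    \<comment> \<open>The factors are grouped so that each becomes a rational function of
      \<open>t\<close>. The product is thus in K8, although each ordinate is \<open>s\<close> times
      an element of K8.\<close>
    have "w1 * w2 * w3 = rtm2 ^ 3 * (zeta 8)\<^sup>2 * (y\<^sup>2 / (z\<^sup>2 + x\<^sup>2)) * (x\<^sup>2 / (y\<^sup>2 + z\<^sup>2)) * (z\<^sup>2 / (z\<^sup>2 + x\<^sup>2))"
      unfolding w1_def w2_def w3_def by (simp add: power2_eq_square power3_eq_cube ac_simps)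
    also have "z\<^sup>2 / (z\<^sup>2 + x\<^sup>2) = (1 + t\<^sup>2) / 2"
      using octahedral_coords(3)[OF nz quartic, folded t_def] denom_nonzero(1)[OF nz quartic] by (simp add: field_simps)
    also have "x\<^sup>2 / (y\<^sup>2 + z\<^sup>2) = (1 - t) / (1 + t)" by (rule octahedral_ratio[OF nz quartic, folded t_def])
    also have "y\<^sup>2 / (z\<^sup>2 + x\<^sup>2) = t" unfolding t_def octahedral_def ..
    finally have "w1 * w2 * w3 \<in> K8" using True by simp
    moreover have "s = (w1 * w2 * w3) / ((w1 / s) * (w2 / s) * (w3 / s) * s\<^sup>2)"
      using wnz s_nonzero by (simp add: power2_eq_square)
    ultimately have "s \<in> K8" using ws s_square by (metis divide_closed mult_closed)
    then show False using s_notin by blast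
  next
    case False
    have tL: "t \<in> L" unfolding t_def using octahedral_L[OF nz quartic L] .
    have "\<i> * t \<notin> K8"
    proof
      assume "\<i> * t \<in> K8"
      then have "- \<i> * (\<i> * t) \<in> K8" by (rule mult_closed[OF uminus_closed[OF K8.s_in_L]])
      moreover have "- \<i> * (\<i> * t) = t" by simp
      ultimately show False using False by (simp only:)
    qed
    moreover have "\<i> * (1 - t) / (1 + t) \<notin> K8"
    proof
      define u where "u = (1 - t) / (1 + t)"
      assume "\<i> * (1 - t) / (1 + t) \<in> K8"
      then have "- \<i> * (\<i> * (1 - t) / (1 + t)) \<in> K8" by (rule mult_closed[OF uminus_closed[OF K8.s_in_L]])
      moreover have "- \<i> * (\<i> * (1 - t) / (1 + t)) = u" unfolding u_def by simp
      ultimately have u: "u \<in> K8" by (simp only:)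
      have "u + 1 = 2 / (1 + t)" unfolding u_def using tn(2) by (simp add: field_simps)
      then have "t = 2 / (u + 1) - 1" using tn(2) by simp
      then have "t \<in> K8" using u by simp
      then show False using False by blast
    qed
    ultimately obtain r1 r2 r3 where
      tor: "r1\<^sup>2 = -1 \<or> (r1 - 1)\<^sup>2 = 2 \<or> (r1 + 1)\<^sup>2 = 2" "r2\<^sup>2 = -1 \<or> (r2 - 1)\<^sup>2 = 2 \<or> (r2 + 1)\<^sup>2 = 2"
        "r3\<^sup>2 = -1 \<or> (r3 - 1)\<^sup>2 = 2 \<or> (r3 + 1)\<^sup>2 = 2"
      and c1: "same_sq_class (nm t * r1) 1" "same_sq_class (nm (t - 1) * (r1 - 1)) 1" "same_sq_class (nm (t + 1) * (r1 + 1)) 1"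
      and c2: "same_sq_class (nm (\<i> * t) * r2) 1" "same_sq_class (nm (\<i> * t + 1) * (r2 + 1)) 1"
      and c3: "same_sq_class (nm (\<i> * (1 - t) / (1 + t)) * r3) 1" "same_sq_class (nm (\<i> * (1 - t) / (1 + t) - 1) * (r3 - 1)) 1"
      using classes_or_exceptional[OF nz quartic L, folded t_def, OF False] nonexc nonexc_perm
        classes_or_exceptional[OF nz(3) znz(1) nz(1) perm(1) L(3) zL(1) L(1), unfolded perm(3)]
        classes_or_exceptional[OF nz(3) znz(2) nz(2) perm(2) L(3) zL(2) L(2), unfolded perm(4)]
      by blast
    define t' where "t' = conj t"
    have i: "\<i> \<in> L" "conj \<i> = \<i>" by simp_all
    have t'n: "t' - 1 \<noteq> 0" "1 + t' \<noteq> 0" "t' - \<i> \<noteq> 0" "t' \<noteq> 0"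
      using tn neq(1) conj_eq_0_iff[of "t - 1"] conj_eq_0_iff[of "1 + t"] conj_eq_0_iff[of "t - \<i>"] tL
      unfolding t'_def by simp_all
    \<comment> \<open>The norms of \<open>t - v\<close> for the branch points 0, 1, -1 and i; the
      norms arising on all three quotients are expressed by them.\<close>
    define n0 n1 n2 m1 where "n0 = t * t'" and "n1 = (t - 1) * (t' - 1)" and "n2 = (1 + t) * (1 + t')"
      and "m1 = (t - \<i>) * (t' - \<i>)"
    have nK: "n0 \<in> K8" "n1 \<in> K8" "n2 \<in> K8" "m1 \<in> K8"
      using trace_norm_K(2)[of t] trace_norm_K(2)[of "t - 1"] trace_norm_K(2)[of "1 + t"] trace_norm_K(2)[of "t - \<i>"] tL
      unfolding n0_def n1_def n2_def m1_def t'_def by simp_all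
    have nnz: "n0 \<noteq> 0" "n1 \<noteq> 0" "n2 \<noteq> 0" "m1 \<noteq> 0"
      unfolding n0_def n1_def n2_def m1_def using tn t'n neq(1) by simp_all
    have N1: "nm t = n0" "nm (t - 1) = n1" "nm (t + 1) = n2"
      unfolding n0_def n1_def n2_def t'_def using tL by (simp_all add: add.commute)
    have N2: "nm (\<i> * t) = - n0" "nm (\<i> * t + 1) = - m1"
      unfolding n0_def m1_def t'_def using tL by (simp_all add: algebra_simps)
    have N3: "nm (\<i> * (1 - t) / (1 + t)) = - n1 / n2"
    proof -
      have "conj (\<i> * (1 - t) / (1 + t)) = \<i> * (1 - t') / (1 + t')" unfolding t'_def using tL by simp
      moreover have "\<i> * (1 - t) / (1 + t) * (\<i> * (1 - t') / (1 + t')) = - ((1 - t) * (1 - t')) / n2"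
        unfolding n2_def by (simp add: ac_simps)
      moreover have "(1 - t) * (1 - t') = n1" unfolding n1_def by (simp add: algebra_simps)
      ultimately show ?thesis by (simp only:)
    qed
    have "\<i> * (1 - t) / (1 + t) - 1 = - (1 + \<i>) * (t - \<i>) / (1 + t)"
      using tn(2) by (simp add: field_simps)
    then have "nm (\<i> * (1 - t) / (1 + t) - 1) = nm (- (1 + \<i>) * (t - \<i>) / (1 + t))" by (simp only:)
    also have "\<dots> = (1 + \<i>)\<^sup>2 * m1 / n2"
      unfolding m1_def n2_def t'_def using tL by (simp add: power2_eq_square) (simp add: algebra_simps)
    finally have N4: "nm (\<i> * (1 - t) / (1 + t) - 1) = (1 + \<i>)\<^sup>2 * m1 / n2" .
    have cancel: "same_sq_class b 1" if "same_sq_class a 1" "u \<in> K8" "u \<noteq> 0" "a = b * u\<^sup>2" for a b u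
      using that same_sq_classI[OF that(2-4)] same_sq_class_sym same_sq_class_trans by blast
    \<comment> \<open>Each of the three products is chosen so that the unknown norms occur to even
      powers, after cancelling denominators. Only the torsion abscissae remain modulo squares, the
      sign being absorbed by i.\<close>
    have id1: "a * u * (- a * v) = u * v * (\<i> * a)\<^sup>2" for a u v
      by (simp add: power2_eq_square ac_simps)
    have id2: "n1 * (r1 - 1) * (n2 * (r1 + 1)) * (- n1 / n2 * r3) = (r1\<^sup>2 - 1) * r3 * (\<i> * n1)\<^sup>2"
    proof -
      have "(r1\<^sup>2 - 1) = (r1 - 1) * (r1 + 1)" by (simp add: power2_eq_square algebra_simps)
      then show ?thesis using nnz(3) by (simp add: power2_eq_square ac_simps)
    qed
    have id3: "n2 * u * (- m1 * v) * (g\<^sup>2 * m1 / n2 * w) = u * v * w * (\<i> * m1 * g)\<^sup>2" for u v w g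
      using nnz(3) by (simp add: power2_eq_square ac_simps)
    have "1 + \<i> \<noteq> 0" by (simp add: complex_eq_iff)
    then have units: "\<i> * n0 \<in> K8" "\<i> * n0 \<noteq> 0" "\<i> * n1 \<in> K8" "\<i> * n1 \<noteq> 0"
      "\<i> * m1 * (1 + \<i>) \<in> K8" "\<i> * m1 * (1 + \<i>) \<noteq> 0"
      using nK nnz by auto
    have "same_sq_class (n0 * r1 * (- n0 * r2)) 1"
      using same_sq_class_mult[OF c1(1) c2(1)] by (simp only: N1 N2 mult_1_left)
    then have r12: "same_sq_class (r1 * r2) 1" by (rule cancel[OF _ units(1,2) id1])
    have "same_sq_class (n1 * (r1 - 1) * (n2 * (r1 + 1)) * (- n1 / n2 * r3)) 1"
      using same_sq_class_mult[OF same_sq_class_mult[OF c1(2,3)] c3(1)] by (simp only: N1 N3 mult_1_left)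
    then have "same_sq_class ((r1\<^sup>2 - 1) * r3) 1" by (rule cancel[OF _ units(3,4) id2])
    moreover have "same_sq_class ((r1\<^sup>2 - 1) * r3) (r1 * r3)"
      by (rule same_sq_class_mult[OF same_sq_class_torsion_square_diff[OF tor(1)]]) (rule same_sq_classI[of 1], auto)
    ultimately have r13: "same_sq_class (r1 * r3) 1" using same_sq_class_sym same_sq_class_trans by blast
    have "same_sq_class (n2 * (r1 + 1) * (- m1 * (r2 + 1)) * ((1 + \<i>)\<^sup>2 * m1 / n2 * (r3 - 1))) 1"
      using same_sq_class_mult[OF same_sq_class_mult[OF c1(3) c2(2)] c3(2)] by (simp only: N1 N2 N4 mult_1_left)
    then have "same_sq_class ((r1 + 1) * (r2 + 1) * (r3 - 1)) 1" by (rule cancel[OF _ units(5,6) id3])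
    with r12 r13 show False
      using torsion_classes_incompatible[of r1 r2 r3] tor by blast
  qed
qed

end

section \<open>Degrees and fields of definition\<close>

interpretation C_field: ring C_ring
  by (rule ring_from_type_algebra)

lemma C_line_extension: "u \<in> C_field.line_extension K a E \<longleftrightarrow> (\<exists>k\<in>K. \<exists>v\<in>E. u = k * a + v)"
  unfolding C_field.line_extension_mem_iff by (simp add: ring_of_type_algebra_def)

lemma C_dimension_0: "C_field.dimension 0 K {0}"
  using C_field.zero_dim[of K] by (simp add: ring_of_type_algebra_def)

lemma C_dimension_Suc:
  assumes "v \<notin> E" "C_field.dimension n K E" "F = {k * v + e | k e. k \<in> K \<and> e \<in> E}"
  shows "C_field.dimension (Suc n) K F"
proof -
  have "F = C_field.line_extension K v E"
    unfolding assms(3) by (rule Set.set_eqI) (unfold C_line_extension mem_Collect_eq, blast)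
  then show ?thesis using C_field.Suc_dim[OF _ assms(1,2)] by (simp add: ring_of_type_algebra_def)
qed

text \<open>Two vectors span \<open>L\<close>. By Cramer's rule 1 and any \<open>\<theta>\<close>
  outside \<open>K\<close> span it as well, and completing the square in the equation of
  \<open>\<theta>\<close> produces \<open>s\<close>.\<close>

lemma (in complex_subfield) degree_le_2_cases:
  assumes "degree_le K L 2" "complex_subfield L" "K \<subseteq> L"
  shows "L = K \<or> (\<exists>s. quadratic_extension K s \<and> L \<subseteq> quadratic_extension.L K s)"
proof (cases "L = K")
  case False
  interpret L: complex_subfield L by fact
  obtain \<theta> where \<theta>: "\<theta> \<in> L" "\<theta> \<notin> K" using False assms(3) by blast
  obtain d where d: "d \<le> 2" "C_field.dimension d K L" using assms(1) unfolding degree_le_def by blast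
  have "\<exists>u v. \<forall>z\<in>L. \<exists>a\<in>K. \<exists>b\<in>K. z = a * u + b * v"
    using d(2)
  proof (cases rule: C_field.dimension.cases)
    case zero_dim
    then have "L = {0}" by (simp add: ring_of_type_algebra_def)
    then show ?thesis using L.one_closed by auto
  next
    case (Suc_dim v E n)
    note L_eq = Suc_dim(2)
    from Suc_dim(5) show ?thesis
    proof (cases rule: C_field.dimension.cases)
      case zero_dim
      then have "E = {0}" by (simp add: ring_of_type_algebra_def)
      \<comment> \<open>In dimension one the second spanning vector is taken to be 0.\<close>
      then have "\<forall>z\<in>L. \<exists>a\<in>K. \<exists>b\<in>K. z = a * v + b * 0" unfolding L_eq by (auto simp: C_line_extension)
      then show ?thesis by blast
    next
      case (Suc_dim v' E' n')
      then have "n' = 0" using d(1) \<open>d = Suc n\<close> by simp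
      with Suc_dim(5) have "C_field.dimension 0 K E'" by simp
      then have "E' = {0}"
        by (cases rule: C_field.dimension.cases) (simp_all add: ring_of_type_algebra_def)
      then have "\<forall>z\<in>L. \<exists>a\<in>K. \<exists>b\<in>K. z = a * v + b * v'"
        unfolding L_eq Suc_dim(2) by (auto simp: C_line_extension) blast
      then show ?thesis by blast
    qed
  qed
  then obtain u v where uv: "\<And>z. z \<in> L \<Longrightarrow> \<exists>a\<in>K. \<exists>b\<in>K. z = a * u + b * v" by blast
  obtain a1 b1 where 1: "a1 \<in> K" "b1 \<in> K" "1 = a1 * u + b1 * v" using uv[OF L.one_closed] by blast
  obtain a2 b2 where 2: "a2 \<in> K" "b2 \<in> K" "\<theta> = a2 * u + b2 * v" using uv[OF \<theta>(1)] by blast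
  define \<delta> where "\<delta> = a1 * b2 - a2 * b1"
  have \<delta>: "\<delta> \<in> K" unfolding \<delta>_def using 1 2 by simp
  have e1: "a1 * \<theta> - a2 = \<delta> * v"
  proof -
    have "a1 * \<theta> - a2 * 1 = a1 * (a2 * u + b2 * v) - a2 * (a1 * u + b1 * v)" using 1(3) 2(3) by (simp only:)
    then show ?thesis unfolding \<delta>_def by (simp add: algebra_simps)
  qed
  have e2: "b2 - b1 * \<theta> = \<delta> * u"
  proof -
    have "b2 * 1 - b1 * \<theta> = b2 * (a1 * u + b1 * v) - b1 * (a2 * u + b2 * v)" using 1(3) 2(3) by (simp only:)
    then show ?thesis unfolding \<delta>_def by (simp add: algebra_simps)
  qed
  \<comment> \<open>A vanishing determinant would make 1 and \<open>\<theta>\<close> proportional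
    over \<open>K\<close>.\<close>
  have \<delta>0: "\<delta> \<noteq> 0"
  proof
    assume "\<delta> = 0"
    then have *: "a1 * \<theta> = a2" "b1 * \<theta> = b2" using e1 e2 by simp_all
    have "a1 \<noteq> 0 \<or> b1 \<noteq> 0" using 1(3) by auto
    then have "\<theta> = a2 / a1 \<or> \<theta> = b2 / b1" using * by (auto simp: field_simps)
    then show False using \<theta>(2) 1 2 by auto
  qed
  have span: "\<exists>a\<in>K. \<exists>b\<in>K. z = a + b * \<theta>" if z: "z \<in> L" for z
  proof -
    obtain a b where ab: "a \<in> K" "b \<in> K" "z = a * u + b * v" using uv[OF z] by blast
    have uv': "u = (b2 - b1 * \<theta>) / \<delta>" "v = (a1 * \<theta> - a2) / \<delta>" using e1 e2 \<delta>0 by simp_all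
    have "z = (a * b2 - b * a2) / \<delta> + (b * a1 - a * b1) / \<delta> * \<theta>"
      unfolding ab(3) uv' using \<delta>0 by (simp add: field_simps)
    then show ?thesis using ab(1,2) 1 2 \<delta> by (metis diff_closed divide_closed mult_closed)
  qed
  have "\<theta>\<^sup>2 \<in> L" using \<theta>(1) by simp
  then obtain a b where ab: "a \<in> K" "b \<in> K" "\<theta>\<^sup>2 = a + b * \<theta>" using span by blast
  define s where "s = \<theta> - b / 2"
  have th: "\<theta> = s + b / 2" unfolding s_def by simp
  have "s\<^sup>2 = a + (b / 2)\<^sup>2"
  proof -
    define h where "h = b / 2"
    have "(s + h)\<^sup>2 = a + 2 * h * (s + h)" using ab(3) unfolding th h_def by simp
    then show ?thesis unfolding h_def[symmetric] by (simp add: power2_eq_square algebra_simps)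
  qed
  then have s2: "s\<^sup>2 \<in> K" using ab by simp
  have sn: "s \<notin> K" using \<theta>(2) ab(2) unfolding th by auto
  interpret Q: quadratic_extension K s
    by unfold_locales (fact sn s2)+
  have "L \<subseteq> Q.L"
  proof
    fix z assume "z \<in> L"
    then obtain c d where cd: "c \<in> K" "d \<in> K" "z = c + d * \<theta>" using span by blast
    have "z = (c + d * (b / 2)) + d * s" unfolding cd(3) th by (simp add: algebra_simps)
    moreover have "c + d * (b / 2) \<in> K" using cd ab by simp
    ultimately show "z \<in> Q.L" using cd(2) by (simp only: Q.L_I)
  qed
  then show ?thesis using Q.quadratic_extension_axioms by blast
qed simp

text \<open>An intermediate field other than \<open>K\<close> contains some \<open>a + b * s\<close>
  with \<open>b\<close> nonzero, and therefore \<open>s\<close>.\<close>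

lemma (in quadratic_extension) degree_le_2_intermediate:
  assumes "complex_subfield M" "K \<subseteq> M" "M \<subseteq> L"
  shows "degree_le K M 2"
proof -
  interpret M: complex_subfield M by fact
  have dim1: "C_field.dimension (Suc 0) K K"
    by (rule C_dimension_Suc[OF _ C_dimension_0, of 1]) auto
  show ?thesis
  proof (cases "M = K")
    case True
    then show ?thesis using dim1 unfolding degree_le_def by (intro exI[of _ 1]) simp
  next
    case False
    then obtain z where z: "z \<in> M" "z \<notin> K" using assms(2) by blast
    obtain a b where ab: "a \<in> K" "b \<in> K" "z = a + b * s" using z(1) assms(3) by (blast elim: L_E)
    have "b \<noteq> 0" using ab z(2) by auto
    then have s_eq: "s = (z - a) / b" using ab(3) by simp
    have "(z - a) / b \<in> M" using ab(1,2) z(1) assms(2) by auto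
    then have sM: "s \<in> M" by (rule ssubst[OF s_eq])
    have "M = {k * s + e | k e. k \<in> K \<and> e \<in> K}"
    proof
      show "M \<subseteq> {k * s + e | k e. k \<in> K \<and> e \<in> K}"
      proof
        fix w assume "w \<in> M"
        then obtain c d where "c \<in> K" "d \<in> K" "w = c + d * s" using assms(3) by (blast elim: L_E)
        then have "w = d * s + c \<and> d \<in> K \<and> c \<in> K" by simp
        then show "w \<in> {k * s + e | k e. k \<in> K \<and> e \<in> K}" by blast
      qed
      show "{k * s + e | k e. k \<in> K \<and> e \<in> K} \<subseteq> M" using sM assms(2) by auto
    qed
    then have "C_field.dimension (Suc (Suc 0)) K M" by (rule C_dimension_Suc[OF s_notin dim1])
    then show ?thesis unfolding degree_le_def by (intro exI[of _ 2]) (simp add: numeral_2_eq_2)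
  qed
qed

section \<open>Projective points and their fields of definition\<close>

lemma proj_rel_iff: "((x, y, z), q) \<in> proj_rel \<longleftrightarrow> (x, y, z) \<noteq> (0, 0, 0) \<and> (\<exists>c. c \<noteq> 0 \<and> q = (c * x, c * y, c * z))"
  unfolding proj_rel_def by (cases q) auto

lemma mem_pt: "q \<in> pt x y z \<longleftrightarrow> (x, y, z) \<noteq> (0, 0, 0) \<and> (\<exists>c. c \<noteq> 0 \<and> q = (c * x, c * y, c * z))"
  unfolding pt_def Image_singleton_iff proj_rel_iff ..

lemma pt_self: "(x, y, z) \<noteq> (0, 0, 0) \<Longrightarrow> (x, y, z) \<in> pt x y z"
  unfolding mem_pt by (intro conjI exI[of _ 1]) simp_all

lemma pt_scale:
  assumes "c \<noteq> 0" shows "pt (c * x) (c * y) (c * z) = pt x y z"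
proof (cases "(x, y, z) = (0, 0, 0)")
  case False
  then show ?thesis
    unfolding pt_def using equiv_class_eq[OF equiv_proj_rel proj_relI[OF False assms]] by simp
qed simp

lemma pt_eq_iff:
  assumes "(x, y, z) \<noteq> (0, 0, 0)"
  shows "pt x y z = pt x' y' z' \<longleftrightarrow> (\<exists>c. c \<noteq> 0 \<and> x' = c * x \<and> y' = c * y \<and> z' = c * z)"
proof
  assume "pt x y z = pt x' y' z'"
  then have "(x, y, z) \<in> pt x' y' z'" using pt_self[OF assms] by simp
  then have "(x', y', z') \<noteq> (0, 0, 0)" unfolding mem_pt by blast
  from pt_self[OF this] \<open>pt x y z = pt x' y' z'\<close> have "(x', y', z') \<in> pt x y z" by simp
  then show "\<exists>c. c \<noteq> 0 \<and> x' = c * x \<and> y' = c * y \<and> z' = c * z" unfolding mem_pt by blast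
next
  assume "\<exists>c. c \<noteq> 0 \<and> x' = c * x \<and> y' = c * y \<and> z' = c * z"
  then show "pt x y z = pt x' y' z'" using pt_scale by blast
qed

lemma P2_E:
  assumes "P \<in> P2"
  obtains x y z where "P = pt x y z" "(x, y, z) \<noteq> (0, 0, 0)"
  using assms unfolding P2_def pt_def by (elim quotientE) (metis DiffE insertI1 prod_cases3)

lemma pt_in_F4_iff: "pt x y z \<in> F4 \<longleftrightarrow> (x, y, z) \<noteq> (0, 0, 0) \<and> x ^ 4 + y ^ 4 = z ^ 4"
proof (cases "(x, y, z) = (0, 0, 0)")
  case True
  \<comment> \<open>The equation in \<open>F4\<close> holds vacuously for the empty set
    \<open>pt 0 0 0\<close>, so it is the membership in \<open>P2\<close> that excludes it.\<close>
  have "pt 0 0 0 = {}" using mem_pt[of _ 0 0 0] by blast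
  moreover have "{} \<notin> P2"
  proof
    assume "{} \<in> P2"
    then show False using pt_self by (elim P2_E) (metis empty_iff)
  qed
  ultimately show ?thesis using True unfolding F4_def by auto
next
  case False
  have "pt x y z \<in> P2" unfolding P2_def pt_def using False by (intro quotientI) simp
  moreover have "(\<forall>(x', y', z')\<in>pt x y z. x' ^ 4 + y' ^ 4 = z' ^ 4) \<longleftrightarrow> x ^ 4 + y ^ 4 = z ^ 4"
  proof
    assume "\<forall>(x', y', z')\<in>pt x y z. x' ^ 4 + y' ^ 4 = z' ^ 4"
    then show "x ^ 4 + y ^ 4 = z ^ 4" using pt_self[OF False] by blast
  next
    assume *: "x ^ 4 + y ^ 4 = z ^ 4"
    have "(c * x) ^ 4 + (c * y) ^ 4 = (c * z) ^ 4" for c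
      unfolding power_mult_distrib *[symmetric] by (simp add: distrib_left)
    then show "\<forall>(x', y', z')\<in>pt x y z. x' ^ 4 + y' ^ 4 = z' ^ 4" unfolding Ball_def mem_pt by auto
  qed
  ultimately show ?thesis unfolding F4_def using False by simp
qed

lemma F4_E:
  assumes "P \<in> F4"
  obtains x y z where "P = pt x y z" "(x, y, z) \<noteq> (0, 0, 0)" "x ^ 4 + y ^ 4 = z ^ 4"
proof -
  have "P \<in> P2" using assms unfolding F4_def by blast
  then obtain x y z where "P = pt x y z" "(x, y, z) \<noteq> (0, 0, 0)" by (rule P2_E)
  then show thesis using that assms pt_in_F4_iff by blast
qed

lemma field_of_definition_subset:
  assumes "complex_subfield M" "x \<in> M" "y \<in> M" "z \<in> M"
  shows "field_of_definition (pt x y z) \<subseteq> M"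
proof -
  interpret complex_subfield M by fact
  show ?thesis
    unfolding field_of_definition_def
  proof (rule Q_adj_minimal[OF assms(1)], rule subsetI)
    fix r assume "r \<in> {a / b | a b x' y' z'. (x', y', z') \<in> pt x y z \<and> a \<in> {x', y', z'} \<and> b \<in> {x', y', z'} \<and> b \<noteq> 0}"
    then obtain a b c where c: "c \<noteq> 0" and ab: "r = a / b" "a \<in> {c * x, c * y, c * z}" "b \<in> {c * x, c * y, c * z}"
      unfolding mem_pt by blast
    obtain a' where a': "a = c * a'" "a' \<in> M" using ab(2) assms by auto
    obtain b' where b': "b = c * b'" "b' \<in> M" using ab(3) assms by auto
    show "r \<in> M" unfolding ab(1) a'(1) b'(1) using c a'(2) b'(2) by simp
  qed
qed

lemma ratio_in_field_of_definition:
  assumes "z \<noteq> 0"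
  shows "x / z \<in> field_of_definition (pt x y z)" "y / z \<in> field_of_definition (pt x y z)"
proof -
  have "(x, y, z) \<in> pt x y z" using assms by (intro pt_self) simp
  then have "{x / z, y / z} \<subseteq> {a / b | a b x' y' z'. (x', y', z') \<in> pt x y z \<and> a \<in> {x', y', z'} \<and> b \<in> {x', y', z'} \<and> b \<noteq> 0}"
    using assms by blast
  then show "x / z \<in> field_of_definition (pt x y z)" "y / z \<in> field_of_definition (pt x y z)"
    unfolding field_of_definition_def using Q_adj_incl by blast+
qed

lemma quadratic_point_imp_exceptional:
  assumes "(x, y, z) \<noteq> (0, 0, 0)" "x ^ 4 + y ^ 4 = z ^ 4" "defined_over_quadratic_ext (pt x y z) K8"
  shows "exceptional (x ^ 4) (y ^ 4)"
proof (cases "x = 0 \<or> y = 0 \<or> z = 0")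
  case True
  then show ?thesis using assms(2) unfolding exceptional_def by auto
next
  case False
  define M where "M = Q_adj (K8 \<union> field_of_definition (pt x y z))"
  have M: "complex_subfield M" "K8 \<subseteq> M" "field_of_definition (pt x y z) \<subseteq> M"
    unfolding M_def using complex_subfield_Q_adj Q_adj_incl by blast+
  have "\<exists>s. quadratic_extension K8 s \<and> M \<subseteq> quadratic_extension.L K8 s"
  proof (cases "M = K8")
    case True
    \<comment> \<open>A point over K8 itself is viewed over some quadratic extension; 1 + sqrt 2 is
      a known nonsquare that provides one.\<close>
    have "csqrt (1 + rt2) \<notin> K8" using K8_square_neq(2)[of "csqrt (1 + rt2)"] by auto
    then interpret Q: quadratic_extension K8 "csqrt (1 + rt2)"
      by unfold_locales simp_all
    show ?thesis using True Q.K_subset_L Q.quadratic_extension_axioms by blast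
  next
    case False
    then show ?thesis
      using K8.L.degree_le_2_cases[OF _ M(1,2)] assms(3) unfolding defined_over_quadratic_ext_def M_def by blast
  qed
  then obtain s where s: "quadratic_extension K8 s" "M \<subseteq> quadratic_extension.L K8 s" by blast
  interpret Q: K8_quadratic s using s(1) unfolding K8_quadratic_def .
  have "x / z \<in> Q.L" "y / z \<in> Q.L" using ratio_in_field_of_definition[of z] False M(3) s(2) by blast+
  moreover have "(x / z) ^ 4 + (y / z) ^ 4 = 1 ^ 4"
    using assms(2) False by (simp add: power_divide flip: add_divide_distrib)
  ultimately have "exceptional ((x / z) ^ 4) ((y / z) ^ 4)"
    using False by (intro Q.quadratic_point_exceptional[of _ _ 1]) auto
  from exceptional_scale[OF this, of "z ^ 4"] show ?thesis using False by (simp add: power_divide)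
qed

lemma quadratic_ext_if_coords:
  assumes "s\<^sup>2 \<in> K8" "S \<subseteq> Q_adj (insert s K8)" "x \<in> Q_adj S" "y \<in> Q_adj S" "z \<in> Q_adj S"
  shows "defined_over_quadratic_ext (pt x y z) K8"
proof -
  define M where "M = Q_adj (K8 \<union> field_of_definition (pt x y z))"
  have M: "complex_subfield M" "K8 \<subseteq> M" unfolding M_def using complex_subfield_Q_adj Q_adj_incl by blast+
  \<comment> \<open>Formulated for an arbitrary field \<open>N\<close>, so that it applies to K8 if
    \<open>s\<close> lies there and to the quadratic extension otherwise.\<close>
  have sub: "M \<subseteq> N" if "complex_subfield N" "K8 \<subseteq> N" "s \<in> N" for N
  proof -
    have "Q_adj (insert s K8) \<subseteq> N" using that by (intro Q_adj_minimal) auto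
    then have "Q_adj S \<subseteq> N" using that(1) assms(2) by (intro Q_adj_minimal) auto
    then have "field_of_definition (pt x y z) \<subseteq> N"
      using that(1) assms(3-5) by (intro field_of_definition_subset) auto
    then show ?thesis unfolding M_def using that by (intro Q_adj_minimal) auto
  qed
  have "degree_le K8 M 2"
  proof (cases "s \<in> K8")
    case True
    have "csqrt (1 + rt2) \<notin> K8" using K8_square_neq(2)[of "csqrt (1 + rt2)"] by auto
    then interpret Q: quadratic_extension K8 "csqrt (1 + rt2)"
      by unfold_locales simp_all
    have "M \<subseteq> K8" using sub[OF K8.L.complex_subfield_axioms _ True] by simp
    then show ?thesis using M Q.K_subset_L by (intro Q.degree_le_2_intermediate) auto
  next
    case False
    then interpret Q: quadratic_extension K8 s
      by unfold_locales (use assms in auto)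
    show ?thesis using M sub[OF Q.L.complex_subfield_axioms Q.K_subset_L Q.s_in_L]
      by (intro Q.degree_le_2_intermediate) auto
  qed
  then show ?thesis unfolding defined_over_quadratic_ext_def M_def .
qed

section \<open>Fibres of the fourth power map\<close>

text \<open>A fibre is an orbit of \<open>\<mu>\<^sub>4\<^sup>3\<close>, and each of the four families is a union of fibres.\<close>

definition fibre :: "complex \<Rightarrow> complex \<Rightarrow> complex \<Rightarrow> (complex \<times> complex \<times> complex) set set" where
  "fibre a b c = {pt x y z | x y z. x ^ 4 = a \<and> y ^ 4 = b \<and> z ^ 4 = c}"

text \<open>Fourth powers map the quartic onto the line \<open>a + b = c\<close>, on which
  \<open>l\<close> is the affine coordinate \<open>a / c\<close>.\<close>

abbreviation affine_fibre :: "complex \<Rightarrow> (complex \<times> complex \<times> complex) set set" where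
  "affine_fibre l \<equiv> fibre l (1 - l) 1"

lemma fourth_power_eq_iff: "x ^ 4 = u ^ 4 \<longleftrightarrow> (\<exists>i\<in>{0..3::nat}. x = u * zeta 4 ^ i)"
proof -
  have "x ^ 4 - u ^ 4 = (x - u) * (x - u * \<i>) * (x + u) * (x + u * \<i>)"
    by (simp add: power4_eq_xxxx algebra_simps)
  then have "x ^ 4 = u ^ 4 \<longleftrightarrow> (x - u) * (x - u * \<i>) * (x + u) * (x + u * \<i>) = 0"
    by (metis eq_iff_diff_eq_0)
  also have "\<dots> \<longleftrightarrow> x = u \<or> x = u * \<i> \<or> x = - u \<or> x = - (u * \<i>)"
    by (auto simp: eq_neg_iff_add_eq_0)
  also have "\<dots> \<longleftrightarrow> (\<exists>i\<in>{0, 1, 2, 3::nat}. x = u * \<i> ^ i)"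
    by (simp add: power3_eq_cube power2_eq_square)
  also have "{0, 1, 2, 3::nat} = {0..3}" by auto
  finally show ?thesis unfolding zeta_4 .
qed

lemma zeta_4_power_4: "(zeta 4 ^ i) ^ 4 = 1"
  unfolding zeta_4 by (simp flip: power_mult add: mult.commute)

lemma fibre_pt: "pt x y z \<in> fibre (x ^ 4) (y ^ 4) (z ^ 4)"
  unfolding fibre_def by blast

lemma complex_root4:
  assumes "k \<noteq> 0" obtains w :: complex where "w ^ 4 = k" "w \<noteq> 0"
proof -
  have "(csqrt (csqrt k)) ^ 4 = ((csqrt (csqrt k))\<^sup>2)\<^sup>2" by (simp only: flip: power_mult) simp
  then have "(csqrt (csqrt k)) ^ 4 = k" by simp
  then show thesis using that assms by (metis power_zero_numeral)
qed

lemma fibre_scale: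
  assumes "k \<noteq> 0" shows "fibre (k * a) (k * b) (k * c) = fibre a b c"
proof -
  have sub: "fibre a b c \<subseteq> fibre (k * a) (k * b) (k * c)" if "k \<noteq> 0" for k a b c
  proof
    fix P assume "P \<in> fibre a b c"
    then obtain x y z where P: "P = pt x y z" "x ^ 4 = a" "y ^ 4 = b" "z ^ 4 = c" unfolding fibre_def by blast
    obtain w where w: "w ^ 4 = k" "w \<noteq> 0" using complex_root4[OF \<open>k \<noteq> 0\<close>] .
    have "P = pt (w * x) (w * y) (w * z)" using P(1) pt_scale[OF w(2)] by simp
    then show "P \<in> fibre (k * a) (k * b) (k * c)"
      using fibre_pt[of "w * x" "w * y" "w * z"] P w by (simp add: power_mult_distrib)
  qed
  have cancel: "inverse k * (k * x) = x" for x using assms by simp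
  have "fibre (k * a) (k * b) (k * c) \<subseteq> fibre a b c"
    using sub[of "inverse k" "k * a" "k * b" "k * c"] assms unfolding cancel by simp
  then show ?thesis using sub[OF assms, of a b c] by blast
qed

text \<open>These are the shapes in which the families list their points. Rescaling by
  \<open>w / z\<close>, a fourth root of unity, normalizes one coordinate and changes no fourth
  power.\<close>

lemma fibre_param:
  assumes "w \<noteq> 0"
  shows "{pt (u * zeta 4 ^ i) (v * zeta 4 ^ j) w | i j. i \<in> {0..3} \<and> j \<in> {0..3}} = fibre (u ^ 4) (v ^ 4) (w ^ 4)"
    and "{pt (u * zeta 4 ^ j) w (v * zeta 4 ^ i) | i j. i \<in> {0..3} \<and> j \<in> {0..3}} = fibre (u ^ 4) (w ^ 4) (v ^ 4)"
    and "{pt w (u * zeta 4 ^ i) (v * zeta 4 ^ j) | i j. i \<in> {0..3} \<and> j \<in> {0..3}} = fibre (w ^ 4) (u ^ 4) (v ^ 4)"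
proof -
  have p4: "(u * zeta 4 ^ i) ^ 4 = u ^ 4" for u i by (simp add: power_mult_distrib zeta_4_power_4)
  have norm: "\<exists>k. k \<noteq> 0 \<and> k * z = w \<and> (\<forall>x. (k * x) ^ 4 = x ^ 4)" if z: "z ^ 4 = w ^ 4" for z
  proof (intro exI conjI allI)
    have z0: "z \<noteq> 0" using z assms by auto
    then show "w / z \<noteq> 0" "w / z * z = w" using assms by simp_all
    show "(w / z * x) ^ 4 = x ^ 4" for x using z z0 assms by (simp add: power_mult_distrib power_divide)
  qed
  have root: "\<exists>i\<in>{0..3::nat}. x = u * zeta 4 ^ i" if "x ^ 4 = u ^ 4" for x u
    using that fourth_power_eq_iff by blast
  show "{pt (u * zeta 4 ^ i) (v * zeta 4 ^ j) w | i j. i \<in> {0..3} \<and> j \<in> {0..3}} = fibre (u ^ 4) (v ^ 4) (w ^ 4)"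
    (is "?A = ?B")
  proof
    show "?A \<subseteq> ?B" unfolding fibre_def using p4 by blast
    show "?B \<subseteq> ?A"
    proof
      fix P assume "P \<in> ?B"
      then obtain x y z where P: "P = pt x y z" "x ^ 4 = u ^ 4" "y ^ 4 = v ^ 4" "z ^ 4 = w ^ 4" unfolding fibre_def by blast
      obtain k where k: "k \<noteq> 0" "k * z = w" "\<And>x. (k * x) ^ 4 = x ^ 4" using norm[OF P(4)] by blast
      have "P = pt (k * x) (k * y) w" using P(1) pt_scale[OF k(1), of x y z] k(2) by simp
      moreover obtain i j where "i \<in> {0..3::nat}" "k * x = u * zeta 4 ^ i" "j \<in> {0..3::nat}" "k * y = v * zeta 4 ^ j"
        using root[of "k * x" u] root[of "k * y" v] k(3) P by metis
      ultimately show "P \<in> ?A" by auto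
    qed
  qed
  show "{pt (u * zeta 4 ^ j) w (v * zeta 4 ^ i) | i j. i \<in> {0..3} \<and> j \<in> {0..3}} = fibre (u ^ 4) (w ^ 4) (v ^ 4)"
    (is "?A = ?B")
  proof
    show "?A \<subseteq> ?B" unfolding fibre_def using p4 by blast
    show "?B \<subseteq> ?A"
    proof
      fix P assume "P \<in> ?B"
      then obtain x y z where P: "P = pt x z y" "x ^ 4 = u ^ 4" "y ^ 4 = v ^ 4" "z ^ 4 = w ^ 4" unfolding fibre_def by blast
      obtain k where k: "k \<noteq> 0" "k * z = w" "\<And>x. (k * x) ^ 4 = x ^ 4" using norm[OF P(4)] by blast
      have "P = pt (k * x) w (k * y)" using P(1) pt_scale[OF k(1), of x z y] k(2) by simp
      moreover obtain i j where "i \<in> {0..3::nat}" "k * x = u * zeta 4 ^ i" "j \<in> {0..3::nat}" "k * y = v * zeta 4 ^ j"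
        using root[of "k * x" u] root[of "k * y" v] k(3) P by metis
      ultimately show "P \<in> ?A" by auto
    qed
  qed
  show "{pt w (u * zeta 4 ^ i) (v * zeta 4 ^ j) | i j. i \<in> {0..3} \<and> j \<in> {0..3}} = fibre (w ^ 4) (u ^ 4) (v ^ 4)"
    (is "?A = ?B")
  proof
    show "?A \<subseteq> ?B" unfolding fibre_def using p4 by blast
    show "?B \<subseteq> ?A"
    proof
      fix P assume "P \<in> ?B"
      then obtain x y z where P: "P = pt z x y" "x ^ 4 = u ^ 4" "y ^ 4 = v ^ 4" "z ^ 4 = w ^ 4" unfolding fibre_def by blast
      obtain k where k: "k \<noteq> 0" "k * z = w" "\<And>x. (k * x) ^ 4 = x ^ 4" using norm[OF P(4)] by blast
      have "P = pt w (k * x) (k * y)" using P(1) pt_scale[OF k(1), of z x y] k(2) by simp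
      moreover obtain i j where "i \<in> {0..3::nat}" "k * x = u * zeta 4 ^ i" "j \<in> {0..3::nat}" "k * y = v * zeta 4 ^ j"
        using root[of "k * x" u] root[of "k * y" v] k(3) P by metis
      ultimately show "P \<in> ?A" by auto
    qed
  qed
qed

lemma card_fibre_1:
  assumes "l \<noteq> 0 \<or> m \<noteq> 0"
  shows "card (fibre l m 1) = card {x::complex. x ^ 4 = l} * card {x::complex. x ^ 4 = m}" "finite (fibre l m 1)"
proof -
  have fin: "finite {x::complex. x ^ 4 = l}" for l
    using finite_nth_roots[of 4 l] by simp
  let ?S = "{x::complex. x ^ 4 = l} \<times> {x::complex. x ^ 4 = m}"
  have img: "fibre l m 1 = (\<lambda>(x, y). pt x y 1) ` ?S"
  proof
    show "fibre l m 1 \<subseteq> (\<lambda>(x, y). pt x y 1) ` ?S"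
    proof
      fix P assume "P \<in> fibre l m 1"
      then obtain x y z where P: "P = pt x y z" "x ^ 4 = l" "y ^ 4 = m" "z ^ 4 = 1" unfolding fibre_def by blast
      then have z: "z \<noteq> 0" by auto
      have "P = pt (x / z) (y / z) 1" using P(1) pt_scale[of "inverse z" x y z] z by (simp add: divide_inverse mult.commute)
      moreover have "(x / z) ^ 4 = l" "(y / z) ^ 4 = m" using P by (simp_all add: power_divide)
      ultimately show "P \<in> (\<lambda>(x, y). pt x y 1) ` ?S" by auto
    qed
    show "(\<lambda>(x, y). pt x y 1) ` ?S \<subseteq> fibre l m 1" unfolding fibre_def by force
  qed
  have "inj_on (\<lambda>(x, y). pt x y 1) ?S" by (rule inj_onI) (auto simp: pt_eq_iff)
  then show "card (fibre l m 1) = card {x::complex. x ^ 4 = l} * card {x::complex. x ^ 4 = m}"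
    unfolding img by (simp add: card_image card_cartesian_product)
  show "finite (fibre l m 1)" unfolding img using fin by blast
qed

lemma card_roots4: "l \<noteq> 0 \<Longrightarrow> card {x::complex. x ^ 4 = l} = 4" "card {x::complex. x ^ 4 = 0} = 1"
  using card_nth_roots[of l 4] by simp_all

lemma fibre_Int_E:
  assumes "P \<in> fibre a b c" "P \<in> fibre a' b' c'" "(a, b, c) \<noteq> (0, 0, 0)"
  obtains k where "k \<noteq> 0" "a' = k * a" "b' = k * b" "c' = k * c"
proof -
  obtain x y z x' y' z' where e: "pt x y z = pt x' y' z'" "x ^ 4 = a" "y ^ 4 = b" "z ^ 4 = c" "x' ^ 4 = a'" "y' ^ 4 = b'" "z' ^ 4 = c'"
    using assms(1,2) unfolding fibre_def by blast
  then have "(x, y, z) \<noteq> (0, 0, 0)" using assms(3) by auto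
  then obtain k where "k \<noteq> 0" "x' = k * x" "y' = k * y" "z' = k * z" using e(1) pt_eq_iff by blast
  then show thesis using that[of "k ^ 4"] e(2-) by (simp add: power_mult_distrib)
qed

lemma affine_fibre_disjoint: "l \<noteq> m \<Longrightarrow> affine_fibre l \<inter> affine_fibre m = {}"
proof (rule ccontr)
  assume "l \<noteq> m" "affine_fibre l \<inter> affine_fibre m \<noteq> {}"
  then obtain P where P: "P \<in> affine_fibre l" "P \<in> affine_fibre m" by blast
  show False by (rule fibre_Int_E[OF P]) (use \<open>l \<noteq> m\<close> in auto)
qed

lemma card_UN_affine_fibre:
  assumes "finite A" "0 \<notin> A" "1 \<notin> A"
  shows "card (\<Union>l\<in>A. affine_fibre l) = 16 * card A" "finite (\<Union>l\<in>A. affine_fibre l)"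
proof -
  have *: "card (affine_fibre l) = 16" if "l \<in> A" for l
  proof -
    have "l \<noteq> 0" "1 - l \<noteq> 0" using that assms by auto
    then show ?thesis using card_fibre_1(1)[of l "1 - l"] card_roots4(1)[of l] card_roots4(1)[of "1 - l"] by simp
  qed
  have fin: "finite (affine_fibre l)" for l by (rule card_fibre_1(2)) auto
  show "card (\<Union>l\<in>A. affine_fibre l) = 16 * card A"
    using card_UN_disjoint[of A affine_fibre] assms(1) fin affine_fibre_disjoint * by simp
  show "finite (\<Union>l\<in>A. affine_fibre l)" using assms(1) fin by blast
qed

lemma affine_fibre_scale:
  assumes "c \<noteq> 0" "b = c - a" shows "fibre a b c = affine_fibre (a / c)"
proof -
  have "inverse c * a = a / c" "inverse c * b = 1 - a / c" "inverse c * c = 1"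
    using assms by (simp_all add: field_simps)
  with fibre_scale[of "inverse c" a b c] assms(1) show ?thesis by simp
qed

section \<open>The families as unions of fibres\<close>

lemma zeta_3_eq: "(zeta 3)\<^sup>2 + zeta 3 + 1 = 0"
proof -
  have z: "zeta 3 = cis (2 * pi / 3)" unfolding zeta_def cis_conv_exp by (simp add: field_simps)
  have cs: "cos (2 * pi / 3) = - 1 / 2" "sin (2 * pi / 3) = sqrt 3 / 2"
    using cos_120 sin_120 by simp_all
  have "sin (2 * pi / 3) * sin (2 * pi / 3) = 3 / 4" unfolding cs by simp
  with cs(1) show ?thesis unfolding z by (simp add: complex_eq_iff power2_eq_square)
qed

lemma zeta_3_cube: "zeta 3 ^ 3 = 1"
proof -
  have "zeta 3 ^ 3 - 1 = (zeta 3 - 1) * ((zeta 3)\<^sup>2 + zeta 3 + 1)"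
    by (simp add: power2_eq_square power3_eq_cube algebra_simps)
  then show ?thesis using zeta_3_eq by simp
qed

lemma root4_2_power: "root4_2\<^sup>2 = rt2" "root4_2 ^ 4 = 2"
proof -
  have "(root 4 2)\<^sup>2 = sqrt 2"
    by (rule real_sqrt_unique[symmetric]) (simp_all flip: power_mult)
  then show 1: "root4_2\<^sup>2 = rt2" unfolding root4_2_def rt2_def by (simp flip: of_real_power)
  have "root4_2 ^ 4 = (root4_2\<^sup>2)\<^sup>2" by (simp flip: power_mult)
  then show "root4_2 ^ 4 = 2" unfolding 1 rt2_square .
qed

lemma sqrt_m7_square: "sqrt_m7\<^sup>2 = - 7"
proof -
  have "(complex_of_real (sqrt 7))\<^sup>2 = 7" by (simp flip: of_real_power)
  then show ?thesis unfolding sqrt_m7_def zeta_4 by (simp add: power_mult_distrib)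
qed

definition beta :: complex where "beta = alpha ^ 4"
definition beta_bar :: complex where "beta_bar = alpha_bar ^ 4"

lemma beta_eq: "beta = (1 - 3 * sqrt_m7) / 2" "beta_bar = (1 + 3 * sqrt_m7) / 2"
proof -
  have s: "sqrt_m7 * sqrt_m7 = - 7" "sqrt_m7 * (sqrt_m7 * a) = - 7 * a" for a
    using sqrt_m7_square by (simp_all add: power2_eq_square flip: mult.assoc)
  have a2: "alpha\<^sup>2 = (- 3 + sqrt_m7) / 2" "alpha_bar\<^sup>2 = (- 3 - sqrt_m7) / 2"
    unfolding alpha_def alpha_bar_def by (simp_all add: power2_eq_square field_simps s)
  have e: "alpha ^ 4 = (alpha\<^sup>2)\<^sup>2" "alpha_bar ^ 4 = (alpha_bar\<^sup>2)\<^sup>2" by (simp_all flip: power_mult)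
  show "beta = (1 - 3 * sqrt_m7) / 2" "beta_bar = (1 + 3 * sqrt_m7) / 2"
    unfolding beta_def beta_bar_def e a2 by (simp_all add: power2_eq_square field_simps s)
qed

text \<open>The sum places \<open>[alpha : alpha_bar : 1]\<close> on the quartic. Together with the
  product it makes \<open>beta\<close> and \<open>beta_bar\<close> the roots of
  \<open>T^2 - T + 16\<close>.\<close>

lemma beta_sum_prod: "beta + beta_bar = 1" "beta * beta_bar = 16"
proof -
  show "beta + beta_bar = 1" unfolding beta_eq by (simp add: field_simps)
  have "beta * beta_bar = (1 - 9 * sqrt_m7\<^sup>2) / 4" unfolding beta_eq by (simp add: power2_eq_square field_simps)
  then show "beta * beta_bar = 16" unfolding sqrt_m7_square by simp
qed

lemma beta_neq: "beta \<noteq> beta_bar"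
  using sqrt_m7_square unfolding beta_eq by auto

text \<open>The three sets contain the values of \<open>(x / z)^4\<close> in the second, third and
  fourth family. Each is an orbit of the group generated by \<open>l\<close> to \<open>1 - l\<close>
  and \<open>l\<close> to \<open>1 / l\<close>, which comes from permuting the coordinates.\<close>

definition ratios2 :: "complex set" where "ratios2 = {2, -1, 1 / 2}"
definition ratios3 :: "complex set" where "ratios3 = {- zeta 3, - (zeta 3)\<^sup>2}"
definition ratios4 :: "complex set" where
  "ratios4 = {beta, beta_bar, - (beta_bar / beta), - (beta / beta_bar), 1 / beta_bar, 1 / beta}"

lemma family1_eq: "family1 = fibre 0 1 1 \<union> fibre 1 0 1 \<union> fibre (- 1) 1 0"
proof -
  have 1: "{pt 0 (zeta 4 ^ i) 1 | i. i \<in> {0..3}} = fibre 0 1 1"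
    using fibre_param(1)[of 1 0 1] by auto
  have 2: "{pt (zeta 4 ^ i) 0 1 | i. i \<in> {0..3}} = fibre 1 0 1"
    using fibre_param(1)[of 1 1 0] by auto
  have 3: "{pt (zeta 8 * zeta 4 ^ i) 1 0 | i. i \<in> {0..3}} = fibre (- 1) 1 0"
    using fibre_param(2)[of 1 "zeta 8" 0] by (auto simp: zeta_8_power_4)
  show ?thesis unfolding family1_def 1 2 3 ..
qed

lemma zeta_8_powers:
  "zeta 8 ^ (1 + 2 * j) = zeta 8 * zeta 4 ^ j" "zeta 8 ^ (2 + 2 * j) = zeta 4 * zeta 4 ^ j"
  "zeta 8 ^ (7 + 2 * j) = zeta 8 ^ 7 * zeta 4 ^ j"
  unfolding power_add power_mult zeta_8_square zeta_4 by simp_all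

lemma family2_eq: "family2 = (\<Union>l\<in>ratios2. affine_fibre l)"
proof -
  have 1: "{pt (root4_2 * zeta 4 ^ i) (zeta 8 ^ (1 + 2 * j)) 1 | i j. i \<in> {0..3} \<and> j \<in> {0..3}} = affine_fibre 2"
    unfolding zeta_8_powers by (subst fibre_param(1)) (simp_all add: root4_2_power zeta_8_power_4)
  have 2: "{pt (zeta 8 ^ (1 + 2 * j)) (root4_2 * zeta 4 ^ i) 1 | i j. i \<in> {0..3} \<and> j \<in> {0..3}} = affine_fibre (- 1)"
  proof -
    have "{pt (zeta 8 ^ (1 + 2 * j)) (root4_2 * zeta 4 ^ i) 1 | i j. i \<in> {0..3} \<and> j \<in> {0..3}} =
      {pt (zeta 8 * zeta 4 ^ i) (root4_2 * zeta 4 ^ j) 1 | i j. i \<in> {0..3} \<and> j \<in> {0..3}}"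
      unfolding zeta_8_powers by blast
    then show ?thesis by (subst (asm) fibre_param(1)) (simp_all add: root4_2_power zeta_8_power_4)
  qed
  have 3: "{pt (inverse root4_2 * zeta 4 ^ i) (inverse root4_2 * zeta 4 ^ j) 1 | i j. i \<in> {0..3} \<and> j \<in> {0..3}} = affine_fibre (1 / 2)"
    by (subst fibre_param(1)) (simp_all add: power_inverse root4_2_power)
  show ?thesis unfolding family2_def ratios2_def 1 2 3 by auto
qed

lemma family3_eq: "family3 = (\<Union>l\<in>ratios3. affine_fibre l)"
proof -
  have p: "zeta 3 ^ 4 = zeta 3" "((zeta 3)\<^sup>2) ^ 4 = (zeta 3)\<^sup>2"
  proof -
    have "zeta 3 ^ 4 = zeta 3 ^ 3 * zeta 3" by (simp add: power4_eq_xxxx power3_eq_cube)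
    then show "zeta 3 ^ 4 = zeta 3" unfolding zeta_3_cube by simp
    moreover have "((zeta 3)\<^sup>2) ^ 4 = (zeta 3 ^ 4)\<^sup>2" by (simp flip: power_mult)
    ultimately show "((zeta 3)\<^sup>2) ^ 4 = (zeta 3)\<^sup>2" by simp
  qed
  have p8: "zeta 3 ^ 8 = (zeta 3)\<^sup>2" using p(2) by simp
  have q: "1 + zeta 3 = - (zeta 3)\<^sup>2" "1 + (zeta 3)\<^sup>2 = - zeta 3"
    using zeta_3_eq by (simp_all add: eq_neg_iff_add_eq_0 ac_simps)
  have 1: "{pt (zeta 3 * zeta 8 ^ (1 + 2 * i)) (zeta 3 ^ 2 * zeta 8 ^ (1 + 2 * j)) 1 | i j. i \<in> {0..3} \<and> j \<in> {0..3}} = affine_fibre (- zeta 3)"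
    unfolding zeta_8_powers mult.assoc[symmetric]
    by (subst fibre_param(1)) (simp_all add: power_mult_distrib p p8 q zeta_8_power_4)
  have 2: "{pt (zeta 3 ^ 2 * zeta 8 ^ (1 + 2 * i)) (zeta 3 * zeta 8 ^ (1 + 2 * j)) 1 | i j. i \<in> {0..3} \<and> j \<in> {0..3}} = affine_fibre (- (zeta 3)\<^sup>2)"
    unfolding zeta_8_powers mult.assoc[symmetric]
    by (subst fibre_param(1)) (simp_all add: power_mult_distrib p p8 q zeta_8_power_4)
  show ?thesis unfolding family3_def ratios3_def 1 2 by auto
qed

lemma family4_eq: "family4 = (\<Union>l\<in>ratios4. affine_fibre l)"
proof -
  have nz: "beta \<noteq> 0" "beta_bar \<noteq> 0" using beta_sum_prod by auto
  have p: "alpha ^ 4 = beta" "alpha_bar ^ 4 = beta_bar" unfolding beta_def beta_bar_def by simp_all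
  have d: "beta_bar = 1 - beta" "beta = 1 - beta_bar" using beta_sum_prod(1) by (simp_all add: algebra_simps)
  have d': "1 = beta - - beta_bar" "1 = beta_bar - - beta" "- beta = beta_bar - 1" "- beta_bar = beta - 1"
    using beta_sum_prod(1) by (simp_all add: algebra_simps)
  have z7: "(zeta 8 ^ 7) ^ 4 = - 1"
  proof -
    have "(zeta 8 ^ 7) ^ 4 = (zeta 8 ^ 4) ^ 7" by (simp flip: power_mult)
    then show ?thesis unfolding zeta_8_power_4 by simp
  qed
  have z43: "(zeta 4 ^ 3) ^ 4 = 1" "zeta 4 ^ 4 = 1" "zeta 4 \<noteq> 0" unfolding zeta_4 by (simp_all flip: power_mult)
  then have z12: "zeta 4 ^ 12 = 1" "zeta 8 ^ 28 = - 1" using z7 by simp_all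
  have 1: "{pt (alpha * zeta 4 ^ i) (alpha_bar * zeta 4 ^ j) 1 | i j. i \<in> {0..3} \<and> j \<in> {0..3}} = affine_fibre beta"
    by (subst fibre_param(1)) (simp_all add: p d(1))
  have 2: "{pt (alpha_bar * zeta 4 ^ i) (alpha * zeta 4 ^ j) 1 | i j. i \<in> {0..3} \<and> j \<in> {0..3}} = affine_fibre beta_bar"
    by (subst fibre_param(1)) (simp_all add: p d(2))
  have 3: "{pt (alpha_bar * zeta 8 ^ (7 + 2 * j)) (zeta 4 ^ 3) (alpha * zeta 4 ^ i) | i j. i \<in> {0..3} \<and> j \<in> {0..3}}
      = affine_fibre (- (beta_bar / beta))"
  proof -
    have "{pt (alpha_bar * zeta 8 ^ (7 + 2 * j)) (zeta 4 ^ 3) (alpha * zeta 4 ^ i) | i j. i \<in> {0..3} \<and> j \<in> {0..3}} = fibre (- beta_bar) 1 beta"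
      unfolding zeta_8_powers mult.assoc[symmetric]
      by (subst fibre_param(2)) (simp_all add: power_mult_distrib p z12 z43)
    then show ?thesis using affine_fibre_scale[OF nz(1) d'(1)] by simp
  qed
  have 4: "{pt (alpha * zeta 8 ^ (7 + 2 * j)) (zeta 4 ^ 3) (alpha_bar * zeta 4 ^ i) | i j. i \<in> {0..3} \<and> j \<in> {0..3}}
      = affine_fibre (- (beta / beta_bar))"
  proof -
    have "{pt (alpha * zeta 8 ^ (7 + 2 * j)) (zeta 4 ^ 3) (alpha_bar * zeta 4 ^ i) | i j. i \<in> {0..3} \<and> j \<in> {0..3}} = fibre (- beta) 1 beta_bar"
      unfolding zeta_8_powers mult.assoc[symmetric]
      by (subst fibre_param(2)) (simp_all add: power_mult_distrib p z12 z43)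
    then show ?thesis using affine_fibre_scale[OF nz(2) d'(2)] by simp
  qed
  have 5: "{pt 1 (alpha * zeta 8 ^ (1 + 2 * i)) (alpha_bar * zeta 8 ^ (2 + 2 * j)) | i j. i \<in> {0..3} \<and> j \<in> {0..3}}
      = affine_fibre (1 / beta_bar)"
  proof -
    have "{pt 1 (alpha * zeta 8 ^ (1 + 2 * i)) (alpha_bar * zeta 8 ^ (2 + 2 * j)) | i j. i \<in> {0..3} \<and> j \<in> {0..3}} = fibre 1 (- beta) beta_bar"
      unfolding zeta_8_powers mult.assoc[symmetric]
      by (subst fibre_param(3)) (simp_all add: power_mult_distrib p z43 zeta_8_power_4)
    then show ?thesis using affine_fibre_scale[OF nz(2) d'(3)] by simp
  qed
  have 6: "{pt 1 (alpha_bar * zeta 8 ^ (1 + 2 * i)) (alpha * zeta 8 ^ (2 + 2 * j)) | i j. i \<in> {0..3} \<and> j \<in> {0..3}}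
      = affine_fibre (1 / beta)"
  proof -
    have "{pt 1 (alpha_bar * zeta 8 ^ (1 + 2 * i)) (alpha * zeta 8 ^ (2 + 2 * j)) | i j. i \<in> {0..3} \<and> j \<in> {0..3}} = fibre 1 (- beta_bar) beta"
      unfolding zeta_8_powers mult.assoc[symmetric]
      by (subst fibre_param(3)) (simp_all add: power_mult_distrib p z43 zeta_8_power_4)
    then show ?thesis using affine_fibre_scale[OF nz(1) d'(4)] by simp
  qed
  show ?thesis unfolding family4_def ratios4_def 1 2 3 4 5 6 by auto
qed

lemma ratios2_iff: "l \<in> ratios2 \<longleftrightarrow> (l - 2) * (l + 1) * (2 * l - 1) = 0"
proof -
  have "l = 1 / 2 \<longleftrightarrow> 2 * l - 1 = 0" by (auto simp: field_simps)
  then show ?thesis unfolding ratios2_def mult_eq_0_iff by (simp add: eq_neg_iff_add_eq_0)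
qed

lemma ratios3_iff: "l \<in> ratios3 \<longleftrightarrow> l\<^sup>2 - l + 1 = 0"
proof -
  have "(l + zeta 3) * (l + (zeta 3)\<^sup>2) = l\<^sup>2 + ((zeta 3)\<^sup>2 + zeta 3 + 1) * l - l + zeta 3 ^ 3"
    by (simp add: power2_eq_square power3_eq_cube algebra_simps)
  also have "\<dots> = l\<^sup>2 - l + 1" unfolding zeta_3_eq zeta_3_cube by simp
  finally show ?thesis unfolding ratios3_def by (auto simp: eq_neg_iff_add_eq_0)
qed

text \<open>The six values form three conjugate pairs, each with a quadratic computed from
  \<open>beta_sum_prod\<close>. The quadratics are those of \<open>exceptional\<close> restricted to
  \<open>a + b = 1\<close>.\<close>

lemma ratios4_iff:
  "l \<in> ratios4 \<longleftrightarrow> l\<^sup>2 - l + 16 = 0 \<or> 16 * l\<^sup>2 - l + 1 = 0 \<or> 16 * l\<^sup>2 - 31 * l + 16 = 0"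
proof -
  have nz: "beta \<noteq> 0" "beta_bar \<noteq> 0" using beta_sum_prod by auto
  have sq: "beta\<^sup>2 + beta_bar\<^sup>2 = - 31"
  proof -
    have "beta\<^sup>2 + beta_bar\<^sup>2 = (beta + beta_bar)\<^sup>2 - 2 * (beta * beta_bar)" by (simp add: power2_eq_square algebra_simps)
    then show ?thesis unfolding beta_sum_prod by simp
  qed
  have "(l - beta) * (l - beta_bar) = l\<^sup>2 - (beta + beta_bar) * l + beta * beta_bar"
    by (simp add: power2_eq_square algebra_simps)
  then have 1: "(l - beta) * (l - beta_bar) = l\<^sup>2 - l + 16" unfolding beta_sum_prod by simp
  have "(l * beta - 1) * (l * beta_bar - 1) = (beta * beta_bar) * l\<^sup>2 - (beta + beta_bar) * l + 1"
    by (simp add: power2_eq_square algebra_simps)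
  then have 2: "(l * beta - 1) * (l * beta_bar - 1) = 16 * l\<^sup>2 - l + 1" unfolding beta_sum_prod by simp
  have "(l * beta + beta_bar) * (l * beta_bar + beta) = (beta * beta_bar) * l\<^sup>2 + (beta\<^sup>2 + beta_bar\<^sup>2) * l + beta * beta_bar"
    by (simp add: power2_eq_square algebra_simps)
  then have 3: "(l * beta + beta_bar) * (l * beta_bar + beta) = 16 * l\<^sup>2 - 31 * l + 16" unfolding beta_sum_prod sq by simp
  have "l \<in> ratios4 \<longleftrightarrow> (l - beta) * (l - beta_bar) = 0 \<or> (l * beta - 1) * (l * beta_bar - 1) = 0 \<or> (l * beta + beta_bar) * (l * beta_bar + beta) = 0"
  proof -
    have "l = 1 / beta \<longleftrightarrow> l * beta - 1 = 0" "l = 1 / beta_bar \<longleftrightarrow> l * beta_bar - 1 = 0"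
      "l = - (beta_bar / beta) \<longleftrightarrow> l * beta + beta_bar = 0" "l = - (beta / beta_bar) \<longleftrightarrow> l * beta_bar + beta = 0"
      using nz by (simp_all add: minus_divide_left eq_divide_eq eq_neg_iff_add_eq_0 del: minus_divide_left[symmetric])
    then show ?thesis unfolding ratios4_def mult_eq_0_iff by auto
  qed
  then show ?thesis unfolding 1 2 3 .
qed

lemma ratios_0_1: "0 \<notin> ratios2 \<union> ratios3 \<union> ratios4" "1 \<notin> ratios2 \<union> ratios3 \<union> ratios4"
  unfolding Un_iff ratios2_iff ratios3_iff ratios4_iff by simp_all

lemma finite_ratios: "finite ratios2" "finite ratios3" "finite ratios4"
  unfolding ratios2_def ratios3_def ratios4_def by simp_all

lemma ratios_disjoint: "ratios2 \<inter> ratios3 = {}" "(ratios2 \<union> ratios3) \<inter> ratios4 = {}"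
proof -
  have 2: "l\<^sup>2 - l + 1 \<noteq> 0" "l \<notin> ratios4" if "l \<in> ratios2" for l
    using that unfolding ratios4_iff ratios2_def by (elim insertE emptyE; hypsubst; simp add: power2_eq_square)+
  then show "ratios2 \<inter> ratios3 = {}" unfolding ratios3_iff[abs_def] by (auto simp: ratios3_iff)
  have "l \<notin> ratios4" if "l \<in> ratios3" for l
  proof
    have l2: "l\<^sup>2 = l - 1" using that unfolding ratios3_iff by (simp add: algebra_simps)
    assume "l \<in> ratios4"
    then have "l = 1 \<or> l = 0" unfolding ratios4_iff l2 by auto
    then show False using that ratios_0_1 by auto
  qed
  with 2 show "(ratios2 \<union> ratios3) \<inter> ratios4 = {}" by blast
qed

lemma card_ratios: "card ratios2 = 3" "card ratios3 = 2" "card ratios4 = 6"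
proof -
  have "2 \<noteq> (- 1 :: complex)" "2 \<noteq> (1 / 2 :: complex)" "- 1 \<noteq> (1 / 2 :: complex)"
    by (simp_all add: complex_eq_iff)
  then show "card ratios2 = 3" unfolding ratios2_def by simp
  have "zeta 3 \<noteq> (zeta 3)\<^sup>2"
  proof
    assume *: "zeta 3 = (zeta 3)\<^sup>2"
    then have "zeta 3 = 1" using zeta_3_cube by (metis mult_cancel_left2 power2_eq_square power_zero_numeral zero_neq_one)
    then show False using zeta_3_eq by simp
  qed
  then show "card ratios3 = 2" unfolding ratios3_def by simp
  have nz: "beta \<noteq> 0" "beta_bar \<noteq> 0" using beta_sum_prod by auto
  have sq: "beta\<^sup>2 = beta - 16" "beta_bar\<^sup>2 = beta_bar - 16"
  proof -
    have "beta\<^sup>2 = beta * (beta + beta_bar) - beta * beta_bar" "beta_bar\<^sup>2 = beta_bar * (beta + beta_bar) - beta * beta_bar"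
      by (simp_all add: power2_eq_square algebra_simps)
    then show "beta\<^sup>2 = beta - 16" "beta_bar\<^sup>2 = beta_bar - 16" unfolding beta_sum_prod by simp_all
  qed
  \<comment> \<open>The three conjugate pairs. Eliminating \<open>l^2\<close> between the quadratics
    of two pairs leaves \<open>l = - 16\<close>, \<open>l = 17\<close> or \<open>l = 1 / 2\<close>,
    none of which is a root.\<close>
  define A B C where "A = {beta, beta_bar}" and "B = {- (beta_bar / beta), - (beta / beta_bar)}" and "C = {1 / beta_bar, 1 / beta}"
  have A: "l\<^sup>2 = l - 16" if "l \<in> A" for l using that sq unfolding A_def by auto
  have quotient: "16 * (- (b' / b))\<^sup>2 = 31 * (- (b' / b)) - 16"
    if b: "b \<noteq> 0" "b + b' = 1" "b * b' = 16" for b b' :: complex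
  proof -
    have "16 * b'\<^sup>2 + 31 * (b * b') + 16 * b\<^sup>2 = 16 * (b + b')\<^sup>2 - b * b'" by (simp add: power2_eq_square algebra_simps)
    also have "\<dots> = 0" unfolding b by simp
    finally have "(16 * b'\<^sup>2 + 31 * (b * b') + 16 * b\<^sup>2) / b\<^sup>2 = 0" by simp
    moreover have "(16 * b'\<^sup>2 + 31 * (b * b') + 16 * b\<^sup>2) / b\<^sup>2 = 16 * (- (b' / b))\<^sup>2 - (31 * (- (b' / b)) - 16)"
      using b(1) by (simp add: add_divide_distrib power_divide) (simp add: power2_eq_square)
    ultimately show ?thesis by simp
  qed
  have "beta_bar + beta = 1" "beta_bar * beta = 16" using beta_sum_prod by (simp_all add: ac_simps)
  note quotients = quotient[OF nz(1) beta_sum_prod] quotient[OF nz(2) this]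
  have B: "16 * l\<^sup>2 = 31 * l - 16" if "l \<in> B" for l
    using that quotients unfolding B_def by (elim insertE emptyE) (simp_all only:)
  have C: "16 * l\<^sup>2 = l - 1" if l: "l \<in> C" for l
  proof -
    obtain b where b: "l = 1 / b" "b \<noteq> 0" "b\<^sup>2 = b - 16"
      using l nz sq unfolding C_def by blast
    have "16 * l\<^sup>2 - (l - 1) = (16 - b + b\<^sup>2) / b\<^sup>2"
      unfolding b(1) using b(2) by (simp add: add_divide_distrib diff_divide_distrib power_divide) (simp add: power2_eq_square)
    then show ?thesis unfolding b(3) by simp
  qed
  have AB: "A \<inter> B = {}"
  proof (intro equals0I, elim IntE)
    fix l assume l: "l \<in> A" "l \<in> B"
    have "15 * (l + 16) = 0" using B[OF l(2)] unfolding A[OF l(1)] by (simp add: algebra_simps)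
    then have "l = - 16" unfolding mult_eq_0_iff eq_neg_iff_add_eq_0 by simp
    then show False using A[OF l(1)] by (simp add: power2_eq_square)
  qed
  have AC: "A \<inter> C = {}"
  proof (intro equals0I, elim IntE)
    fix l assume l: "l \<in> A" "l \<in> C"
    have "15 * l = 15 * 17" using C[OF l(2)] unfolding A[OF l(1)] by (simp add: algebra_simps)
    then have "l = 17" by simp
    then show False using A[OF l(1)] by (simp add: power2_eq_square)
  qed
  have BC: "B \<inter> C = {}"
  proof (intro equals0I, elim IntE)
    fix l assume l: "l \<in> B" "l \<in> C"
    have "31 * l - 16 = l - 1" unfolding B[OF l(1), symmetric] C[OF l(2)] ..
    moreover have "15 * (2 * l - 1) = (31 * l - 16) - (l - 1)" by (simp add: algebra_simps)
    ultimately have "15 * (2 * l - 1) = 0" by (simp only: diff_self)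
    then have half: "l = 1 / 2" unfolding mult_eq_0_iff by (simp add: field_simps)
    from C[OF l(2)] show False unfolding half by (simp add: power2_eq_square complex_eq_iff)
  qed
  have "beta\<^sup>2 \<noteq> beta_bar\<^sup>2" unfolding sq using beta_neq by simp
  then have "beta_bar / beta \<noteq> beta / beta_bar" using nz by (auto simp: field_simps power2_eq_square)
  then have card: "card A = 2" "card B = 2" "card C = 2"
    unfolding A_def B_def C_def using beta_neq nz by (simp_all add: field_simps)
  have fin: "finite A" "finite B" "finite C" unfolding A_def B_def C_def by simp_all
  have "card (A \<union> B) = 4" using card_Un_disjoint[OF fin(1,2) AB] card by simp
  moreover have "(A \<union> B) \<inter> C = {}" using AC BC by blast
  ultimately have "card (A \<union> B \<union> C) = 6" using card_Un_disjoint[of "A \<union> B" C] fin card by simp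
  moreover have "ratios4 = A \<union> B \<union> C" unfolding ratios4_def A_def B_def C_def by auto
  ultimately show "card ratios4 = 6" by simp
qed

lemma exceptional_imp_ratios:
  assumes "exceptional l (1 - l)" "l \<noteq> 0" "l \<noteq> 1"
  shows "l \<in> ratios2 \<union> ratios3 \<union> ratios4"
proof -
  have eqs: "l\<^sup>2 + l * (1 - l) + (1 - l)\<^sup>2 = l\<^sup>2 - l + 1" "16 * l\<^sup>2 + 31 * l * (1 - l) + 16 * (1 - l)\<^sup>2 = l\<^sup>2 - l + 16"
    "16 * l\<^sup>2 + l * (1 - l) + (1 - l)\<^sup>2 = 16 * l\<^sup>2 - l + 1" "l\<^sup>2 + l * (1 - l) + 16 * (1 - l)\<^sup>2 = 16 * l\<^sup>2 - 31 * l + 16"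
    by (simp_all add: power2_eq_square algebra_simps)
  moreover have "l = 1 - l \<longleftrightarrow> 2 * l - 1 = 0" "2 * l + (1 - l) = l + 1" "l + 2 * (1 - l) = - (l - 2)"
    by (auto simp: algebra_simps)
  ultimately show ?thesis
    using assms unfolding exceptional_def eqs Un_iff ratios2_iff ratios3_iff ratios4_iff by auto
qed

lemma mem_families:
  assumes "(x, y, z) \<noteq> (0, 0, 0)" "x ^ 4 + y ^ 4 = z ^ 4" "exceptional (x ^ 4) (y ^ 4)"
  shows "pt x y z \<in> family1 \<union> family2 \<union> family3 \<union> family4"
proof -
  have P: "pt x y z \<in> fibre (x ^ 4) (y ^ 4) (z ^ 4)" by (rule fibre_pt)
  consider "z = 0" | "x = 0" "z \<noteq> 0" | "y = 0" "z \<noteq> 0" | "x \<noteq> 0" "y \<noteq> 0" "z \<noteq> 0" by blast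
  then show ?thesis
  proof cases
    case 1
    then have "x ^ 4 = y ^ 4 * - 1" "y \<noteq> 0" using assms(1,2) by (auto simp: eq_neg_iff_add_eq_0)
    then have "fibre (x ^ 4) (y ^ 4) (z ^ 4) = fibre (- 1) 1 0"
      using fibre_scale[of "y ^ 4" "- 1" 1 0] 1 by simp
    then show ?thesis using P unfolding family1_eq by blast
  next
    case 2
    then have "fibre (x ^ 4) (y ^ 4) (z ^ 4) = fibre 0 1 1"
      using fibre_scale[of "z ^ 4" 0 1 1] assms(2) by simp
    then show ?thesis using P unfolding family1_eq by blast
  next
    case 3
    then have "fibre (x ^ 4) (y ^ 4) (z ^ 4) = fibre 1 0 1"
      using fibre_scale[of "z ^ 4" 1 0 1] assms(2) by simp
    then show ?thesis using P unfolding family1_eq by blast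
  next
    case 4
    define l where "l = x ^ 4 / z ^ 4"
    have l: "1 - l = y ^ 4 / z ^ 4" unfolding l_def using assms(2) 4(3) by (simp add: field_simps)
    have "exceptional l (1 - l)" unfolding l unfolding l_def
      using exceptional_scale[OF assms(3), of "inverse (z ^ 4)"] by (simp add: divide_inverse)
    moreover have "l \<noteq> 0" unfolding l_def using 4 by simp
    moreover have "l \<noteq> 1" using l 4 by auto
    ultimately have "l \<in> ratios2 \<union> ratios3 \<union> ratios4" by (rule exceptional_imp_ratios)
    moreover have "pt x y z \<in> affine_fibre l"
      using P affine_fibre_scale[of "z ^ 4" "y ^ 4" "x ^ 4"] 4(3) assms(2) unfolding l_def by (simp add: algebra_simps)
    ultimately show ?thesis unfolding family2_eq family3_eq family4_eq by blast
  qed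
qed

section \<open>Fields over which the families are defined\<close>

definition pts_over :: "complex set \<Rightarrow> (complex \<times> complex \<times> complex) set set" where
  "pts_over M = {pt x y z | x y z. x \<in> M \<and> y \<in> M \<and> z \<in> M}"

lemma pts_overI: "\<lbrakk>x \<in> M; y \<in> M; z \<in> M\<rbrakk> \<Longrightarrow> pt x y z \<in> pts_over M"
  unfolding pts_over_def by blast

lemma zeta_4_in_Q_adj: "zeta 8 \<in> S \<Longrightarrow> zeta 4 \<in> Q_adj S"
proof -
  interpret complex_subfield "Q_adj S" by (rule complex_subfield_Q_adj)
  assume "zeta 8 \<in> S"
  then have "zeta 8 \<in> Q_adj S" using Q_adj_incl by blast
  then have "(zeta 8)\<^sup>2 \<in> Q_adj S" by simp
  then show ?thesis unfolding zeta_8_square zeta_4 .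
qed

lemma family1_pts_over: "family1 \<subseteq> pts_over (Q_adj {zeta 8})"
proof -
  interpret complex_subfield "Q_adj {zeta 8}" by (rule complex_subfield_Q_adj)
  have "zeta 8 \<in> Q_adj {zeta 8}" "zeta 4 \<in> Q_adj {zeta 8}" using zeta_4_in_Q_adj Q_adj_incl by blast+
  then show ?thesis unfolding family1_def by (auto intro!: pts_overI)
qed

lemma family2_pts_over: "family2 \<subseteq> pts_over (Q_adj {root4_2, zeta 8})"
proof -
  interpret complex_subfield "Q_adj {root4_2, zeta 8}" by (rule complex_subfield_Q_adj)
  have "zeta 8 \<in> Q_adj {root4_2, zeta 8}" "zeta 4 \<in> Q_adj {root4_2, zeta 8}" "root4_2 \<in> Q_adj {root4_2, zeta 8}"
    using zeta_4_in_Q_adj Q_adj_incl by blast+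
  then show ?thesis unfolding family2_def by (auto intro!: pts_overI)
qed

lemma family3_pts_over: "family3 \<subseteq> pts_over (Q_adj {zeta 3, zeta 8})"
proof -
  interpret complex_subfield "Q_adj {zeta 3, zeta 8}" by (rule complex_subfield_Q_adj)
  have "zeta 8 \<in> Q_adj {zeta 3, zeta 8}" "zeta 3 \<in> Q_adj {zeta 3, zeta 8}"
    using Q_adj_incl by blast+
  then show ?thesis unfolding family3_def by (auto intro!: pts_overI)
qed

lemma family4_pts_over: "family4 \<subseteq> pts_over (Q_adj {sqrt_m7, zeta 8})"
proof -
  interpret complex_subfield "Q_adj {sqrt_m7, zeta 8}" by (rule complex_subfield_Q_adj)
  have "zeta 8 \<in> Q_adj {sqrt_m7, zeta 8}" "zeta 4 \<in> Q_adj {sqrt_m7, zeta 8}" "sqrt_m7 \<in> Q_adj {sqrt_m7, zeta 8}"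
    using zeta_4_in_Q_adj Q_adj_incl by blast+
  moreover from this have "alpha \<in> Q_adj {sqrt_m7, zeta 8}" "alpha_bar \<in> Q_adj {sqrt_m7, zeta 8}"
    unfolding alpha_def alpha_bar_def by simp_all
  ultimately show ?thesis unfolding family4_def by (auto intro!: pts_overI)
qed

lemma pts_over_defined_over: "P \<in> pts_over (Q_adj S) \<Longrightarrow> defined_over P (Q_adj S)"
  unfolding pts_over_def defined_over_def using field_of_definition_subset[OF complex_subfield_Q_adj] by blast

lemma pts_over_quadratic:
  assumes "P \<in> pts_over (Q_adj S)" "s\<^sup>2 \<in> K8" "S \<subseteq> Q_adj (insert s K8)"
  shows "defined_over_quadratic_ext P K8"
  using assms(1) quadratic_ext_if_coords[OF assms(2,3)] unfolding pts_over_def by blast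

lemma families_quadratic:
  assumes "P \<in> family1 \<union> family2 \<union> family3 \<union> family4"
  shows "defined_over_quadratic_ext P K8"
proof -
  have incl: "insert s K8 \<subseteq> Q_adj (insert s K8)" for s by (rule Q_adj_incl)
  consider "P \<in> pts_over (Q_adj {zeta 8})" | "P \<in> pts_over (Q_adj {root4_2, zeta 8})"
    | "P \<in> pts_over (Q_adj {zeta 3, zeta 8})" | "P \<in> pts_over (Q_adj {sqrt_m7, zeta 8})"
    using assms family1_pts_over family2_pts_over family3_pts_over family4_pts_over by blast
  then show ?thesis
  proof cases
    case 1
    show ?thesis by (rule pts_over_quadratic[OF 1, of 1]) (use incl[of 1] zeta_8_in_K8 in auto)
  next
    case 2
    show ?thesis
      by (rule pts_over_quadratic[OF 2, of root4_2]) (use incl[of root4_2] zeta_8_in_K8 in \<open>auto simp: root4_2_power\<close>)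
  next
    case 3
    \<comment> \<open>This square root of -3 generates the same extension as \<open>zeta 3\<close>
      and has its square in K8.\<close>
    define s where "s = 2 * zeta 3 + 1"
    interpret N: complex_subfield "Q_adj (insert s K8)" by (rule complex_subfield_Q_adj)
    have "s\<^sup>2 = 4 * ((zeta 3)\<^sup>2 + zeta 3 + 1) - 3" unfolding s_def by (simp add: power2_eq_square algebra_simps)
    then have "s\<^sup>2 \<in> K8" unfolding zeta_3_eq by simp
    moreover have "s \<in> Q_adj (insert s K8)" using incl[of s] by blast
    then have "(s - 1) / 2 \<in> Q_adj (insert s K8)" by simp
    then have "zeta 3 \<in> Q_adj (insert s K8)" unfolding s_def by simp
    ultimately show ?thesis using incl[of s] zeta_8_in_K8 by (intro pts_over_quadratic[OF 3, of s]) auto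
  next
    case 4
    show ?thesis
      by (rule pts_over_quadratic[OF 4, of sqrt_m7]) (use incl[of sqrt_m7] zeta_8_in_K8 in \<open>auto simp: sqrt_m7_square\<close>)
  qed
qed

lemma fibre_subset_F4: "\<lbrakk>a + b = c; (a, b, c) \<noteq> (0, 0, 0)\<rbrakk> \<Longrightarrow> fibre a b c \<subseteq> F4"
  unfolding fibre_def using pt_in_F4_iff by fastforce

lemma families_subset_F4: "family1 \<union> family2 \<union> family3 \<union> family4 \<subseteq> F4"
proof -
  have "affine_fibre l \<subseteq> F4" for l by (rule fibre_subset_F4) auto
  moreover have "family1 \<subseteq> F4" unfolding family1_eq using fibre_subset_F4[of 0 1 1] fibre_subset_F4[of 1 0 1] fibre_subset_F4[of "- 1" 1 0] by simp
  ultimately show ?thesis unfolding family2_eq family3_eq family4_eq by blast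
qed

lemma quadratic_points_eq:
  "{P \<in> F4. defined_over_quadratic_ext P K8} = family1 \<union> family2 \<union> family3 \<union> family4"
proof
  show "{P \<in> F4. defined_over_quadratic_ext P K8} \<subseteq> family1 \<union> family2 \<union> family3 \<union> family4"
  proof (intro subsetI, elim CollectE conjE)
    fix P assume "P \<in> F4" and q: "defined_over_quadratic_ext P K8"
    then obtain x y z where P: "P = pt x y z" "(x, y, z) \<noteq> (0, 0, 0)" "x ^ 4 + y ^ 4 = z ^ 4" by (elim F4_E)
    then show "P \<in> family1 \<union> family2 \<union> family3 \<union> family4"
      using mem_families quadratic_point_imp_exceptional q by blast
  qed
  show "family1 \<union> family2 \<union> family3 \<union> family4 \<subseteq> {P \<in> F4. defined_over_quadratic_ext P K8}"
    using families_subset_F4 families_quadratic by blast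
qed

section \<open>Counting the points\<close>

lemma card_family1: "card family1 = 12" "finite family1"
proof -
  have "fibre (- 1) 1 0 = (\<lambda>x. pt x 1 0) ` {x. x ^ 4 = - 1}"
  proof
    show "fibre (- 1) 1 0 \<subseteq> (\<lambda>x. pt x 1 0) ` {x. x ^ 4 = - 1}"
    proof
      fix P assume "P \<in> fibre (- 1) 1 0"
      then obtain x y where P: "P = pt x y 0" "x ^ 4 = - 1" "y ^ 4 = 1" unfolding fibre_def by auto
      then have y: "y \<noteq> 0" by auto
      have "P = pt (x / y) 1 0" using P(1) pt_scale[of "inverse y" x y 0] y by (simp add: divide_inverse mult.commute)
      then show "P \<in> (\<lambda>x. pt x 1 0) ` {x. x ^ 4 = - 1}" using P by (auto simp: power_divide)
    qed
    show "(\<lambda>x. pt x 1 0) ` {x. x ^ 4 = - 1} \<subseteq> fibre (- 1) 1 0" unfolding fibre_def by force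
  qed
  moreover have "inj_on (\<lambda>x. pt x 1 0) {x. x ^ 4 = - 1}" by (rule inj_onI) (auto simp: pt_eq_iff)
  moreover have "finite {x::complex. x ^ 4 = - 1}" using finite_nth_roots[of 4 "- 1"] by simp
  ultimately have 3: "card (fibre (- 1) 1 0) = 4" "finite (fibre (- 1) 1 0)"
    using card_roots4(1)[of "- 1"] by (simp_all add: card_image)
  have 1: "card (fibre 0 1 1) = 4" "card (fibre 1 0 1) = 4" "finite (fibre 0 1 1)" "finite (fibre 1 0 1)"
    using card_fibre_1[of 0 1] card_fibre_1[of 1 0] card_roots4 by simp_all
  have "fibre 0 1 1 \<inter> fibre 1 0 1 = {}" "(fibre 0 1 1 \<union> fibre 1 0 1) \<inter> fibre (- 1) 1 0 = {}"
    by (auto elim: fibre_Int_E)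
  then show "card family1 = 12" "finite family1"
    unfolding family1_eq using 1 3 by (simp_all add: card_Un_disjoint)
qed

text \<open>Every cusp has a vanishing coordinate, whereas the points over an \<open>l\<close> other
  than 0 and 1 have none.\<close>

lemma family1_disjoint:
  assumes "A \<subseteq> ratios2 \<union> ratios3 \<union> ratios4" shows "family1 \<inter> (\<Union>l\<in>A. affine_fibre l) = {}"
proof (intro equals0I, elim IntE UN_E)
  fix P l assume P: "P \<in> family1" "l \<in> A" "P \<in> affine_fibre l"
  have l: "l \<noteq> 0" "l \<noteq> 1" using P(2) assms ratios_0_1 by blast+
  from P(1) show False
    unfolding family1_eq by (elim UnE; elim fibre_Int_E[OF P(3)]) (use l in auto)
qed

theorem theorem7p3:
  shows "{P \<in> F4. defined_over_quadratic_ext P (Q_adj {zeta 8})}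
           = family1 \<union> family2 \<union> family3 \<union> family4
    \<and> card family1 = 12 \<and> (\<forall>P\<in>family1. defined_over P (Q_adj {zeta 8}))
    \<and> card family2 = 48 \<and> (\<forall>P\<in>family2. defined_over P (Q_adj {root4_2, zeta 8}))
    \<and> card family3 = 32 \<and> (\<forall>P\<in>family3. defined_over P (Q_adj {zeta 3, zeta 8}))
    \<and> card family4 = 96 \<and> (\<forall>P\<in>family4. defined_over P (Q_adj {sqrt_m7, zeta 8}))
    \<and> card {P \<in> F4. defined_over_quadratic_ext P (Q_adj {zeta 8})} = 188"
proof -
  have c: "card family2 = 48" "card family3 = 32" "card family4 = 96"
    unfolding family2_eq family3_eq family4_eq
    using card_UN_affine_fibre(1)[OF finite_ratios(1)] card_UN_affine_fibre(1)[OF finite_ratios(2)] card_UN_affine_fibre(1)[OF finite_ratios(3)]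
      ratios_0_1 card_ratios by auto
  define A where "A = ratios2 \<union> ratios3 \<union> ratios4"
  have "card A = 11"
    unfolding A_def using ratios_disjoint card_ratios finite_ratios by (simp add: card_Un_disjoint)
  moreover have "finite A" unfolding A_def using finite_ratios by simp
  ultimately have "card (\<Union>l\<in>A. affine_fibre l) = 176" "finite (\<Union>l\<in>A. affine_fibre l)"
    using card_UN_affine_fibre[of A] ratios_0_1 unfolding A_def by simp_all
  moreover have "family1 \<union> family2 \<union> family3 \<union> family4 = family1 \<union> (\<Union>l\<in>A. affine_fibre l)"
    unfolding family2_eq family3_eq family4_eq A_def by blast
  ultimately have "card (family1 \<union> family2 \<union> family3 \<union> family4) = 188"
    using card_family1 family1_disjoint[of A] unfolding A_def by (simp add: card_Un_disjoint)
  moreover have "\<forall>P\<in>family1. defined_over P (Q_adj {zeta 8})" "\<forall>P\<in>family2. defined_over P (Q_adj {root4_2, zeta 8})"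
    "\<forall>P\<in>family3. defined_over P (Q_adj {zeta 3, zeta 8})" "\<forall>P\<in>family4. defined_over P (Q_adj {sqrt_m7, zeta 8})"
    using family1_pts_over family2_pts_over family3_pts_over family4_pts_over pts_over_defined_over by blast+
  ultimately show ?thesis
    using quadratic_points_eq c card_family1(1) unfolding Q_adj_zeta_8 by simp
qed

end
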